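(* Let $\mathcal H$ be a separable complex Krein space, $T\in S_1$ and $V\in L(\mathcal H)$. Then the following are equivalent: (i) for every signature operator $J$ of $\mathcal H$ and every $B_0\in L(\mathcal H)$ with $\operatorname{ran}B_0\subseteq\operatorname{ran}V$ there exists $\min_{X\in L(\mathcal H),\,VX=B_0}\operatorname{tr}_J(X^{\#}T^{\#}TX)$, and $T(\ker V)$ is a nonnegative subspace of $\mathcal H$; (ii) there exists a bounded global solution of the indefinite abstract spline problem, i.e., an operator $G\in L(\mathcal H)$ such that $Gh\in\operatorname{spl}(h)$ for every $h\in\mathcal H$; (iii) $T^{\#}T$ is $\ker V$-complementable and $T(\ker V)$ is a nonnegative subspace of $\mathcal H$; (iv) $\operatorname{spl}(h_0)$ is nonempty for every $h_0\in\mathcal H$. In this case, for every signature operator $J$ and every $B_0\in L(\mathcal H)$ with $\operatorname{ran}B_0\subseteq\operatorname{ran}V$, $$\min_{VX=B_0}\operatorname{tr}_J(X^{\#}T^{\#}TX)=\operatorname{tr}_J(X_0^{\#}T^{\#}TX_0)=\operatorname{tr}_J\big((V^{\dagger_J}B_0)^{\#}(T^{\#}T)_{/[\ker V]}(V^{\dagger_J}B_0)\big),$$ where $X_0$ is any solution of the equation $$(P^J_{\ker V})^{\#}T^{\#}T\big(P^J_{\ker V}X+V^{\dagger_J}B_0\big)=0.$$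
   Context: A Krein space is a complex vector space with an indefinite inner product $[\cdot,\cdot]$ admitting a $[\cdot,\cdot]$-orthogonal direct sum decomposition (fundamental decomposition) $\mathcal H=\mathcal H_+[\dotplus]\mathcal H_-$ with $(\mathcal H_+,[\cdot,\cdot])$ and $(\mathcal H_-,-[\cdot,\cdot])$ Hilbert spaces. The associated signature operator is $J=P_+-P_-$, where $P_\pm$ is the projection onto $\mathcal H_\pm$ along $\mathcal H_\mp$, and $\langle x,y\rangle_J=[Jx,y]$ is a Hilbert space inner product; all such inner products give equivalent norms. $L(\mathcal H)$ is the set of bounded linear operators on $\mathcal H$. $T^{\#}$ is the adjoint with respect to $[\cdot,\cdot]$. For $\mathcal S\subseteq\mathcal H$, $\mathcal S^{[\perp]}=\{h:[h,s]=0\ \forall s\in\mathcal S\}$. A subspace $\mathcal S$ is nonnegative if $[s,s]\ge0$ for all $s\in\mathcal S$. $S_1$ denotes the trace class operators with respect to $\langle\cdot,\cdot\rangle_J$ (independent of $J$). For $R\in S_1$, $\operatorname{tr}_J(R)=\sum_n[Re_n,e_n]=\operatorname{tr}(JR)$ for any orthonormal basis $\{e_n\}$ of $(\mathcal H,\langle\cdot,\cdot\rangle_J)$. $P^J_{\mathcal S}$ is the orthogonal projection onto a closed subspace $\mathcal S$, and $V^{\dagger_J}$ is the (possibly unbounded, densely defined) Moore–Penrose inverse of $V$, both in the Hilbert space $(\mathcal H,\langle\cdot,\cdot\rangle_J)$; when $\operatorname{ran}B_0\subseteq\operatorname{ran}V$, $V^{\dagger_J}B_0\in L(\mathcal H)$.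 For $h_0\in\mathcal H$, $\operatorname{spl}(h_0)=\{h\in h_0+\ker V:[Th,Th]=\min_{z\in\ker V}[T(h_0+z),T(h_0+z)]\}$. A selfadjoint operator $W=W^{\#}\in L(\mathcal H)$ is $\mathcal S$-complementable, for a closed subspace $\mathcal S$, if $\mathcal H=\mathcal S+(W\mathcal S)^{[\perp]}$. Schur complement: given a signature operator $J$, write the Hilbert space selfadjoint operator $JW$ in block form $\begin{pmatrix}a&b\\ b^*&c\end{pmatrix}$ with respect to $\mathcal S\oplus\mathcal S^{\perp_J}$; $W$ is $\mathcal S$-weakly complementable if $\operatorname{ran}b\subseteq\operatorname{ran}|a|^{1/2}$ (this is independent of $J$, and is implied by $\mathcal S$-complementability). Then, with $a=u|a|$ the polar decomposition and $f$ the unique bounded solution of $b=|a|^{1/2}f$ with $\operatorname{ran}f\subseteq\overline{\operatorname{ran}}\,|a|^{1/2}$, one sets $(JW)_{/\mathcal S}=\begin{pmatrix}0&0\\0&c-f^*uf\end{pmatrix}$ and $W_{/[\mathcal S]}=J(JW)_{/\mathcal S}$, which does not depend on $J$.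
   Formalization: X_0 ranges over bounded solutions of the equation that also satisfy V X_0 = B_0; without this the formula fails (for V = I every X_0 solves the equation). Existence of such an X_0 is also asserted. *)

theory Defs
  imports "HOL-Analysis.Analysis" "HOL-Library.Complex_Order"
begin

text \<open>
  Inequalities between complex numbers are those of \<^theory>\<open>HOL-Library.Complex_Order\<close>:
  \<open>z \<le> w\<close> means \<open>Re z \<le> Re w\<close> and \<open>Im z = Im w\<close>.
\<close>

section \<open>Krein spaces\<close>

class complex_vector = ab_group_add +
  fixes scaleC :: "complex \<Rightarrow> 'a \<Rightarrow> 'a" (infixr \<open>*\<^sub>C\<close> 75)
  assumes scaleC_add_right: "a *\<^sub>C (x + y) = a *\<^sub>C x + a *\<^sub>C y"
    and scaleC_add_left: "(a + b) *\<^sub>C x = a *\<^sub>C x + b *\<^sub>C x"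
    and scaleC_scaleC: "a *\<^sub>C b *\<^sub>C x = (a * b) *\<^sub>C x"
    and scaleC_one: "1 *\<^sub>C x = x"

global_interpretation cvec: vector_space "scaleC :: complex \<Rightarrow> 'a \<Rightarrow> 'a::complex_vector"
  by unfold_locales (fact scaleC_add_right scaleC_add_left scaleC_scaleC scaleC_one)+

class indefinite_inner = complex_vector +
  fixes kinner :: "'a \<Rightarrow> 'a \<Rightarrow> complex"
  assumes kinner_add_left: "kinner (x + y) z = kinner x z + kinner y z"
    and kinner_scaleC_left: "kinner (a *\<^sub>C x) y = a * kinner x y"
    and kinner_commute: "kinner x y = cnj (kinner y x)"

text \<open>
  The library's \<^term>\<open>cvec.subspace\<close>, restated because that constant is not available inside
  a class specification.
\<close>
definition (in complex_vector) csubspace :: "'a set \<Rightarrow> bool" where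
  "csubspace S \<longleftrightarrow> 0 \<in> S \<and> (\<forall>x\<in>S. \<forall>y\<in>S. x + y \<in> S) \<and> (\<forall>c. \<forall>x\<in>S. c *\<^sub>C x \<in> S)"

lemma csubspace_iff_subspace: "csubspace S \<longleftrightarrow> cvec.subspace S"
  by (simp add: csubspace_def cvec.subspace_def)

text \<open>\<open>(S, ip)\<close> is a Hilbert space, for a Hermitian sesquilinear form \<open>ip\<close> on the whole space.
  The absolute value has no effect on \<open>S\<close>; since \<open>ip\<close> may be indefinite outside of \<open>S\<close>, it is
  what makes \<^locale>\<open>Metric_space\<close> applicable, which requires a nonnegative function on the whole type.\<close>
definition (in complex_vector) hilbert_on :: "('a \<Rightarrow> 'a \<Rightarrow> complex) \<Rightarrow> 'a set \<Rightarrow> bool" where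
  "hilbert_on ip S \<longleftrightarrow> csubspace S \<and> (\<forall>x\<in>S. x \<noteq> 0 \<longrightarrow> 0 < ip x x) \<and>
     Metric_space.mcomplete S (\<lambda>x y. sqrt \<bar>Re (ip (x - y) (x - y))\<bar>)"

definition (in indefinite_inner) fundamental_decomposition :: "'a set \<Rightarrow> 'a set \<Rightarrow> bool" where
  "fundamental_decomposition Hp Hm \<longleftrightarrow>
     hilbert_on kinner Hp \<and> hilbert_on (\<lambda>x y. - kinner x y) Hm \<and>
     (\<forall>x\<in>Hp. \<forall>y\<in>Hm. kinner x y = 0) \<and>
     Hp \<inter> Hm = {0} \<and> (\<forall>h. \<exists>x\<in>Hp. \<exists>y\<in>Hm. h = x + y)"

class krein_space = indefinite_inner +
  assumes ex_fundamental_decomposition: "\<exists>Hp Hm. fundamental_decomposition Hp Hm"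

text \<open>Projection onto \<open>M\<close> along \<open>N\<close>, for a direct sum of \<open>M\<close> and \<open>N\<close>.\<close>
definition proj_along :: "'a::complex_vector set \<Rightarrow> 'a set \<Rightarrow> 'a \<Rightarrow> 'a" where
  "proj_along M N h = (THE x. x \<in> M \<and> h - x \<in> N)"

definition signature_op :: "('a::krein_space \<Rightarrow> 'a) \<Rightarrow> bool" where
  "signature_op J \<longleftrightarrow> (\<exists>Hp Hm. fundamental_decomposition Hp Hm \<and>
     J = (\<lambda>h. proj_along Hp Hm h - proj_along Hm Hp h))"

section \<open>The Hilbert space of a signature operator\<close>

definition jinner :: "('a::krein_space \<Rightarrow> 'a) \<Rightarrow> 'a \<Rightarrow> 'a \<Rightarrow> complex" where
  "jinner J x y = kinner (J x) y"

definition jnorm :: "('a::krein_space \<Rightarrow> 'a) \<Rightarrow> 'a \<Rightarrow> real" where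
  "jnorm J x = sqrt (Re (jinner J x x))"

definition jtopology :: "('a::krein_space \<Rightarrow> 'a) \<Rightarrow> 'a topology" where
  "jtopology J = Metric_space.mtopology UNIV (\<lambda>x y. jnorm J (x - y))"

text \<open>
  The norms \<open>jnorm J\<close> for the different signature operators \<open>J\<close> are equivalent, so that
  the choice of \<open>J\<close> is immaterial in the next two definitions.
\<close>
definition krein_separable :: "'a::krein_space itself \<Rightarrow> bool" where
  "krein_separable _ \<longleftrightarrow> (\<exists>J D. signature_op J \<and> countable D \<and>
     jtopology J closure_of D = (UNIV :: 'a set))"

definition bounded_op :: "('a::krein_space \<Rightarrow> 'a) \<Rightarrow> bool" where
  "bounded_op T \<longleftrightarrow> Vector_Spaces.linear scaleC scaleC T \<and>
     (\<exists>J. signature_op J \<and> (\<exists>M. \<forall>x. jnorm J (T x) \<le> M * jnorm J x))"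

abbreviation ker :: "('a::krein_space \<Rightarrow> 'a) \<Rightarrow> 'a set" where
  "ker V \<equiv> {x. V x = 0}"

definition jorth :: "('a::krein_space \<Rightarrow> 'a) \<Rightarrow> 'a set \<Rightarrow> 'a set" where
  "jorth J S = {h. \<forall>s\<in>S. jinner J h s = 0}"

text \<open>Orthogonal projection onto the closed subspace \<open>S\<close>.\<close>
definition jproj :: "('a::krein_space \<Rightarrow> 'a) \<Rightarrow> 'a set \<Rightarrow> 'a \<Rightarrow> 'a" where
  "jproj J S h = (THE x. x \<in> S \<and> h - x \<in> jorth J S)"

text \<open>
  Moore--Penrose inverse. Its domain is \<open>range V + jorth J (range V)\<close>; outside of it the value
  is unspecified.
\<close>
definition mp_inv :: "('a::krein_space \<Rightarrow> 'a) \<Rightarrow> ('a \<Rightarrow> 'a) \<Rightarrow> 'a \<Rightarrow> 'a" where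
  "mp_inv J V y = (THE x. x \<in> jorth J (ker V) \<and> y - V x \<in> jorth J (range V))"

definition jadj :: "('a::krein_space \<Rightarrow> 'a) \<Rightarrow> ('a \<Rightarrow> 'a) \<Rightarrow> 'a \<Rightarrow> 'a" where
  "jadj J A = (THE B. \<forall>x y. jinner J (A x) y = jinner J x (B y))"

definition positive_op :: "('a::krein_space \<Rightarrow> 'a) \<Rightarrow> ('a \<Rightarrow> 'a) \<Rightarrow> bool" where
  "positive_op J A \<longleftrightarrow> bounded_op A \<and> (\<forall>x. 0 \<le> jinner J (A x) x)"

definition sqrt_op :: "('a::krein_space \<Rightarrow> 'a) \<Rightarrow> ('a \<Rightarrow> 'a) \<Rightarrow> 'a \<Rightarrow> 'a" where
  "sqrt_op J A = (THE B. positive_op J B \<and> B \<circ> B = A)"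

definition abs_op :: "('a::krein_space \<Rightarrow> 'a) \<Rightarrow> ('a \<Rightarrow> 'a) \<Rightarrow> 'a \<Rightarrow> 'a" where
  "abs_op J A = sqrt_op J (jadj J A \<circ> A)"

definition partial_isometry :: "('a::krein_space \<Rightarrow> 'a) \<Rightarrow> ('a \<Rightarrow> 'a) \<Rightarrow> bool" where
  "partial_isometry J U \<longleftrightarrow> bounded_op U \<and> (\<forall>x\<in>jorth J (ker U). jnorm J (U x) = jnorm J x)"

text \<open>The partial isometry of the polar decomposition \<open>A = U |A|\<close>.\<close>
definition polar_op :: "('a::krein_space \<Rightarrow> 'a) \<Rightarrow> ('a \<Rightarrow> 'a) \<Rightarrow> 'a \<Rightarrow> 'a" where
  "polar_op J A = (THE U. partial_isometry J U \<and> ker U = ker A \<and> A = U \<circ> abs_op J A)"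

section \<open>Trace class operators and the trace\<close>

definition orthonormal_basis :: "('a::krein_space \<Rightarrow> 'a) \<Rightarrow> 'a set \<Rightarrow> bool" where
  "orthonormal_basis J E \<longleftrightarrow> (\<forall>e\<in>E. \<forall>f\<in>E. jinner J e f = (if e = f then 1 else 0)) \<and>
     jtopology J closure_of (cvec.span E) = UNIV"

text \<open>Neither the choice of \<open>J\<close> nor that of the orthonormal basis matters here.\<close>
definition trace_class :: "('a::krein_space \<Rightarrow> 'a) \<Rightarrow> bool" where
  "trace_class R \<longleftrightarrow> bounded_op R \<and> (\<exists>J E. signature_op J \<and> orthonormal_basis J E \<and>
     (\<lambda>e. jinner J (abs_op J R e) e) summable_on E)"

definition tr :: "('a::krein_space \<Rightarrow> 'a) \<Rightarrow> ('a \<Rightarrow> 'a) \<Rightarrow> complex" where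
  "tr J R = (THE t. \<forall>E. orthonormal_basis J E \<longrightarrow> ((\<lambda>e. kinner (R e) e) has_sum t) E)"

section \<open>Krein space notions\<close>

definition kadj :: "('a::krein_space \<Rightarrow> 'a) \<Rightarrow> 'a \<Rightarrow> 'a" (\<open>_\<^sup>#\<close> [1000] 999) where
  "T\<^sup># = (THE B. \<forall>x y. kinner (T x) y = kinner x (B y))"

definition korth :: "'a::krein_space set \<Rightarrow> 'a set" where
  "korth S = {h. \<forall>s\<in>S. kinner h s = 0}"

definition nonneg_subspace :: "'a::krein_space set \<Rightarrow> bool" where
  "nonneg_subspace S \<longleftrightarrow> cvec.subspace S \<and> (\<forall>s\<in>S. 0 \<le> kinner s s)"

definition complementable :: "('a::krein_space \<Rightarrow> 'a) \<Rightarrow> 'a set \<Rightarrow> bool" where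
  "complementable W S \<longleftrightarrow> (\<forall>h. \<exists>s\<in>S. \<exists>t\<in>korth (W ` S). h = s + t)"

text \<open>
  The Schur complement computed with a given signature operator. The blocks of \<open>J \<circ> W\<close>, and the
  operators derived from them, are taken as operators on the whole space, extended by zero.
  The operator \<open>f\<close> exists exactly if \<open>W\<close> is \<open>S\<close>-weakly complementable, that is,
  if \<open>range b\<close> is contained in \<open>range r\<close>.
\<close>
definition schur_wrt ::
  "('a::krein_space \<Rightarrow> 'a) \<Rightarrow> ('a \<Rightarrow> 'a) \<Rightarrow> 'a set \<Rightarrow> 'a \<Rightarrow> 'a" where
  "schur_wrt J W S =
    (let P = jproj J S; Q = (\<lambda>x. x - P x);
         a = P \<circ> J \<circ> W \<circ> P; b = P \<circ> J \<circ> W \<circ> Q; c = Q \<circ> J \<circ> W \<circ> Q;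
         r = sqrt_op J (abs_op J a); u = polar_op J a;
         f = (THE f. bounded_op f \<and> b = r \<circ> f \<and> range f \<subseteq> jtopology J closure_of range r)
     in J \<circ> (\<lambda>x. c x - jadj J f (u (f x))))"

text \<open>The common value, over all signature operators, of the Schur complement.\<close>
definition schur :: "('a::krein_space \<Rightarrow> 'a) \<Rightarrow> 'a set \<Rightarrow> 'a \<Rightarrow> 'a" where
  "schur W S = (THE C. \<forall>J. signature_op J \<longrightarrow> C = schur_wrt J W S)"

definition is_minimum :: "'b::order \<Rightarrow> 'b set \<Rightarrow> bool" where
  "is_minimum m A \<longleftrightarrow> m \<in> A \<and> (\<forall>a\<in>A. m \<le> a)"

definition spl :: "('a::krein_space \<Rightarrow> 'a) \<Rightarrow> ('a \<Rightarrow> 'a) \<Rightarrow> 'a \<Rightarrow> 'a set" where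
  "spl T V h0 = {h. (\<exists>k\<in>ker V. h = h0 + k) \<and>
     is_minimum (kinner (T h) (T h)) {kinner (T (h0 + z)) (T (h0 + z)) |z. z \<in> ker V}}"

text \<open>The values over which the trace is minimised.\<close>
definition trace_values ::
  "('a::krein_space \<Rightarrow> 'a) \<Rightarrow> ('a \<Rightarrow> 'a) \<Rightarrow> ('a \<Rightarrow> 'a) \<Rightarrow> ('a \<Rightarrow> 'a) \<Rightarrow> complex set" where
  "trace_values J T V B = {tr J (X\<^sup># \<circ> T\<^sup># \<circ> T \<circ> X) |X. bounded_op X \<and> V \<circ> X = B}"

end

theory Submission
  imports Defs
begin

text \<open>
  Write \<open>W = T\<^sup># T\<close> and \<open>S = ker V\<close>. A vector \<open>h\<close> minimizes \<open>[T \<cdot>, T \<cdot>]\<close> on \<open>h + S\<close> iff \<open>T S\<close> is nonnegative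
  and \<open>h\<close> lies in the companion \<open>(W S)\<^sup>[\<^sup>\<bottom>\<^sup>]\<close>; so the spline problem is solvable everywhere iff \<open>T S\<close> is
  nonnegative and \<open>S\<close> together with the companion spans the space. In that case
  \<open>ran P J W \<subseteq> ran P J W P\<close> for the orthogonal projection \<open>P\<close> onto \<open>S\<close>, and Douglas' lemma
  provides a bounded choice \<open>G h\<close> of splines. As \<open>T X\<close> is a Hilbert--Schmidt operator,
  \<open>tr\<^sub>J (X\<^sup># W X) = \<Sum> [T X e, T X e]\<close> converges and does not depend on the orthonormal basis; therefore
  the trace is minimized by minimizing every summand, which \<open>X = G V\<^sup>\<dagger> B\<^sub>0\<close> does, and the Schur complement
  is \<open>W G\<close>. Conversely, rank one perturbations of a minimizer for \<open>B\<^sub>0 = V\<close> yield splines.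
\<close>

section \<open>Indefinite inner products and linear maps\<close>

text \<open>Boundedness and trace class are defined through some unspecified signature operator, so
  the Hilbert space theory is built over an arbitrary \<open>J\<close>, and equivalence of the norms
  makes the choice immaterial. That equivalence rests on uniform boundedness, which also yields
  Douglas' lemma by way of an estimate for adjoints.

  The terms [T X e, T X e] have no fixed sign, while \<open>tr\<close> is a description that demands
  the same sum over every orthonormal basis. The form is therefore written as a difference of two
  squared norms, and for squared norms Tonelli's theorem applies to the matrix coefficients.

  The Schur complement becomes tractable because nonnegativity of T(ker V) makes the block
  \<open>a\<close> positive: it is its own absolute value, and its polar factor is an orthogonal
  projection. Splines need not be unique, but their images under T^# T are, so the choice of G does
  not affect the formula.\<close>

lemma kinner_add_right: "kinner x (y + z) = kinner x y + kinner x z"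
  using kinner_add_left[of y z x] by (metis complex_cnj_add kinner_commute)

lemma kinner_scaleC_right: "kinner x (c *\<^sub>C y) = cnj c * kinner x y"
  using kinner_scaleC_left[of c y x] by (metis complex_cnj_mult kinner_commute)

lemma kinner_zero_left [simp]: "kinner 0 y = 0"
  using kinner_scaleC_left[of 0 0 y] by simp

lemma kinner_zero_right [simp]: "kinner x 0 = 0"
  using kinner_scaleC_right[of x 0 0] by simp

lemma kinner_minus_left [simp]: "kinner (- x) y = - kinner x y"
  using kinner_add_left[of x "- x" y] by (simp add: eq_neg_iff_add_eq_0 add.commute)

lemma kinner_minus_right [simp]: "kinner x (- y) = - kinner x y"
  using kinner_add_right[of x y "- y"] by (simp add: eq_neg_iff_add_eq_0 add.commute)

lemma kinner_diff_left: "kinner (x - y) z = kinner x z - kinner y z"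
  using kinner_add_left[of x "- y" z] by simp

lemma kinner_diff_right: "kinner x (y - z) = kinner x y - kinner x z"
  using kinner_add_right[of x y "- z"] by simp

lemma Im_kinner_self [simp]: "Im (kinner x x) = 0"
  using kinner_commute[of x x] by (metis cnj.simps(2) equal_neg_zero)

lemma kinner_self_eq: "kinner x x = of_real (Re (kinner x x))"
  by (simp add: complex_eq_iff)

lemma kinner_nonneg_iff: "0 \<le> kinner x x \<longleftrightarrow> 0 \<le> Re (kinner x x)"
  by (simp add: less_eq_complex_def)

lemmas kinner_simps = kinner_add_left kinner_add_right kinner_scaleC_left kinner_scaleC_right
  kinner_diff_left kinner_diff_right

abbreviation clinear :: "('a::complex_vector \<Rightarrow> 'b::complex_vector) \<Rightarrow> bool" where
  "clinear \<equiv> Vector_Spaces.linear scaleC scaleC"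

lemma clinear_iff:
  "clinear A \<longleftrightarrow> (\<forall>x y. A (x + y) = A x + A y) \<and> (\<forall>c x. A (c *\<^sub>C x) = c *\<^sub>C A x)"
  by (auto simp: Vector_Spaces.linear_iff cvec.vector_space_axioms)

lemma clinearI:
  assumes "\<And>x y. A (x + y) = A x + A y" and "\<And>c x. A (c *\<^sub>C x) = c *\<^sub>C A x"
  shows "clinear A"
  using assms by (simp add: clinear_iff)

lemma clinear_add: "clinear A \<Longrightarrow> A (x + y) = A x + A y"
  by (simp add: clinear_iff)

lemma clinear_scale: "clinear A \<Longrightarrow> A (c *\<^sub>C x) = c *\<^sub>C A x"
  by (simp add: clinear_iff)

lemma clinear_zero: "clinear A \<Longrightarrow> A 0 = 0"
  using clinear_add[of A 0 0] by simp

lemma clinear_minus: "clinear A \<Longrightarrow> A (- x) = - A x"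
  using clinear_scale[of A "-1" x] by simp

lemma clinear_diff: "clinear A \<Longrightarrow> A (x - y) = A x - A y"
  using clinear_add[of A x "- y"] by (simp add: clinear_minus)

lemmas clinear_simps = clinear_add clinear_scale clinear_zero clinear_minus clinear_diff

lemma clinear_comp: "clinear A \<Longrightarrow> clinear B \<Longrightarrow> clinear (\<lambda>x. A (B x))"
  by (simp add: clinear_iff)

lemma subspace_ker: "clinear A \<Longrightarrow> cvec.subspace (ker A)"
  by (simp add: cvec.subspace_def clinear_simps)

lemma subspace_image: "clinear A \<Longrightarrow> cvec.subspace S \<Longrightarrow> cvec.subspace (A ` S)"
  unfolding cvec.subspace_def
  by (auto simp: image_iff) (metis clinear_zero, metis clinear_add, metis clinear_scale)

text \<open>In the applications \<open>m\<close> is the squared modulus of a complex number q, and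
  the quadratic comes from a displacement by t q times a vector; hence \<open>m\<close> occurs in
  both coefficients. For \<open>b > 0\<close> the minimum is at \<open>t = 1 / b\<close>; for
  \<open>b = 0\<close> the expression is affine, so its slope vanishes.\<close>

lemma real_quadratic_discriminant:
  fixes a b m :: real
  assumes nonneg: "\<And>t. 0 \<le> a - 2 * t * m + t\<^sup>2 * (m * b)" and "0 \<le> b" and "0 \<le> m"
  shows "m \<le> a * b"
proof (cases "b = 0")
  case True
  have "m = 0"
  proof (rule ccontr)
    assume "m \<noteq> 0"
    then have "0 \<le> a - (a + 1)"
      using nonneg[of "(a + 1) / (2 * m)"] True by simp
    then show False by simp
  qed
  then show ?thesis using True by simp
next
  case False
  then have b: "0 < b" using assms by simp
  have "0 \<le> a - 2 * (1 / b) * m + (1 / b)\<^sup>2 * (m * b)"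
    by (rule nonneg)
  also have "\<dots> = a - m / b"
    using b by (simp add: power2_eq_square)
  finally have "m / b \<le> a" by simp
  then show ?thesis using b by (simp add: field_simps)
qed

text \<open>The form [A x, y] is only assumed semidefinite, so that two cases are covered:
  \<open>A = J\<close> gives the inequality for \<open>jinner\<close>, and \<open>J\<close> composed
  with a positive operator the one behind \<open>jnorm_sq_le_positive\<close>.\<close>

lemma kinner_Cauchy_Schwarz:
  assumes A: "clinear A" and sym: "\<And>x y. kinner (A x) y = kinner x (A y)"
    and pos: "\<And>x. 0 \<le> Re (kinner (A x) x)"
  shows "(cmod (kinner (A x) y))\<^sup>2 \<le> Re (kinner (A x) x) * Re (kinner (A y) y)"
proof (rule real_quadratic_discriminant)
  fix t :: real
  let ?c = "kinner (A x) y"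
  have swap: "kinner (A y) x = cnj ?c"
    by (metis sym kinner_commute)
  have real: "Im (kinner (A y) y) = 0"
    using sym[of y y] kinner_commute[of y "A y"] by (simp add: complex_eq_iff)
  have "0 \<le> Re (kinner (A (x - (of_real t * ?c) *\<^sub>C y)) (x - (of_real t * ?c) *\<^sub>C y))"
    by (rule pos)
  also have "kinner (A (x - (of_real t * ?c) *\<^sub>C y)) (x - (of_real t * ?c) *\<^sub>C y)
    = kinner (A x) x - 2 * of_real t * (?c * cnj ?c)
      + of_real (t\<^sup>2) * ((?c * cnj ?c) * kinner (A y) y)"
    by (simp add: clinear_simps[OF A] kinner_simps swap algebra_simps power2_eq_square)
  also have "Re \<dots> = Re (kinner (A x) x) - 2 * t * (cmod ?c)\<^sup>2
    + t\<^sup>2 * ((cmod ?c)\<^sup>2 * Re (kinner (A y) y))"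
    by (simp add: complex_norm_square[symmetric] real)
  finally show "0 \<le> Re (kinner (A x) x) - 2 * t * (cmod ?c)\<^sup>2
    + t\<^sup>2 * ((cmod ?c)\<^sup>2 * Re (kinner (A y) y))" .
qed (use pos in auto)

section \<open>The inner product of a signature operator\<close>

lemma tendsto_zero_le:
  fixes f g :: "nat \<Rightarrow> real"
  assumes "\<And>n. 0 \<le> f n" and "\<And>n. f n \<le> g n" and "g \<longlonglongrightarrow> 0"
  shows "f \<longlonglongrightarrow> 0"
  by (rule Lim_null_comparison[OF _ assms(3)]) (simp add: assms)

lemma signature_op_decomposition:
  assumes "signature_op J"
  obtains Hp Hm where "fundamental_decomposition Hp Hm"
    and "\<And>p m. p \<in> Hp \<Longrightarrow> m \<in> Hm \<Longrightarrow> J (p + m) = p - m"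
proof -
  from assms obtain Hp Hm where fd: "fundamental_decomposition Hp Hm"
    and J: "J = (\<lambda>h. proj_along Hp Hm h - proj_along Hm Hp h)"
    by (auto simp: signature_op_def)
  have sub: "cvec.subspace Hp" "cvec.subspace Hm" and int: "Hp \<inter> Hm = {0}"
    using fd by (auto simp: fundamental_decomposition_def hilbert_on_def csubspace_iff_subspace)
  have proj: "proj_along M N (p + m) = p"
    if "cvec.subspace M" "cvec.subspace N" "M \<inter> N = {0}" "p \<in> M" "m \<in> N" for M N and p m :: 'a
    unfolding proj_along_def
  proof (rule the_equality)
    show "p \<in> M \<and> p + m - p \<in> N" using that by simp
  next
    fix x assume x: "x \<in> M \<and> p + m - x \<in> N"
    have "p - x \<in> M" using x that cvec.subspace_diff by blast
    moreover have "p - x \<in> N"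
      using cvec.subspace_diff[OF that(2), of "p + m - x" m] x that by simp
    ultimately have "p - x \<in> {0}" using that(3) by blast
    then show "x = p" by simp
  qed
  have "J (p + m) = p - m" if "p \<in> Hp" "m \<in> Hm" for p m
  proof -
    have "proj_along Hm Hp (p + m) = m"
      using proj[OF sub(2,1) _ that(2,1)] int by (metis Int_commute add.commute)
    then show ?thesis using proj[OF sub int that] by (simp add: J)
  qed
  with fd show ?thesis using that by blast
qed

lemma Metric_space_complete_limit:
  assumes "Metric_space M d" and "Metric_space.mcomplete M d" and "range s \<subseteq> M"
    and "\<And>e. e > 0 \<Longrightarrow> \<exists>N. \<forall>m\<ge>N. \<forall>n\<ge>N. d (s m) (s n) < e"
  shows "\<exists>l\<in>M. (\<lambda>n. d (s n) l) \<longlonglongrightarrow> 0"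
proof -
  interpret Metric_space M d by fact
  have "MCauchy s" unfolding MCauchy_def
  proof (intro conjI allI impI assms(3))
    fix e :: real assume "0 < e"
    from assms(4)[OF this]
    show "\<exists>N. \<forall>n n'. N \<le> n \<longrightarrow> N \<le> n' \<longrightarrow> d (s n) (s n') < e" by blast
  qed
  then obtain l where l: "limitin mtopology s l sequentially"
    using assms(2) unfolding mcomplete_def by presburger
  then show ?thesis
    by (intro bexI[of _ l]) (simp_all add: limitin_metric_dist_null)
qed

text \<open>Several signature operators occur side by side, the given one and those hidden in
  \<open>bounded_op\<close> and \<open>trace_class\<close>; the locale is interpreted for each of
  them.\<close>

locale signature =
  fixes J :: "'a::krein_space \<Rightarrow> 'a"
  assumes signature_op: "signature_op J"
begin

lemma J_invol [simp]: "J (J x) = x"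
  and clinear_J: "clinear J"
  and J_sym: "kinner (J x) y = kinner x (J y)"
  and jinner_pos: "x \<noteq> 0 \<Longrightarrow> 0 < Re (jinner J x x)"
proof -
  obtain Hp Hm where fd: "fundamental_decomposition Hp Hm"
    and J: "\<And>p m. p \<in> Hp \<Longrightarrow> m \<in> Hm \<Longrightarrow> J (p + m) = p - m"
    using signature_op_decomposition[OF signature_op] by blast
  have sp: "cvec.subspace Hp" and sm: "cvec.subspace Hm" and orth: "\<And>p m. p \<in> Hp \<Longrightarrow> m \<in> Hm \<Longrightarrow> kinner p m = 0"
    and dec: "\<And>h. \<exists>p\<in>Hp. \<exists>m\<in>Hm. h = p + m"
    and pp: "\<And>p. p \<in> Hp \<Longrightarrow> p \<noteq> 0 \<Longrightarrow> 0 < kinner p p"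
    and mm: "\<And>m. m \<in> Hm \<Longrightarrow> m \<noteq> 0 \<Longrightarrow> kinner m m < 0"
    using fd by (auto simp: fundamental_decomposition_def hilbert_on_def csubspace_iff_subspace)
  have orth': "kinner m p = 0" if "p \<in> Hp" "m \<in> Hm" for p m
    using orth[OF that] kinner_commute[of m p] by simp
  show "J (J x) = x"
  proof -
    obtain p m where "p \<in> Hp" "m \<in> Hm" "x = p + m" using dec by blast
    then show ?thesis using J[of p m] J[of p "- m"] cvec.subspace_neg[OF sm] by simp
  qed
  show "clinear J"
  proof (rule clinearI)
    fix x y
    obtain p m where x: "p \<in> Hp" "m \<in> Hm" "x = p + m" using dec by blast
    obtain p' m' where y: "p' \<in> Hp" "m' \<in> Hm" "y = p' + m'" using dec by blast
    have "J ((p + p') + (m + m')) = (p + p') - (m + m')"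
      using x y J cvec.subspace_add sp sm by blast
    moreover have "J x = p - m" "J y = p' - m'" using x y J by blast+
    moreover have "x + y = (p + p') + (m + m')" using x y by simp
    ultimately show "J (x + y) = J x + J y" by simp
  next
    fix c x
    obtain p m where x: "p \<in> Hp" "m \<in> Hm" "x = p + m" using dec by blast
    have "J (c *\<^sub>C p + c *\<^sub>C m) = c *\<^sub>C p - c *\<^sub>C m"
      using x J cvec.subspace_scale sp sm by blast
    moreover have "J x = p - m" using x J by blast
    ultimately show "J (c *\<^sub>C x) = c *\<^sub>C J x" using x
      by (simp add: cvec.scale_right_distrib cvec.scale_right_diff_distrib)
  qed
  show "kinner (J x) y = kinner x (J y)"
  proof -
    obtain p m where x: "p \<in> Hp" "m \<in> Hm" "x = p + m" using dec by blast
    obtain p' m' where y: "p' \<in> Hp" "m' \<in> Hm" "y = p' + m'" using dec by blast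
    show ?thesis using x y by (simp add: J kinner_simps orth orth')
  qed
  show "0 < Re (jinner J x x)" if "x \<noteq> 0"
  proof -
    obtain p m where x: "p \<in> Hp" "m \<in> Hm" "x = p + m" using dec by blast
    have "jinner J x x = kinner p p - kinner m m"
      using x by (simp add: jinner_def J kinner_simps orth orth')
    moreover have "p \<noteq> 0 \<or> m \<noteq> 0" using that x by auto
    moreover have "0 \<le> Re (kinner p p)" "p \<noteq> 0 \<Longrightarrow> 0 < Re (kinner p p)"
      using pp[of p] x by (cases "p = 0"; simp add: less_complex_def)+
    moreover have "Re (kinner m m) \<le> 0" "m \<noteq> 0 \<Longrightarrow> Re (kinner m m) < 0"
      using mm[of m] x by (cases "m = 0"; simp add: less_complex_def)+
    ultimately show ?thesis by auto
  qed
qed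

lemma jinner_add_left: "jinner J (x + y) z = jinner J x z + jinner J y z"
  and jinner_add_right: "jinner J x (y + z) = jinner J x y + jinner J x z"
  and jinner_diff_left: "jinner J (x - y) z = jinner J x z - jinner J y z"
  and jinner_diff_right: "jinner J x (y - z) = jinner J x y - jinner J x z"
  and jinner_scale_left: "jinner J (c *\<^sub>C x) y = c * jinner J x y"
  and jinner_scale_right: "jinner J x (c *\<^sub>C y) = cnj c * jinner J x y"
  and jinner_zero_left [simp]: "jinner J 0 y = 0"
  and jinner_zero_right [simp]: "jinner J x 0 = 0"
  and jinner_minus_left [simp]: "jinner J (- x) y = - jinner J x y"
  and jinner_minus_right [simp]: "jinner J x (- y) = - jinner J x y"
  by (simp_all add: jinner_def clinear_simps[OF clinear_J] kinner_simps)

lemmas jinner_simps = jinner_add_left jinner_add_right jinner_diff_left jinner_diff_right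
  jinner_scale_left jinner_scale_right

lemma jinner_commute: "jinner J x y = cnj (jinner J y x)"
  unfolding jinner_def by (metis J_sym kinner_commute)

lemma kinner_eq_jinner: "kinner x y = jinner J (J x) y" "kinner x y = jinner J x (J y)"
  by (simp_all add: jinner_def J_sym)

lemma jinner_J_J [simp]: "jinner J (J x) (J y) = jinner J x y"
  by (simp add: jinner_def J_sym)

lemma jnorm_nonneg [simp]: "0 \<le> jnorm J x"
  using jinner_pos[of x] by (cases "x = 0") (simp_all add: jnorm_def)

lemma jnorm_sq: "(jnorm J x)\<^sup>2 = Re (jinner J x x)"
  using jinner_pos[of x] by (cases "x = 0") (simp_all add: jnorm_def)

lemma jinner_self: "jinner J x x = of_real ((jnorm J x)\<^sup>2)"
  using jinner_commute[of x x] by (simp add: jnorm_sq complex_eq_iff)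

lemma jnorm_eq_0 [simp]: "jnorm J x = 0 \<longleftrightarrow> x = 0"
  using jinner_pos[of x] by (cases "x = 0") (auto simp: jnorm_def)

lemma jnorm_pos: "x \<noteq> 0 \<Longrightarrow> 0 < jnorm J x"
  using jnorm_nonneg[of x] jnorm_eq_0[of x] by linarith

lemma jnorm_zero [simp]: "jnorm J 0 = 0"
  by simp

lemma jinner_self_eq_0 [simp]: "jinner J x x = 0 \<longleftrightarrow> x = 0"
  by (simp add: jinner_self)

lemma jnorm_scale [simp]: "jnorm J (c *\<^sub>C x) = cmod c * jnorm J x"
proof -
  have "(jnorm J (c *\<^sub>C x))\<^sup>2 = Re ((c * cnj c) * jinner J x x)"
    by (simp add: jnorm_sq jinner_simps algebra_simps)
  also have "\<dots> = (cmod c * jnorm J x)\<^sup>2"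
    by (simp add: complex_norm_square[symmetric] jinner_self power_mult_distrib)
  finally show ?thesis by (simp add: power2_eq_iff_nonneg)
qed

lemma jnorm_minus [simp]: "jnorm J (- x) = jnorm J x"
  using jnorm_scale[of "-1" x] by simp

lemma jnorm_J [simp]: "jnorm J (J x) = jnorm J x"
  by (simp add: jnorm_def)

lemma jnorm_commute: "jnorm J (x - y) = jnorm J (y - x)"
  using jnorm_minus[of "x - y"] by simp

lemma jinner_Cauchy_Schwarz: "cmod (jinner J x y) \<le> jnorm J x * jnorm J y"
proof -
  have "(cmod (jinner J x y))\<^sup>2 \<le> (jnorm J x * jnorm J y)\<^sup>2"
    using kinner_Cauchy_Schwarz[OF clinear_J J_sym, of x y]
    by (simp add: power_mult_distrib jnorm_sq jinner_def[symmetric])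
      (metis jnorm_sq zero_le_power2)
  then show ?thesis by (meson jnorm_nonneg mult_nonneg_nonneg power2_le_imp_le)
qed

lemma jnorm_add_sq: "(jnorm J (x + y))\<^sup>2 = (jnorm J x)\<^sup>2 + (jnorm J y)\<^sup>2 + 2 * Re (jinner J x y)"
  using jinner_commute[of y x] by (simp add: jnorm_sq jinner_simps)

lemma jnorm_diff_sq: "(jnorm J (x - y))\<^sup>2 = (jnorm J x)\<^sup>2 + (jnorm J y)\<^sup>2 - 2 * Re (jinner J x y)"
  using jnorm_add_sq[of x "- y"] by simp

lemma jnorm_triangle: "jnorm J (x + y) \<le> jnorm J x + jnorm J y"
proof (rule power2_le_imp_le)
  have "Re (jinner J x y) \<le> jnorm J x * jnorm J y"
    using jinner_Cauchy_Schwarz[of x y] complex_Re_le_cmod order_trans by blast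
  then show "(jnorm J (x + y))\<^sup>2 \<le> (jnorm J x + jnorm J y)\<^sup>2"
    by (simp add: jnorm_add_sq power2_sum)
qed simp

lemma jnorm_triangle_diff: "jnorm J (x - z) \<le> jnorm J (x - y) + jnorm J (y - z)"
  using jnorm_triangle[of "x - y" "y - z"] by simp

lemma jnorm_triangle_sub: "jnorm J x \<le> jnorm J y + jnorm J (x - y)"
  using jnorm_triangle[of y "x - y"] by simp

lemma Metric_space_jnorm: "Metric_space UNIV (\<lambda>x y. jnorm J (x - y))"
  by unfold_locales (auto simp: jnorm_commute jnorm_triangle_diff)

lemma jtopology_closure_of:
  "jtopology J closure_of S = {x. \<forall>r>0. \<exists>y\<in>S. jnorm J (x - y) < r}"
  by (simp add: jtopology_def Metric_space.metric_closure_of[OF Metric_space_jnorm]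
      Metric_space.in_mball[OF Metric_space_jnorm])

text \<open>On the two summands of the decomposition the norm of \<open>J\<close> comes from plus or
  minus the form, and the summands are \<open>J\<close>-orthogonal. So the components of a Cauchy
  sequence are Cauchy in complete spaces.\<close>

lemma jnorm_complete:
  assumes Cauchy: "\<And>e. e > 0 \<Longrightarrow> \<exists>N. \<forall>m\<ge>N. \<forall>n\<ge>N. jnorm J (s m - s n) < e"
  obtains l where "(\<lambda>n. jnorm J (s n - l)) \<longlonglongrightarrow> 0"
proof -
  obtain Hp Hm where fd: "fundamental_decomposition Hp Hm"
    and J: "\<And>p m. p \<in> Hp \<Longrightarrow> m \<in> Hm \<Longrightarrow> J (p + m) = p - m"
    using signature_op_decomposition[OF signature_op] by blast
  have sp: "cvec.subspace Hp" and sm: "cvec.subspace Hm"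
    and orth: "\<And>p m. p \<in> Hp \<Longrightarrow> m \<in> Hm \<Longrightarrow> kinner p m = 0"
    and dec: "\<And>h. \<exists>p\<in>Hp. \<exists>m\<in>Hm. h = p + m"
    and cp: "Metric_space.mcomplete Hp (\<lambda>x y. sqrt \<bar>Re (kinner (x - y) (x - y))\<bar>)"
    and cm: "Metric_space.mcomplete Hm (\<lambda>x y. sqrt \<bar>Re (- kinner (x - y) (x - y))\<bar>)"
    using fd by (auto simp: fundamental_decomposition_def hilbert_on_def csubspace_iff_subspace)
  have Jp: "J p = p" if "p \<in> Hp" for p
    using J[OF that cvec.subspace_0[OF sm]] by simp
  have Jm: "J m = - m" if "m \<in> Hm" for m
    using J[OF cvec.subspace_0[OF sp] that] by simp
  \<comment> \<open>One argument for both summands: the absolute value lets the same distance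
    describe \<open>Hm\<close>, where the form is negative.\<close>
  have lim: "\<exists>l\<in>M. (\<lambda>n. jnorm J (t n - l)) \<longlonglongrightarrow> 0"
    if sM: "cvec.subspace M"
      and eq: "\<And>x. x \<in> M \<Longrightarrow> \<bar>Re (kinner x x)\<bar> = Re (jinner J x x)"
      and comp: "Metric_space.mcomplete M (\<lambda>x y. sqrt \<bar>Re (kinner (x - y) (x - y))\<bar>)"
      and t: "range t \<subseteq> M" and le: "\<And>m n. jnorm J (t m - t n) \<le> jnorm J (s m - s n)"
    for M and t :: "nat \<Rightarrow> 'a"
  proof -
    let ?d = "\<lambda>x y. sqrt \<bar>Re (kinner (x - y) (x - y))\<bar>"
    have d: "?d x y = jnorm J (x - y)" if "x \<in> M" "y \<in> M" for x y
      using eq[of "x - y"] that cvec.subspace_diff[OF sM] by (simp add: jnorm_def)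
    have "Metric_space M ?d"
    proof
      fix x y
      show "?d x y = ?d y x"
        by (metis minus_diff_eq kinner_minus_left kinner_minus_right minus_minus)
    next
      fix x y z assume "x \<in> M" "y \<in> M" "z \<in> M"
      then show "?d x z \<le> ?d x y + ?d y z" by (simp only: d jnorm_triangle_diff)
    qed (simp_all only: d jnorm_eq_0, auto)
    moreover have "\<exists>N. \<forall>m\<ge>N. \<forall>n\<ge>N. ?d (t m) (t n) < e" if e: "e > 0" for e
    proof -
      obtain N where "\<forall>m\<ge>N. \<forall>n\<ge>N. jnorm J (s m - s n) < e" using Cauchy[OF e] by blast
      then have "\<forall>m\<ge>N. \<forall>n\<ge>N. jnorm J (t m - t n) < e" using le order_le_less_trans by blast
      moreover have "?d (t m) (t n) = jnorm J (t m - t n)" for m n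
        using d t by blast
      ultimately show ?thesis by metis
    qed
    ultimately obtain l where l: "l \<in> M" "(\<lambda>n. ?d (t n) l) \<longlonglongrightarrow> 0"
      using Metric_space_complete_limit[OF _ comp t] by blast
    moreover have "?d (t n) l = jnorm J (t n - l)" for n
      using d t l by blast
    ultimately show ?thesis by auto
  qed
  have "\<forall>n. \<exists>p m. p \<in> Hp \<and> m \<in> Hm \<and> s n = p + m" using dec by blast
  then obtain p m where pm: "\<And>n. p n \<in> Hp" "\<And>n. m n \<in> Hm" "\<And>n. s n = p n + m n"
    by metis
  have split: "(jnorm J (s i - s j))\<^sup>2 = (jnorm J (p i - p j))\<^sup>2 + (jnorm J (m i - m j))\<^sup>2" for i j
  proof -
    have "p i - p j \<in> Hp" "m i - m j \<in> Hm"
      using pm sp sm cvec.subspace_diff by blast+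
    then have "jinner J (p i - p j) (m i - m j) = 0"
      by (simp add: jinner_def Jp orth)
    moreover have "s i - s j = (p i - p j) + (m i - m j)" by (simp add: pm)
    ultimately show ?thesis by (simp only: jnorm_add_sq) simp
  qed
  have eqp: "\<bar>Re (kinner x x)\<bar> = Re (jinner J x x)" if "x \<in> Hp" for x
    using jnorm_sq[of x] that by (simp add: jinner_def Jp) (metis abs_of_nonneg zero_le_power2)
  have eqm: "\<bar>Re (kinner x x)\<bar> = Re (jinner J x x)" if "x \<in> Hm" for x
    using jnorm_sq[of x] that zero_le_power2[of "jnorm J x"] by (simp add: jinner_def Jm)
  have "\<exists>l\<in>Hp. (\<lambda>n. jnorm J (p n - l)) \<longlonglongrightarrow> 0"
  proof (rule lim[OF sp eqp cp])
    show "jnorm J (p i - p j) \<le> jnorm J (s i - s j)" for i j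
      by (rule power2_le_imp_le) (simp_all add: split)
  qed (use pm in auto)
  then obtain lp where lp: "(\<lambda>n. jnorm J (p n - lp)) \<longlonglongrightarrow> 0" by blast
  have "\<exists>l\<in>Hm. (\<lambda>n. jnorm J (m n - l)) \<longlonglongrightarrow> 0"
  proof (rule lim[OF sm eqm])
    show "jnorm J (m i - m j) \<le> jnorm J (s i - s j)" for i j
      by (rule power2_le_imp_le) (simp_all add: split)
    show "Metric_space.mcomplete Hm (\<lambda>x y. sqrt \<bar>Re (kinner (x - y) (x - y))\<bar>)"
      using cm by simp
  qed (use pm in auto)
  then obtain lm where lm: "(\<lambda>n. jnorm J (m n - lm)) \<longlonglongrightarrow> 0" by blast
  have "(\<lambda>n. jnorm J (s n - (lp + lm))) \<longlonglongrightarrow> 0"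
  proof (rule tendsto_zero_le)
    fix n
    have "s n - (lp + lm) = (p n - lp) + (m n - lm)" by (simp add: pm)
    then show "jnorm J (s n - (lp + lm)) \<le> jnorm J (p n - lp) + jnorm J (m n - lm)"
      by (simp only: jnorm_triangle)
    show "(\<lambda>n. jnorm J (p n - lp) + jnorm J (m n - lm)) \<longlonglongrightarrow> 0"
      using tendsto_add[OF lp lm] by simp
  qed simp
  then show ?thesis using that by blast
qed

section \<open>Limits, uniform boundedness and equivalence of the norms\<close>

lemma jnorm_limit_unique:
  assumes "(\<lambda>n. jnorm J (s n - l)) \<longlonglongrightarrow> 0" and "(\<lambda>n. jnorm J (s n - l')) \<longlonglongrightarrow> 0"
  shows "l = l'"
proof -
  have "(\<lambda>n. jnorm J (l - l')) \<longlonglongrightarrow> 0"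
  proof (rule tendsto_zero_le)
    show "jnorm J (l - l') \<le> jnorm J (s n - l) + jnorm J (s n - l')" for n
      using jnorm_triangle_diff[of l l' "s n"] by (simp add: jnorm_commute)
    show "(\<lambda>n. jnorm J (s n - l) + jnorm J (s n - l')) \<longlonglongrightarrow> 0"
      using tendsto_add[OF assms] by simp
  qed simp
  then show ?thesis using LIMSEQ_unique[OF _ tendsto_const] by fastforce
qed

lemma tendsto_jinner_left:
  assumes "(\<lambda>n. jnorm J (s n - l)) \<longlonglongrightarrow> 0"
  shows "(\<lambda>n. jinner J (s n) y) \<longlonglongrightarrow> jinner J l y"
proof (rule LIM_zero_cancel, rule tendsto_norm_zero_cancel, rule tendsto_zero_le)
  show "norm (jinner J (s n) y - jinner J l y) \<le> jnorm J (s n - l) * jnorm J y" for n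
    using jinner_Cauchy_Schwarz[of "s n - l" y] by (simp add: jinner_diff_left)
  show "(\<lambda>n. jnorm J (s n - l) * jnorm J y) \<longlonglongrightarrow> 0"
    using tendsto_mult_left_zero[OF assms] by simp
qed simp

lemma tendsto_jnorm:
  assumes "(\<lambda>n. jnorm J (s n - l)) \<longlonglongrightarrow> 0"
  shows "(\<lambda>n. jnorm J (s n)) \<longlonglongrightarrow> jnorm J l"
proof (rule LIM_zero_cancel, rule tendsto_rabs_zero_cancel, rule tendsto_zero_le[OF _ _ assms])
  show "\<bar>jnorm J (s n) - jnorm J l\<bar> \<le> jnorm J (s n - l)" for n
    using jnorm_triangle_sub[of "s n" l] jnorm_triangle_sub[of l "s n"]
    by (simp add: jnorm_commute)
qed simp

text \<open>Telescoping against a convergent real sequence. The gliding hump needs the error bound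
  \<open>L - c n\<close>; in the construction of square roots \<open>c\<close> is a multiple of a
  scalar copy of the operator iteration.\<close>

lemma jnorm_complete_dominated:
  assumes c: "c \<longlonglongrightarrow> L" and le: "\<And>n. jnorm J (s (Suc n) - s n) \<le> c (Suc n) - c n"
  obtains l where "(\<lambda>n. jnorm J (s n - l)) \<longlonglongrightarrow> 0" and "\<And>n. jnorm J (s n - l) \<le> L - c n"
proof -
  have dist: "jnorm J (s (n + k) - s n) \<le> c (n + k) - c n" for n k
  proof (induction k)
    case (Suc k)
    then show ?case
      using jnorm_triangle_diff[of "s (n + Suc k)" "s n" "s (n + k)"] le[of "n + k"] by simp
  qed simp
  have "\<exists>N. \<forall>m\<ge>N. \<forall>n\<ge>N. jnorm J (s m - s n) < e" if e: "e > 0" for e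
  proof -
    have "Cauchy c" using c by (simp add: convergent_Cauchy convergentI)
    then obtain N where N: "\<And>m n. m \<ge> N \<Longrightarrow> n \<ge> N \<Longrightarrow> \<bar>c m - c n\<bar> < e"
      using e unfolding Cauchy_def dist_real_def by blast
    have "jnorm J (s m - s n) < e" if "m \<ge> N" "n \<ge> N" for m n
    proof (cases "n \<le> m")
      case True
      then show ?thesis using dist[of n "m - n"] N[OF that] by simp
    next
      case False
      then show ?thesis using dist[of m "n - m"] N[OF that] jnorm_commute[of "s m" "s n"] by simp
    qed
    then show ?thesis by blast
  qed
  then obtain l where l: "(\<lambda>n. jnorm J (s n - l)) \<longlonglongrightarrow> 0"
    using jnorm_complete by blast
  have "jnorm J (s n - l) \<le> L - c n" for n
  proof (rule LIMSEQ_le_const)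
    show "(\<lambda>k. jnorm J (s (k + n) - l) + (c (k + n) - c n)) \<longlonglongrightarrow> L - c n"
      using tendsto_add[OF LIMSEQ_ignore_initial_segment[OF l]
          tendsto_diff[OF LIMSEQ_ignore_initial_segment[OF c] tendsto_const]]
      by simp
    have "jnorm J (s n - l) \<le> jnorm J (s (k + n) - l) + (c (k + n) - c n)" for k
      using jnorm_triangle_diff[of "s n" l "s (n + k)"] dist[of n k]
        jnorm_commute[of "s n" "s (n + k)"] by (simp add: add.commute)
    then show "\<exists>N. \<forall>k\<ge>N. jnorm J (s n - l) \<le> jnorm J (s (k + n) - l) + (c (k + n) - c n)"
      by blast
  qed
  with l show ?thesis using that by blast
qed

text \<open>
  Uniform boundedness by a gliding hump: if \<open>\<parallel>y\<^sub>n\<parallel> > 4 ^ n\<close>, then in a series with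
  \<open>n\<close>-th term \<open>\<plusminus> 3 ^ -n y\<^sub>n / \<parallel>y\<^sub>n\<parallel>\<close> the signs can be chosen such that the inner products of the sum
  with the \<open>y\<^sub>n\<close> are unbounded.
\<close>
lemma weakly_bounded_imp_bounded:
  assumes weak: "\<And>x. \<exists>K. \<forall>y\<in>Y. cmod (jinner J x y) \<le> K"
  shows "\<exists>C. \<forall>y\<in>Y. jnorm J y \<le> C"
proof (rule ccontr)
  assume "\<nexists>C. \<forall>y\<in>Y. jnorm J y \<le> C"
  then have "\<forall>n::nat. \<exists>y. y \<in> Y \<and> 4 ^ n < jnorm J y"
    by (meson not_le)
  then obtain y where y: "\<And>n::nat. y n \<in> Y" "\<And>n. 4 ^ n < jnorm J (y n)"
    by metis
  have ypos: "0 < jnorm J (y n)" for n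
    using y(2)[of n] by (smt (verit) zero_less_power)
  define z where "z n = of_real ((1/3) ^ n / jnorm J (y n)) *\<^sub>C y n" for n
  have z: "jnorm J (z n) = (1/3) ^ n" for n
    using ypos[of n] jnorm_eq_0[of "y n"] by (simp add: z_def norm_divide norm_power del: jnorm_eq_0)
  have zy: "jinner J (z n) (y n) = of_real ((1/3) ^ n * jnorm J (y n))" for n
    using ypos[of n] by (simp add: z_def jinner_scale_left jinner_self power2_eq_square)
  define x where "x = rec_nat 0 (\<lambda>n x.
    if (1/3) ^ n * jnorm J (y n) \<le> cmod (jinner J (x + z n) (y n)) then x + z n else x - z n)"
  have x_Suc: "x (Suc n) = (if (1/3) ^ n * jnorm J (y n) \<le> cmod (jinner J (x n + z n) (y n))
      then x n + z n else x n - z n)" for n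
    by (simp add: x_def)
  have hump: "(1/3) ^ n * jnorm J (y n) \<le> cmod (jinner J (x (Suc n)) (y n))" for n
  proof (cases "(1/3) ^ n * jnorm J (y n) \<le> cmod (jinner J (x n + z n) (y n))")
    case False
    let ?a = "jinner J (x n) (y n)" and ?r = "(1/3) ^ n * jnorm J (y n)"
    have "2 * ?r = cmod ((?a + of_real ?r) - (?a - of_real ?r))"
      using ypos[of n] by (simp add: norm_mult norm_power)
    also have "\<dots> \<le> cmod (?a + of_real ?r) + cmod (?a - of_real ?r)"
      by (rule norm_triangle_ineq4)
    finally show ?thesis
      using False by (simp add: x_Suc jinner_simps zy)
  qed (simp add: x_Suc)
  \<comment> \<open>The increments of \<open>?c\<close> are the norms (1/3)^n of the terms, so the
    tail after term n has norm at most 1/2 (1/3)^n: it can destroy only half of what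
    \<open>hump\<close> secures.\<close>
  let ?c = "\<lambda>n. - (3/2) * (1/3) ^ n :: real"
  have "?c \<longlonglongrightarrow> 0"
    by (rule tendsto_mult_right_zero) (simp add: LIMSEQ_power_zero)
  moreover have "jnorm J (x (Suc n) - x n) \<le> ?c (Suc n) - ?c n" for n
    by (simp add: x_Suc z)
  ultimately obtain l where l: "\<And>n. jnorm J (x n - l) \<le> 0 - ?c n"
    using jnorm_complete_dominated by blast
  have grow: "(1/2) * (4/3) ^ n \<le> cmod (jinner J l (y n))" for n
  proof -
    have "jnorm J (x (Suc n) - l) * jnorm J (y n) \<le> (1/2) * (1/3) ^ n * jnorm J (y n)"
      using l[of "Suc n"] by (intro mult_right_mono) auto
    then have "cmod (jinner J (x (Suc n)) (y n) - jinner J l (y n)) \<le> (1/2) * (1/3) ^ n * jnorm J (y n)"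
      using jinner_Cauchy_Schwarz[of "x (Suc n) - l" "y n"] by (simp add: jinner_diff_left)
    then have "(1/2) * (1/3) ^ n * jnorm J (y n) \<le> cmod (jinner J l (y n))"
      using hump[of n] norm_triangle_ineq2[of "jinner J (x (Suc n)) (y n)" "jinner J l (y n)"]
      by linarith
    moreover have "(1/2) * (1/3) ^ n * 4 ^ n \<le> (1/2) * (1/3) ^ n * jnorm J (y n)"
      using y(2)[of n] by (intro mult_left_mono) auto
    moreover have "(1/2) * (1/3) ^ n * 4 ^ n = (1/2) * (4/3 :: real) ^ n"
      by (simp add: power_divide)
    ultimately show ?thesis by linarith
  qed
  obtain K where K: "\<And>n. cmod (jinner J l (y n)) \<le> K"
    using weak[of l] y(1) by blast
  obtain n where "2 * K < (4/3) ^ n"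
    using real_arch_pow[of "4/3" "2 * K"] by auto
  then show False using grow[of n] K[of n] by linarith
qed

text \<open>\<open>jinner J x (J u)\<close> equals [x, u], which does not involve \<open>J\<close>
  and is bounded by the \<open>J'\<close>-norm of \<open>x\<close> for \<open>u\<close> in the
  \<open>J'\<close>-unit ball. So the image of that ball under \<open>J\<close> is weakly bounded,
  hence bounded.\<close>

lemma jnorm_equivalent:
  assumes "signature_op J'"
  obtains C where "0 < C" and "\<And>x. jnorm J x \<le> C * jnorm J' x"
proof -
  interpret J': signature J' by standard fact
  have "\<exists>K. \<forall>y\<in>J ` {y. jnorm J' y \<le> 1}. cmod (jinner J x y) \<le> K" for x
  proof (intro exI ballI)
    fix y assume "y \<in> J ` {y. jnorm J' y \<le> 1}"
    then obtain u where u: "y = J u" "jnorm J' u \<le> 1" by blast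
    have "jinner J x y = jinner J' x (J' u)"
      using u by (simp add: kinner_eq_jinner(2)[symmetric] J'.kinner_eq_jinner(2)[symmetric])
    also have "cmod \<dots> \<le> jnorm J' x * jnorm J' u"
      using J'.jinner_Cauchy_Schwarz[of x "J' u"] by simp
    also have "\<dots> \<le> jnorm J' x * 1"
      using u by (intro mult_left_mono) auto
    finally show "cmod (jinner J x y) \<le> jnorm J' x" by simp
  qed
  from weakly_bounded_imp_bounded[OF this]
  obtain C where C: "\<And>u. jnorm J' u \<le> 1 \<Longrightarrow> jnorm J u \<le> C"
    by auto
  have "jnorm J x \<le> max C 1 * jnorm J' x" for x
  proof (cases "x = 0")
    case False
    then have pos: "0 < jnorm J' x" by (rule J'.jnorm_pos)
    have "jnorm J (of_real (1 / jnorm J' x) *\<^sub>C x) \<le> C"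
      using pos by (intro C) (simp add: norm_divide)
    then have "jnorm J x \<le> C * jnorm J' x"
      using pos by (simp add: norm_divide field_simps)
    then show ?thesis using pos by (smt (verit) mult_right_mono)
  qed simp
  then show ?thesis using that[of "max C 1"] by simp
qed

end

section \<open>Bounded operators\<close>

lemma ex_signature_op: "\<exists>J :: 'a::krein_space \<Rightarrow> 'a. signature_op J"
  using ex_fundamental_decomposition unfolding signature_op_def by blast

context signature
begin

text \<open>\<open>bounded_op\<close> supplies some signature operator; equivalence of the norms in
  both directions moves the bound to the fixed \<open>J\<close>.\<close>

lemma bounded_op_iff:
  "bounded_op A \<longleftrightarrow> clinear A \<and> (\<exists>M. \<forall>x. jnorm J (A x) \<le> M * jnorm J x)"
proof
  assume "bounded_op A"
  then obtain J' M where lin: "clinear A" and J': "signature_op J'"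
    and M: "\<And>x. jnorm J' (A x) \<le> M * jnorm J' x"
    unfolding bounded_op_def by blast
  interpret J': signature J' by standard fact
  obtain C where C: "0 < C" "\<And>x. jnorm J x \<le> C * jnorm J' x"
    using jnorm_equivalent[OF J'] by blast
  obtain D where D: "0 < D" "\<And>x. jnorm J' x \<le> D * jnorm J x"
    using J'.jnorm_equivalent[OF signature_op] by blast
  have "jnorm J (A x) \<le> C * \<bar>M\<bar> * D * jnorm J x" for x
  proof -
    have "jnorm J (A x) \<le> C * jnorm J' (A x)" by (rule C)
    also have "\<dots> \<le> C * (\<bar>M\<bar> * jnorm J' x)"
      using M[of x] C(1) mult_right_mono[OF abs_ge_self[of M], of "jnorm J' x"]
      by (intro mult_left_mono) auto
    also have "\<dots> \<le> C * (\<bar>M\<bar> * (D * jnorm J x))"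
      using C(1) D(2) by (intro mult_left_mono) auto
    finally show ?thesis by (simp add: mult.assoc)
  qed
  with lin show "clinear A \<and> (\<exists>M. \<forall>x. jnorm J (A x) \<le> M * jnorm J x)" by blast
next
  assume "clinear A \<and> (\<exists>M. \<forall>x. jnorm J (A x) \<le> M * jnorm J x)"
  then show "bounded_op A" unfolding bounded_op_def using signature_op by blast
qed

lemma bounded_opE:
  assumes "bounded_op A"
  obtains M where "0 < M" and "\<And>x. jnorm J (A x) \<le> M * jnorm J x"
proof -
  obtain M where M: "\<And>x. jnorm J (A x) \<le> M * jnorm J x"
    using assms bounded_op_iff by blast
  have "jnorm J (A x) \<le> (\<bar>M\<bar> + 1) * jnorm J x" for x
    using M[of x] by (smt (verit) jnorm_nonneg mult_right_mono)
  then show ?thesis using that[of "\<bar>M\<bar> + 1"] by simp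
qed

lemma bounded_opI:
  assumes "clinear A" and "\<And>x. jnorm J (A x) \<le> M * jnorm J x"
  shows "bounded_op A"
  using assms bounded_op_iff by blast

lemma bounded_op_J: "bounded_op J"
  by (rule bounded_opI[where M = 1]) (simp_all add: clinear_J)

lemma tendsto_bounded_op:
  assumes "bounded_op A" and "(\<lambda>n. jnorm J (s n - l)) \<longlonglongrightarrow> 0"
  shows "(\<lambda>n. jnorm J (A (s n) - A l)) \<longlonglongrightarrow> 0"
proof -
  obtain M where M: "\<And>x. jnorm J (A x) \<le> M * jnorm J x"
    using bounded_opE[OF assms(1)] by blast
  have lin: "clinear A" using assms(1) by (simp add: bounded_op_def)
  show ?thesis
  proof (rule tendsto_zero_le)
    show "jnorm J (A (s n) - A l) \<le> M * jnorm J (s n - l)" for n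
      using M[of "s n - l"] by (simp add: clinear_diff[OF lin])
    show "(\<lambda>n. M * jnorm J (s n - l)) \<longlonglongrightarrow> 0"
      using tendsto_mult_right_zero[OF assms(2)] .
  qed simp
qed

end

lemma bounded_op_clinear: "bounded_op A \<Longrightarrow> clinear A"
  by (simp add: bounded_op_def)

lemma bounded_op_id: "bounded_op (\<lambda>x. x :: 'a::krein_space)"
proof -
  obtain J :: "'a \<Rightarrow> 'a" where "signature_op J" using ex_signature_op by blast
  then interpret signature J by unfold_locales
  show ?thesis by (rule bounded_opI[where M = 1]) (simp_all add: clinear_iff)
qed

lemma bounded_op_comp:
  fixes A B :: "'a::krein_space \<Rightarrow> 'a"
  assumes "bounded_op A" and "bounded_op B"
  shows "bounded_op (\<lambda>x. A (B x))"
proof -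
  obtain J :: "'a \<Rightarrow> 'a" where "signature_op J" using ex_signature_op by blast
  then interpret signature J by unfold_locales
  obtain M where M: "0 < M" "\<And>x. jnorm J (A x) \<le> M * jnorm J x"
    using bounded_opE[OF assms(1)] by blast
  obtain N where N: "\<And>x. jnorm J (B x) \<le> N * jnorm J x"
    using bounded_opE[OF assms(2)] by blast
  show ?thesis
  proof (rule bounded_opI[where M = "M * N"])
    show "clinear (\<lambda>x. A (B x))"
      using assms by (simp add: bounded_op_clinear clinear_comp)
    fix x
    have "jnorm J (A (B x)) \<le> M * jnorm J (B x)" by (rule M)
    also have "\<dots> \<le> M * (N * jnorm J x)" using M(1) N by (intro mult_left_mono) auto
    finally show "jnorm J (A (B x)) \<le> M * N * jnorm J x" by (simp add: mult.assoc)
  qed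
qed

lemma bounded_op_add:
  fixes A B :: "'a::krein_space \<Rightarrow> 'a"
  assumes "bounded_op A" and "bounded_op B"
  shows "bounded_op (\<lambda>x. A x + B x)"
proof -
  obtain J :: "'a \<Rightarrow> 'a" where "signature_op J" using ex_signature_op by blast
  then interpret signature J by unfold_locales
  obtain M where M: "\<And>x. jnorm J (A x) \<le> M * jnorm J x"
    using bounded_opE[OF assms(1)] by blast
  obtain N where N: "\<And>x. jnorm J (B x) \<le> N * jnorm J x"
    using bounded_opE[OF assms(2)] by blast
  show ?thesis
  proof (rule bounded_opI[where M = "M + N"])
    show "clinear (\<lambda>x. A x + B x)"
      using assms by (auto intro!: clinearI simp: clinear_simps[OF bounded_op_clinear] cvec.scale_right_distrib)
    show "jnorm J (A x + B x) \<le> (M + N) * jnorm J x" for x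
      using jnorm_triangle[of "A x" "B x"] M[of x] N[of x] by (simp add: distrib_right)
  qed
qed

lemma bounded_op_scale:
  fixes A :: "'a::krein_space \<Rightarrow> 'a"
  assumes "bounded_op A"
  shows "bounded_op (\<lambda>x. c *\<^sub>C A x)"
proof -
  obtain J :: "'a \<Rightarrow> 'a" where "signature_op J" using ex_signature_op by blast
  then interpret signature J by unfold_locales
  obtain M where M: "\<And>x. jnorm J (A x) \<le> M * jnorm J x"
    using bounded_opE[OF assms(1)] by blast
  show ?thesis
  proof (rule bounded_opI[where M = "cmod c * M"])
    show "clinear (\<lambda>x. c *\<^sub>C A x)"
      using assms
      by (auto intro!: clinearI simp: clinear_simps[OF bounded_op_clinear] cvec.scale_right_distrib
          mult.commute)
    show "jnorm J (c *\<^sub>C A x) \<le> cmod c * M * jnorm J x" for x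
      using M[of x] by (simp add: mult.assoc mult_left_mono)
  qed
qed

lemma bounded_op_diff:
  assumes "bounded_op A" and "bounded_op B"
  shows "bounded_op (\<lambda>x. A x - B x)"
  using bounded_op_add[OF assms(1) bounded_op_scale[OF assms(2), of "-1"]] by simp

section \<open>Orthogonal projections and adjoints\<close>

context signature
begin

lemma subspace_jorth: "cvec.subspace (jorth J S)"
  by (auto simp: cvec.subspace_def jorth_def jinner_simps)

definition closed_subspace :: "'a set \<Rightarrow> bool" where
  "closed_subspace S \<longleftrightarrow> cvec.subspace S \<and>
     (\<forall>s l. (\<forall>n. s n \<in> S) \<longrightarrow> (\<lambda>n. jnorm J (s n - l)) \<longlonglongrightarrow> 0 \<longrightarrow> l \<in> S)"

lemma closed_subspace_ker: "bounded_op A \<Longrightarrow> closed_subspace (ker A)"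
  unfolding closed_subspace_def
proof (intro conjI allI impI)
  assume A: "bounded_op A"
  then show "cvec.subspace (ker A)" by (simp add: subspace_ker bounded_op_clinear)
  fix s :: "nat \<Rightarrow> 'a" and l
  assume "\<forall>n. s n \<in> ker A" and "(\<lambda>n. jnorm J (s n - l)) \<longlonglongrightarrow> 0"
  with tendsto_bounded_op[OF A this(2)] have "(\<lambda>n::nat. jnorm J (A l)) \<longlonglongrightarrow> 0"
    by simp
  then show "l \<in> ker A" using LIMSEQ_unique[OF _ tendsto_const] by fastforce
qed

text \<open>Without closedness of \<open>S\<close> the projection lies in its closure only.\<close>
lemma ex_projection:
  assumes S: "cvec.subspace S"
  obtains p s where "\<And>n. s n \<in> S" and "(\<lambda>n. jnorm J (s n - p)) \<longlonglongrightarrow> 0" and "h - p \<in> jorth J S"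
proof -
  define d where "d = (INF x\<in>S. (jnorm J (h - x))\<^sup>2)"
  have bdd: "bdd_below ((\<lambda>x. (jnorm J (h - x))\<^sup>2) ` S)"
    by (rule bdd_belowI[of _ 0]) auto
  have ne: "S \<noteq> {}" using cvec.subspace_0[OF S] by blast
  have d_le: "d \<le> (jnorm J (h - x))\<^sup>2" if "x \<in> S" for x
    unfolding d_def by (rule cINF_lower[OF bdd that])
  have "\<exists>x\<in>S. (jnorm J (h - x))\<^sup>2 < d + e" if "e > 0" for e
    using that cINF_less_iff[OF ne bdd, of "d + e"] by (simp add: d_def)
  then have "\<forall>n::nat. \<exists>x. x \<in> S \<and> (jnorm J (h - x))\<^sup>2 < d + inverse (real (Suc n))"
    by (meson inverse_positive_iff_positive of_nat_0_less_iff zero_less_Suc)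
  then obtain s where s: "\<And>n. s n \<in> S"
    and sd: "\<And>n. (jnorm J (h - s n))\<^sup>2 < d + inverse (real (Suc n))"
    by metis
  have dist: "(jnorm J (s m - s n))\<^sup>2 \<le> 2 * (inverse (real (Suc m)) + inverse (real (Suc n)))" for m n
  proof -
    let ?x = "h - s n" and ?y = "h - s m"
    \<comment> \<open>Parallelogram law: the midpoint of two members of \<open>S\<close> is again in
      \<open>S\<close>, so its squared distance from \<open>h\<close> is at least \<open>d\<close>,
      and almost minimal points must be close together.\<close>
    have "(1/2) *\<^sub>C (s m + s n) \<in> S"
      using s S cvec.subspace_add cvec.subspace_scale by blast
    then have "4 * d \<le> 4 * (jnorm J (h - (1/2) *\<^sub>C (s m + s n)))\<^sup>2"
      using d_le by simp
    also have "\<dots> = (jnorm J (2 *\<^sub>C (h - (1/2) *\<^sub>C (s m + s n))))\<^sup>2"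
      by (simp add: power_mult_distrib)
    also have "2 *\<^sub>C (h - (1/2) *\<^sub>C (s m + s n)) = ?x + ?y"
      using scaleC_add_left[of 1 1 h]
      by (simp add: cvec.scale_right_diff_distrib scaleC_scaleC algebra_simps)
    finally have "4 * d \<le> (jnorm J (?x + ?y))\<^sup>2" .
    moreover have "(jnorm J (?x + ?y))\<^sup>2 + (jnorm J (?x - ?y))\<^sup>2
      = 2 * (jnorm J ?x)\<^sup>2 + 2 * (jnorm J ?y)\<^sup>2"
      unfolding jnorm_add_sq jnorm_diff_sq by simp
    moreover have "?x - ?y = s m - s n" by simp
    moreover have "b \<le> 2 * (i + j)"
      if "4 * d \<le> a" "a + b = 2 * x + 2 * y" "y < d + i" "x < d + j" for a b x y i j
      using that by (auto simp: algebra_simps)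
    ultimately show ?thesis using sd[of m] sd[of n] by metis
  qed
  have "\<exists>N. \<forall>m\<ge>N. \<forall>n\<ge>N. jnorm J (s m - s n) < e" if e: "e > 0" for e
  proof -
    obtain N where N: "inverse (real (Suc N)) < e\<^sup>2 / 4"
      using reals_Archimedean[of "e\<^sup>2 / 4"] e by auto
    have "jnorm J (s m - s n) < e" if "m \<ge> N" "n \<ge> N" for m n
    proof (rule power2_less_imp_less)
      have "inverse (real (Suc m)) \<le> inverse (real (Suc N))"
        "inverse (real (Suc n)) \<le> inverse (real (Suc N))"
        using that by (auto intro!: le_imp_inverse_le)
      then show "(jnorm J (s m - s n))\<^sup>2 < e\<^sup>2"
        using dist[of m n] N by argo
    qed (use e in simp)
    then show ?thesis by blast
  qed
  then obtain p where p: "(\<lambda>n. jnorm J (s n - p)) \<longlonglongrightarrow> 0"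
    using jnorm_complete by blast
  have lim: "(\<lambda>n. (jnorm J (h - s n - u))\<^sup>2) \<longlonglongrightarrow> (jnorm J (h - p - u))\<^sup>2" for u
  proof (rule tendsto_power, rule tendsto_jnorm)
    have "h - s n - u - (h - p - u) = - (s n - p)" for n by simp
    then show "(\<lambda>n. jnorm J (h - s n - u - (h - p - u))) \<longlonglongrightarrow> 0"
      using p by (simp only: jnorm_minus)
  qed
  have "(jnorm J (h - p))\<^sup>2 \<le> d"
  proof (rule LIMSEQ_le)
    show "(\<lambda>n. (jnorm J (h - s n))\<^sup>2) \<longlonglongrightarrow> (jnorm J (h - p))\<^sup>2" using lim[of 0] by simp
    show "(\<lambda>n. d + inverse (real (Suc n))) \<longlonglongrightarrow> d"
      using tendsto_add[OF tendsto_const LIMSEQ_inverse_real_of_nat, of d] by simp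
  qed (use sd less_imp_le in blast)
  moreover have "d \<le> (jnorm J (h - p - x))\<^sup>2" if "x \<in> S" for x
  proof (rule LIMSEQ_le_const[OF lim], intro exI allI impI)
    show "d \<le> (jnorm J (h - s n - x))\<^sup>2" for n
      using d_le[of "s n + x"] cvec.subspace_add[OF S s that] by (simp add: algebra_simps)
  qed
  ultimately have min: "(jnorm J (h - p))\<^sup>2 \<le> (jnorm J (h - p - x))\<^sup>2" if "x \<in> S" for x
    using that order_trans by blast
  have "jinner J (h - p) x = 0" if x: "x \<in> S" for x
  proof -
    let ?q = "jinner J (h - p) x"
    \<comment> \<open>First order condition: moving \<open>p\<close> along \<open>x\<close> cannot
      decrease the distance. The minimal distance cancels, which leaves the discriminant lemma with
      constant term 0.\<close>
    have "(cmod ?q)\<^sup>2 \<le> 0 * (jnorm J x)\<^sup>2"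
    proof (rule real_quadratic_discriminant)
      fix t :: real
      have "(jnorm J (h - p))\<^sup>2 \<le> (jnorm J (h - p - (of_real t * ?q) *\<^sub>C x))\<^sup>2"
        by (rule min) (use x S cvec.subspace_scale in blast)
      also have "\<dots> = (jnorm J (h - p))\<^sup>2 + (t\<^sup>2 * ((cmod ?q)\<^sup>2 * (jnorm J x)\<^sup>2))
          - 2 * (t * (cmod ?q)\<^sup>2)"
        unfolding jnorm_diff_sq[of "h - p"] jinner_scale_right
        by (simp add: norm_mult power_mult_distrib mult.assoc cmod_power2)
          (simp add: power2_eq_square)
      finally show "0 \<le> 0 - 2 * t * (cmod ?q)\<^sup>2 + t\<^sup>2 * ((cmod ?q)\<^sup>2 * (jnorm J x)\<^sup>2)"
        by simp
    qed simp_all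
    then show ?thesis by simp
  qed
  then have "h - p \<in> jorth J S" by (simp add: jorth_def)
  with s p show ?thesis using that by blast
qed

lemma jorth_Int: "x \<in> S \<Longrightarrow> x \<in> jorth J S \<Longrightarrow> x = 0"
  by (auto simp: jorth_def)

lemma jorthD: "x \<in> jorth J S \<Longrightarrow> y \<in> S \<Longrightarrow> jinner J x y = 0"
  and jorthD': "x \<in> jorth J S \<Longrightarrow> y \<in> S \<Longrightarrow> jinner J y x = 0"
  using jinner_commute[of y x] by (auto simp: jorth_def)

lemma jproj_eqI:
  assumes S: "cvec.subspace S" and p: "p \<in> S" and "h - p \<in> jorth J S"
  shows "jproj J S h = p"
  unfolding jproj_def
proof (rule the_equality)
  fix x assume x: "x \<in> S \<and> h - x \<in> jorth J S"
  have "x - p \<in> S" using x p S cvec.subspace_diff by blast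
  moreover have "x - p \<in> jorth J S"
    using cvec.subspace_diff[OF subspace_jorth, of "h - p" S "h - x"] x assms by simp
  ultimately show "x = p" using jorth_Int[of "x - p"] by simp
qed (use assms in simp)

lemma jproj:
  assumes "closed_subspace S"
  shows jproj_mem: "jproj J S h \<in> S" and jproj_orth: "h - jproj J S h \<in> jorth J S"
proof -
  have S: "cvec.subspace S" using assms by (simp add: closed_subspace_def)
  obtain p where "p \<in> S" "h - p \<in> jorth J S"
    using ex_projection[OF S, of h] assms unfolding closed_subspace_def by metis
  with jproj_eqI[OF S this] show "jproj J S h \<in> S" "h - jproj J S h \<in> jorth J S" by simp_all
qed

lemma jproj_ident: "cvec.subspace S \<Longrightarrow> x \<in> S \<Longrightarrow> jproj J S x = x"
  by (rule jproj_eqI) (simp_all add: jorth_def)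

lemma jproj_eq_0: "cvec.subspace S \<Longrightarrow> x \<in> jorth J S \<Longrightarrow> jproj J S x = 0"
  by (rule jproj_eqI) (simp_all add: cvec.subspace_0)

lemma jproj_sym:
  assumes "closed_subspace S"
  shows "jinner J (jproj J S x) y = jinner J x (jproj J S y)"
proof -
  have "jinner J (jproj J S x) (y - jproj J S y) = 0" "jinner J (x - jproj J S x) (jproj J S y) = 0"
    using jproj[OF assms] jorthD jorthD' by blast+
  then show ?thesis by (simp add: jinner_simps)
qed

lemma bounded_op_jproj:
  assumes cl: "closed_subspace S"
  shows "bounded_op (jproj J S)"
proof (rule bounded_opI[where M = 1])
  have S: "cvec.subspace S" using cl by (simp add: closed_subspace_def)
  show "clinear (jproj J S)"
  proof (rule clinearI)
    fix x y
    show "jproj J S (x + y) = jproj J S x + jproj J S y"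
    proof (rule jproj_eqI[OF S])
      show "jproj J S x + jproj J S y \<in> S" by (simp add: cvec.subspace_add S jproj[OF cl])
      have "(x - jproj J S x) + (y - jproj J S y) \<in> jorth J S"
        by (intro cvec.subspace_add subspace_jorth jproj cl)
      then show "x + y - (jproj J S x + jproj J S y) \<in> jorth J S" by (simp add: algebra_simps)
    qed
  next
    fix c x
    show "jproj J S (c *\<^sub>C x) = c *\<^sub>C jproj J S x"
    proof (rule jproj_eqI[OF S])
      show "c *\<^sub>C jproj J S x \<in> S" by (simp add: cvec.subspace_scale S jproj[OF cl])
      have "c *\<^sub>C (x - jproj J S x) \<in> jorth J S"
        by (intro cvec.subspace_scale subspace_jorth jproj cl)
      then show "c *\<^sub>C x - c *\<^sub>C jproj J S x \<in> jorth J S"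
        by (simp add: cvec.scale_right_diff_distrib)
    qed
  qed
  fix x
  have "jinner J (jproj J S x) (x - jproj J S x) = 0"
    by (rule jorthD'[OF jproj_orth[OF cl] jproj_mem[OF cl]])
  then have "(jnorm J x)\<^sup>2 = (jnorm J (jproj J S x))\<^sup>2 + (jnorm J (x - jproj J S x))\<^sup>2"
    using jnorm_add_sq[of "jproj J S x" "x - jproj J S x"] by simp
  then show "jnorm J (jproj J S x) \<le> 1 * jnorm J x"
    by (simp add: power2_le_imp_le)
qed

section \<open>Riesz representation, adjoints and Douglas' lemma\<close>

lemma jinner_eqI: "(\<And>x. jinner J x a = jinner J x b) \<Longrightarrow> a = b"
  using jinner_self_eq_0[of "a - b"] by (simp add: jinner_diff_right)

lemma Riesz_representation:
  assumes add: "\<And>x y. \<phi> (x + y) = \<phi> x + \<phi> y" and scale: "\<And>c x. \<phi> (c *\<^sub>C x) = c * \<phi> x"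
    and bound: "\<And>x. cmod (\<phi> x) \<le> M * jnorm J x"
  obtains y where "\<And>x. \<phi> x = jinner J x y"
proof (cases "\<forall>x. \<phi> x = 0")
  case True
  then show ?thesis using that[of 0] by simp
next
  case False
  then obtain h where h: "\<phi> h \<noteq> 0" by blast
  have diff: "\<phi> (x - y) = \<phi> x - \<phi> y" for x y
    using add[of "x - y" y] by simp
  have zero: "\<phi> 0 = 0" using diff[of 0 0] by simp
  let ?S = "{x. \<phi> x = 0}"
  have sub: "cvec.subspace ?S"
    by (simp add: cvec.subspace_def add scale zero)
  have "closed_subspace ?S"
    unfolding closed_subspace_def
  proof (intro conjI allI impI sub)
    fix s :: "nat \<Rightarrow> 'a" and l
    assume s: "\<forall>n. s n \<in> ?S" and l: "(\<lambda>n. jnorm J (s n - l)) \<longlonglongrightarrow> 0"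
    have "(\<lambda>n::nat. cmod (\<phi> l)) \<longlonglongrightarrow> 0"
    proof (rule tendsto_zero_le)
      show "cmod (\<phi> l) \<le> M * jnorm J (s n - l)" for n
        using bound[of "s n - l"] s by (simp add: diff)
      show "(\<lambda>n. M * jnorm J (s n - l)) \<longlonglongrightarrow> 0" using tendsto_mult_right_zero[OF l] .
    qed simp
    then show "l \<in> ?S" using LIMSEQ_unique[OF _ tendsto_const] by fastforce
  qed
  note P = jproj[OF this, of h]
  define u where "u = h - jproj J ?S h"
  have u: "\<phi> u \<noteq> 0" using P h by (simp add: u_def diff)
  then have "u \<noteq> 0" using zero by auto
  then have pos: "jnorm J u \<noteq> 0" by simp
  have "\<phi> x = jinner J x ((cnj (\<phi> u) / of_real ((jnorm J u)\<^sup>2)) *\<^sub>C u)" for x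
  proof -
    have "x - (\<phi> x / \<phi> u) *\<^sub>C u \<in> ?S" using u by (simp add: diff scale)
    then have "jinner J (x - (\<phi> x / \<phi> u) *\<^sub>C u) u = 0"
      by (rule jorthD'[OF P(2)[folded u_def]])
    then have "jinner J x u = \<phi> x / \<phi> u * of_real ((jnorm J u)\<^sup>2)"
      by (simp add: jinner_simps jinner_self)
    then show ?thesis using u pos by (simp add: jinner_scale_right)
  qed
  then show ?thesis using that by blast
qed

lemma ex_adjoint:
  assumes "bounded_op A"
  obtains B where "\<And>x y. jinner J (A x) y = jinner J x (B y)"
proof -
  have lin: "clinear A" by (rule bounded_op_clinear) fact
  obtain M where M: "\<And>x. jnorm J (A x) \<le> M * jnorm J x"
    using bounded_opE[OF assms] by blast
  have "\<exists>b. \<forall>x. jinner J (A x) y = jinner J x b" for y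
  proof -
    have "cmod (jinner J (A x) y) \<le> (M * jnorm J y) * jnorm J x" for x
    proof -
      have "cmod (jinner J (A x) y) \<le> jnorm J (A x) * jnorm J y" by (rule jinner_Cauchy_Schwarz)
      also have "\<dots> \<le> (M * jnorm J x) * jnorm J y" by (intro mult_right_mono M) simp
      finally show ?thesis by (simp add: mult.commute mult.left_commute)
    qed
    then obtain b where "\<And>x. jinner J (A x) y = jinner J x b"
      by (rule Riesz_representation[rotated 2]) (simp_all add: clinear_simps[OF lin] jinner_simps)
    then show ?thesis by blast
  qed
  then show ?thesis using that by metis
qed

lemma jadj_eqI:
  assumes "\<And>x y. jinner J (A x) y = jinner J x (B y)"
  shows "jadj J A = B"
  unfolding jadj_def
proof (rule the_equality)
  fix B' assume "\<forall>x y. jinner J (A x) y = jinner J x (B' y)"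
  then show "B' = B" using assms by (intro ext jinner_eqI) metis
qed (use assms in blast)

lemma jinner_jadj: "bounded_op A \<Longrightarrow> jinner J (A x) y = jinner J x (jadj J A y)"
  using ex_adjoint jadj_eqI by metis

lemma jinner_jadj': "bounded_op A \<Longrightarrow> jinner J (jadj J A x) y = jinner J x (A y)"
  by (metis jinner_commute jinner_jadj)

lemma jadj_clinear:
  assumes "bounded_op A"
  shows "clinear (jadj J A)"
  by (auto intro!: clinearI jinner_eqI simp: jinner_jadj[OF assms, symmetric] jinner_simps)

lemma bounded_op_jadj:
  assumes A: "bounded_op A"
  shows "bounded_op (jadj J A)"
proof -
  obtain M where M: "0 < M" "\<And>x. jnorm J (A x) \<le> M * jnorm J x"
    using bounded_opE[OF assms(1)] by blast
  show ?thesis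
  proof (rule bounded_opI[OF jadj_clinear[OF A]])
    fix y
    let ?b = "jadj J A y"
    have "(jnorm J ?b)\<^sup>2 = cmod (jinner J (A ?b) y)"
      by (simp add: jinner_jadj[OF A] jinner_self norm_power)
    also have "\<dots> \<le> (M * jnorm J ?b) * jnorm J y"
      using jinner_Cauchy_Schwarz[of "A ?b" y] M(2)[of ?b] by (meson jnorm_nonneg mult_right_mono order_trans)
    finally have "jnorm J ?b * jnorm J ?b \<le> jnorm J ?b * (M * jnorm J y)"
      by (simp add: power2_eq_square mult.commute mult.left_commute)
    then show "jnorm J ?b \<le> M * jnorm J y"
      using jnorm_nonneg[of ?b] M(1) by (cases "jnorm J ?b = 0") (auto simp del: jnorm_eq_0)
  qed
qed

lemma kadj_eq_jadj:
  assumes "bounded_op A"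
  shows "kadj A = (\<lambda>y. J (jadj J A (J y)))"
  unfolding kadj_def
proof (rule the_equality)
  show eq: "\<forall>x y. kinner (A x) y = kinner x (J (jadj J A (J y)))"
    by (simp add: kinner_eq_jinner(2) jinner_jadj[OF assms])
  fix B assume B: "\<forall>x y. kinner (A x) y = kinner x (B y)"
  show "B = (\<lambda>y. J (jadj J A (J y)))"
  proof
    fix y
    have "J (B y) = J (J (jadj J A (J y)))"
      using B eq by (intro jinner_eqI) (metis kinner_eq_jinner(2))
    then show "B y = J (jadj J A (J y))" by (metis J_invol)
  qed
qed

text \<open>\<open>F x\<close> is the preimage of \<open>B x\<close> orthogonal to ker A, and
  uniqueness makes it linear. For boundedness the inclusion is dualized: with \<open>?A\<close> and
  \<open>?B\<close> the adjoints, the vectors \<open>?B z\<close> with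
  \<open>jnorm J (?A z) \<le> 1\<close> are weakly bounded, by \<open>jnorm J (F x)\<close> at
  \<open>x\<close>, so \<open>jnorm J (?B z) \<le> C * jnorm J (?A z)\<close> by uniform
  boundedness.\<close>

lemma Douglas_factorization:
  assumes A: "bounded_op A" and B: "bounded_op B" and ran: "range B \<subseteq> range A"
  obtains F where "bounded_op F" and "\<And>x. A (F x) = B x" and "\<And>x. F x \<in> jorth J (ker A)"
proof -
  have linA: "clinear A" and linB: "clinear B" using A B by (simp_all add: bounded_op_clinear)
  note cl = closed_subspace_ker[OF A]
  have unique: "u = v" if "A u = A v" "u \<in> jorth J (ker A)" "v \<in> jorth J (ker A)" for u v
  proof -
    have "u - v \<in> ker A" using that by (simp add: clinear_diff[OF linA])
    moreover have "u - v \<in> jorth J (ker A)" using that subspace_jorth cvec.subspace_diff by blast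
    ultimately show ?thesis using jorth_Int[of "u - v" "ker A"] by simp
  qed
  have "\<exists>v. A v = B x \<and> v \<in> jorth J (ker A)" for x
  proof -
    obtain y where "B x = A y" using ran by blast
    moreover have "A (jproj J (ker A) y) = 0" using jproj_mem[OF cl] by blast
    ultimately have "A (y - jproj J (ker A) y) = B x" by (simp add: clinear_diff[OF linA])
    then show ?thesis using jproj_orth[OF cl] by blast
  qed
  then obtain F where AF: "\<And>x. A (F x) = B x" and F: "\<And>x. F x \<in> jorth J (ker A)" by metis
  have lin: "clinear F"
  proof (rule clinearI)
    show "F (x + y) = F x + F y" for x y
      by (rule unique)
        (simp_all add: clinear_simps[OF linA] clinear_simps[OF linB] AF F cvec.subspace_add[OF subspace_jorth])
    show "F (c *\<^sub>C x) = c *\<^sub>C F x" for c x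
      by (rule unique)
        (simp_all add: clinear_simps[OF linA] clinear_simps[OF linB] AF F cvec.subspace_scale[OF subspace_jorth])
  qed
  let ?A = "jadj J A" and ?B = "jadj J B"
  have linA': "clinear ?A" and linB': "clinear ?B" using A B by (simp_all add: jadj_clinear)
  have dual: "jinner J x (?B z) = jinner J (F x) (?A z)" for x z
    by (simp add: jinner_jadj[OF A, symmetric] jinner_jadj[OF B, symmetric] AF)
  have "\<exists>K. \<forall>y\<in>?B ` {z. jnorm J (?A z) \<le> 1}. cmod (jinner J x y) \<le> K" for x
  proof (intro exI ballI)
    fix y assume "y \<in> ?B ` {z. jnorm J (?A z) \<le> 1}"
    then obtain z where z: "y = ?B z" "jnorm J (?A z) \<le> 1" by blast
    have "cmod (jinner J x y) \<le> jnorm J (F x) * jnorm J (?A z)"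
      unfolding z dual by (rule jinner_Cauchy_Schwarz)
    also have "\<dots> \<le> jnorm J (F x)" using z(2) mult_left_mono[of _ 1 "jnorm J (F x)"] by simp
    finally show "cmod (jinner J x y) \<le> jnorm J (F x)" .
  qed
  from weakly_bounded_imp_bounded[OF this]
  obtain C where C: "\<And>z. jnorm J (?A z) \<le> 1 \<Longrightarrow> jnorm J (?B z) \<le> C" by auto
  have le: "jnorm J (?B z) \<le> C * jnorm J (?A z)" for z
  proof (cases "?A z = 0")
    case True
    then have "jinner J x (?B z) = jinner J x 0" for x by (simp add: dual)
    then have "?B z = 0" by (rule jinner_eqI)
    with True show ?thesis by simp
  next
    case False
    then have pos: "0 < jnorm J (?A z)" by (rule jnorm_pos)
    have "jnorm J (?B (of_real (1 / jnorm J (?A z)) *\<^sub>C z)) \<le> C"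
      using pos False by (intro C) (simp add: clinear_scale[OF linA'] norm_divide)
    then show ?thesis
      using pos by (simp add: clinear_scale[OF linB'] norm_divide field_simps)
  qed
  have "bounded_op F"
  proof (rule bounded_opI[OF lin])
    fix x
    \<comment> \<open>\<open>F x\<close> equals its projection \<open>p\<close> onto the closure of
      the range of the adjoint: both are orthogonal to ker A, and \<open>A\<close> annihilates their
      difference. Hence the dual estimate can be tested on the vectors \<open>s n\<close>, which
      tend to \<open>F x\<close>.\<close>
    obtain s p where s: "\<And>n. s n \<in> range ?A" and p: "(\<lambda>n. jnorm J (s n - p)) \<longlonglongrightarrow> 0"
      and orth: "F x - p \<in> jorth J (range ?A)"
      using ex_projection[OF subspace_image[OF linA' cvec.subspace_UNIV], of "F x"] by metis
    have "A (F x - p) = 0"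
    proof (rule jinner_eqI)
      fix y
      have "jinner J (F x - p) (?A y) = 0" using orth jorthD by blast
      then have "jinner J (A (F x - p)) y = 0" by (simp add: jinner_jadj[OF A])
      then show "jinner J y (A (F x - p)) = jinner J y 0"
        using jinner_commute[of y "A (F x - p)"] by simp
    qed
    moreover have "p \<in> jorth J (ker A)"
      unfolding jorth_def
    proof (intro CollectI ballI)
      fix k assume k: "k \<in> ker A"
      have "jinner J (s n) k = 0" for n
        using s[of n] k by (auto simp: jinner_jadj'[OF A])
      then show "jinner J p k = 0"
        using tendsto_jinner_left[OF p, of k] LIMSEQ_unique[OF _ tendsto_const] by fastforce
    qed
    ultimately have Fp: "F x = p"
      by (intro unique[OF _ F]) (simp_all add: clinear_diff[OF linA])
    have "cmod (jinner J (s n) (F x)) \<le> jnorm J (s n) * (C * jnorm J x)" for n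
    proof -
      obtain z where z: "s n = ?A z" using s[of n] by blast
      have "cmod (jinner J (s n) (F x)) = cmod (jinner J x (?B z))"
        unfolding z dual by (metis jinner_commute complex_mod_cnj)
      also have "\<dots> \<le> jnorm J x * jnorm J (?B z)" by (rule jinner_Cauchy_Schwarz)
      also have "\<dots> \<le> jnorm J x * (C * jnorm J (s n))"
        unfolding z by (intro mult_left_mono le) simp
      finally show ?thesis by (simp add: mult.commute mult.left_commute)
    qed
    then have "cmod (jinner J p (F x)) \<le> jnorm J p * (C * jnorm J x)"
      using LIMSEQ_le[OF tendsto_norm[OF tendsto_jinner_left[OF p, of "F x"]]
          tendsto_mult_right[OF tendsto_jnorm[OF p], of "C * jnorm J x"]] by blast
    then have "jnorm J (F x) * jnorm J (F x) \<le> jnorm J (F x) * (C * jnorm J x)"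
      by (simp add: Fp jinner_self norm_mult power2_eq_square)
    then show "jnorm J (F x) \<le> \<bar>C\<bar> * jnorm J x"
    proof (cases "F x = 0")
      case False
      then have "jnorm J (F x) \<le> C * jnorm J x"
        using \<open>jnorm J (F x) * jnorm J (F x) \<le> _\<close> jnorm_pos[of "F x"] by simp
      also have "\<dots> \<le> \<bar>C\<bar> * jnorm J x" by (intro mult_right_mono) auto
      finally show ?thesis .
    qed simp
  qed
  then show ?thesis using that AF F by blast
qed

lemma mp_inv_eqI:
  assumes V: "clinear V" and "V x = y" and "x \<in> jorth J (ker V)"
  shows "mp_inv J V y = x"
  unfolding mp_inv_def
proof (rule the_equality)
  show "x \<in> jorth J (ker V) \<and> y - V x \<in> jorth J (range V)"
    using assms by (simp add: jorth_def)
  fix x' assume x': "x' \<in> jorth J (ker V) \<and> y - V x' \<in> jorth J (range V)"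
  have "y - V x' = V (x - x')" using assms by (simp add: clinear_diff)
  then have "V (x - x') = 0" using x' jorth_Int[of "V (x - x')" "range V"] by simp
  moreover have "x - x' \<in> jorth J (ker V)"
    using x' assms subspace_jorth cvec.subspace_diff by blast
  ultimately show "x' = x" using jorth_Int[of "x - x'" "ker V"] by simp
qed

end

lemma kadj:
  fixes A :: "'a::krein_space \<Rightarrow> 'a"
  assumes A: "bounded_op A"
  shows kinner_kadj: "kinner (A x) y = kinner x (kadj A y)" and kinner_kadj': "kinner (kadj A x) y = kinner x (A y)"
    and bounded_op_kadj: "bounded_op (kadj A)"
proof -
  obtain J :: "'a \<Rightarrow> 'a" where "signature_op J" using ex_signature_op by blast
  then interpret signature J by unfold_locales
  show *: "kinner (A x) y = kinner x (kadj A y)" for x y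
    by (simp add: kadj_eq_jadj[OF A] kinner_eq_jinner(2) jinner_jadj[OF A])
  show "kinner (kadj A x) y = kinner x (A y)"
    by (metis * kinner_commute)
  show "bounded_op (kadj A)"
    unfolding kadj_eq_jadj[OF A]
    by (intro bounded_op_comp[OF bounded_op_J] bounded_op_comp[OF bounded_op_jadj[OF A]] bounded_op_J)
qed

section \<open>Square roots of positive operators\<close>

context signature
begin

lemma positive_op_bounded: "positive_op J A \<Longrightarrow> bounded_op A"
  by (simp add: positive_op_def)

lemma positive_op_clinear: "positive_op J A \<Longrightarrow> clinear A"
  by (simp add: positive_op_bounded bounded_op_clinear)

lemma positive_op_nonneg: "positive_op J A \<Longrightarrow> 0 \<le> Re (jinner J (A x) x)"
  by (simp add: positive_op_def less_eq_complex_def)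

text \<open>Polarization over the complex numbers: reality of the form at \<open>x + y\<close>
  compares the imaginary parts, and at \<open>x + \<i> *\<^sub>C y\<close> the real parts.\<close>

lemma positive_op_sym:
  assumes A: "positive_op J A"
  shows "jinner J (A x) y = jinner J x (A y)"
proof -
  note lin = positive_op_clinear[OF A]
  have real: "Im (jinner J (A z) z) = 0" for z
    using A unfolding positive_op_def less_eq_complex_def by (metis zero_complex.sel(2))
  have "Im (jinner J (A x) y) + Im (jinner J (A y) x) = 0"
    using real[of "x + y"] real[of x] real[of y] by (simp add: clinear_simps[OF lin] jinner_simps)
  moreover have "Re (jinner J (A x) y) - Re (jinner J (A y) x) = 0"
    using real[of "x + \<i> *\<^sub>C y"] real[of x] real[of y]
    by (simp add: clinear_simps[OF lin] jinner_simps)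
  ultimately have "jinner J (A x) y = cnj (jinner J (A y) x)"
    by (simp add: complex_eq_iff)
  then show ?thesis using jinner_commute[of x "A y"] by simp
qed

lemma positive_opI:
  assumes "bounded_op A" and sym: "\<And>x y. jinner J (A x) y = jinner J x (A y)"
    and "\<And>x. 0 \<le> Re (jinner J (A x) x)"
  shows "positive_op J A"
proof -
  have "Im (jinner J (A x) x) = 0" for x
    using sym[of x x] jinner_commute[of x "A x"] by (simp add: complex_eq_iff)
  then show ?thesis using assms by (simp add: positive_op_def less_eq_complex_def)
qed

text \<open>Cauchy-Schwarz for the form <A x, y> with y = A x; the bound \<open>le\<close> at
  \<open>A x\<close> leaves a common factor \<parallel>A x\<parallel>^2 to cancel.\<close>

lemma jnorm_sq_le_positive:
  assumes A: "clinear A" and sym: "\<And>x y. jinner J (A x) y = jinner J x (A y)"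
    and pos: "\<And>x. 0 \<le> Re (jinner J (A x) x)"
    and le: "\<And>x. Re (jinner J (A x) x) \<le> m * (jnorm J x)\<^sup>2"
  shows "(jnorm J (A x))\<^sup>2 \<le> m * Re (jinner J (A x) x)"
proof (cases "A x = 0")
  case False
  have "(cmod (jinner J (A x) (A x)))\<^sup>2 \<le> Re (jinner J (A x) x) * Re (jinner J (A (A x)) (A x))"
    unfolding jinner_def
  proof (rule kinner_Cauchy_Schwarz)
    show "clinear (\<lambda>x. J (A x))" by (rule clinear_comp[OF clinear_J A])
    show "kinner (J (A x)) y = kinner x (J (A y))" for x y
      using sym[of x y] by (simp add: jinner_def J_sym)
    show "0 \<le> Re (kinner (J (A x)) x)" for x
      using pos[of x] by (simp add: jinner_def)
  qed
  also have "\<dots> \<le> Re (jinner J (A x) x) * (m * (jnorm J (A x))\<^sup>2)"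
    using pos le by (intro mult_left_mono) auto
  finally have "(jnorm J (A x))\<^sup>2 * (jnorm J (A x))\<^sup>2
      \<le> m * Re (jinner J (A x) x) * (jnorm J (A x))\<^sup>2"
    by (simp add: jinner_self norm_power power2_eq_square norm_mult mult.assoc mult.left_commute)
  moreover have "0 < (jnorm J (A x))\<^sup>2" using jnorm_pos[OF False] by (rule zero_less_power)
  ultimately show ?thesis by (rule mult_right_le_imp_le)
qed simp

text \<open>If 2 S = B + S^2, then (1 - S)^2 = 1 - B; the proof iterates this fixed point equation
  from 0. The last conclusion, that the root commutes with every bounded operator commuting with
  \<open>B\<close>, is what makes square roots unique.\<close>

lemma ex_sqrt_contraction:
  assumes B: "clinear B" and sym: "\<And>x y. jinner J (B x) y = jinner J x (B y)"
    and contr: "\<And>x. jnorm J (B x) \<le> jnorm J x"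
  obtains R where "positive_op J R" and "\<And>x. R (R x) = x - B x"
    and "\<And>C x. clinear C \<Longrightarrow> (\<And>x. C (B x) = B (C x)) \<Longrightarrow> bounded_op C \<Longrightarrow> C (R x) = R (C x)"
proof -
  text \<open>
    \<open>A\<^sub>n\<close> is a polynomial in \<open>B\<close> with nonnegative coefficients, and \<open>c\<^sub>n\<close> is its value at \<open>1\<close>;
    \<open>A\<^sub>n\<close> increases to \<open>1 - (1 - B)\<^sup>1\<^sup>/\<^sup>2\<close>.
  \<close>
  define A where "A = rec_nat (\<lambda>x. 0) (\<lambda>n A x. (1/2) *\<^sub>C (B x + A (A x)))"
  define c :: "nat \<Rightarrow> real" where "c = rec_nat 0 (\<lambda>n c. (1 + c\<^sup>2) / 2)"
  have A0: "A 0 x = 0" and A_Suc: "A (Suc n) x = (1/2) *\<^sub>C (B x + A n (A n x))" for n x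
    by (simp_all add: A_def)
  have c0: "c 0 = 0" and c_Suc: "c (Suc n) = (1 + (c n)\<^sup>2) / 2" for n
    by (simp_all add: c_def)
  have lin: "clinear (A n)" for n
  proof (induction n)
    case (Suc n)
    then show ?case
      by (simp add: clinear_iff A_Suc clinear_simps[OF B] cvec.scale_right_distrib mult.commute)
  qed (simp add: clinear_iff A0)
  have symA: "jinner J (A n x) y = jinner J x (A n y)" for n x y
  proof (induction n arbitrary: x y)
    case (Suc n)
    show ?case by (simp add: A_Suc jinner_simps sym Suc)
  qed (simp add: A0)
  have comm: "C (A n x) = A n (C x)" if "clinear C" "\<And>x. C (B x) = B (C x)" for C n x
  proof (induction n arbitrary: x)
    case (Suc n)
    show ?case by (simp add: A_Suc clinear_simps[OF that(1)] that(2) Suc)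
  qed (simp add: A0 clinear_zero that)
  have commA: "A m (A n x) = A n (A m x)" for m n x
    by (rule comm[OF lin]) (rule comm[OF B refl, symmetric])
  have c: "0 \<le> c n \<and> c n \<le> 1" for n
  proof (induction n)
    case (Suc n)
    then show ?case by (simp add: c_Suc power_le_one)
  qed (simp add: c0)
  have "c n \<le> c (Suc n)" for n
  proof -
    have "0 \<le> (1 - c n)\<^sup>2" by simp
    then show ?thesis by (simp add: c_Suc power2_eq_square algebra_simps)
  qed
  then have "incseq c" by (rule incseq_SucI)
  then obtain L where L: "c \<longlonglongrightarrow> L"
    using incseq_convergent[OF \<open>incseq c\<close>, of 1] c by metis
  have L1: "L \<le> 1" using LIMSEQ_le_const2[OF L] c by blast
  have normA: "jnorm J (A n x) \<le> c n * jnorm J x" for n x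
  proof (induction n arbitrary: x)
    case (Suc n)
    have "jnorm J (B x + A n (A n x)) \<le> jnorm J (B x) + jnorm J (A n (A n x))"
      by (rule jnorm_triangle)
    also have "jnorm J (A n (A n x)) \<le> c n * (c n * jnorm J x)"
      using Suc c[of n] by (meson mult_left_mono order_trans)
    finally have "jnorm J (B x + A n (A n x)) \<le> (1 + (c n)\<^sup>2) * jnorm J x"
      using contr[of x] by (simp add: power2_eq_square algebra_simps)
    then show ?case by (simp add: A_Suc c_Suc)
  qed (simp add: A0 c0)
  \<comment> \<open>As all iterates commute, the next difference is 1/2 (A_(n+1) - A_n) (A_(n+1) +
    A_n). The scalars \<open>c\<close> obey the same recursion, so the bound propagates.\<close>
  have step: "jnorm J (A (Suc n) x - A n x) \<le> (c (Suc n) - c n) * jnorm J x" for n x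
  proof (induction n arbitrary: x)
    case 0
    then show ?case using contr[of x] by (simp add: A0 A_Suc c0 c_Suc)
  next
    case (Suc n)
    let ?D = "\<lambda>x. A (Suc n) x - A n x" and ?y = "A (Suc n) x + A n x"
    have "A (Suc (Suc n)) x - A (Suc n) x = (1/2) *\<^sub>C (A (Suc n) (A (Suc n) x) - A n (A n x))"
      unfolding A_Suc[of "Suc n" x] by (subst (3) A_Suc)
        (simp add: cvec.scale_right_distrib cvec.scale_right_diff_distrib)
    also have "A (Suc n) (A (Suc n) x) - A n (A n x) = ?D ?y"
      by (simp add: clinear_simps[OF lin] commA[of n "Suc n"])
    finally have eq: "A (Suc (Suc n)) x - A (Suc n) x = (1/2) *\<^sub>C ?D ?y" .
    have "jnorm J ?y \<le> c (Suc n) * jnorm J x + c n * jnorm J x"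
      using jnorm_triangle[of "A (Suc n) x" "A n x"] normA[of "Suc n" x] normA[of n x] by linarith
    then have "(c (Suc n) - c n) * jnorm J ?y
        \<le> (c (Suc n) - c n) * (c (Suc n) * jnorm J x + c n * jnorm J x)"
      using \<open>incseq c\<close> by (intro mult_left_mono) (simp_all add: incseq_SucD)
    with Suc[of ?y] have "jnorm J (?D ?y) \<le> (c (Suc n) - c n) * (c (Suc n) * jnorm J x + c n * jnorm J x)"
      by linarith
    also have "\<dots> = 2 * ((c (Suc (Suc n)) - c (Suc n)) * jnorm J x)"
    proof -
      have "2 * c (Suc n) = 1 + (c n)\<^sup>2" "2 * c (Suc (Suc n)) = 1 + (c (Suc n))\<^sup>2"
        by (simp_all add: c_Suc)
      then show ?thesis by algebra
    qed
    finally show ?case by (simp add: eq)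
  qed
  have "\<exists>l. (\<lambda>n. jnorm J (A n x - l)) \<longlonglongrightarrow> 0" for x
  proof (rule jnorm_complete_dominated)
    show "(\<lambda>n. c n * jnorm J x) \<longlonglongrightarrow> L * jnorm J x" by (intro tendsto_mult_right L)
    show "jnorm J (A (Suc n) x - A n x) \<le> c (Suc n) * jnorm J x - c n * jnorm J x" for n
      using step[of n x] by (simp add: algebra_simps)
  qed blast
  then obtain S where S: "\<And>x. (\<lambda>n. jnorm J (A n x - S x)) \<longlonglongrightarrow> 0" by metis
  have S_add: "S (x + y) = S x + S y" for x y
  proof (rule jnorm_limit_unique[OF S], rule tendsto_zero_le)
    show "jnorm J (A n (x + y) - (S x + S y)) \<le> jnorm J (A n x - S x) + jnorm J (A n y - S y)" for n
      using jnorm_triangle[of "A n x - S x" "A n y - S y"]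
      by (simp add: clinear_simps[OF lin] algebra_simps)
    show "(\<lambda>n. jnorm J (A n x - S x) + jnorm J (A n y - S y)) \<longlonglongrightarrow> 0"
      using tendsto_add[OF S S] by simp
  qed simp
  have S_scale: "S (a *\<^sub>C x) = a *\<^sub>C S x" for a x
  proof (rule jnorm_limit_unique[OF S])
    have "jnorm J (A n (a *\<^sub>C x) - a *\<^sub>C S x) = cmod a * jnorm J (A n x - S x)" for n
      by (simp add: clinear_simps[OF lin] cvec.scale_right_diff_distrib[symmetric])
    then show "(\<lambda>n. jnorm J (A n (a *\<^sub>C x) - a *\<^sub>C S x)) \<longlonglongrightarrow> 0"
      using tendsto_mult_right_zero[OF S, of "cmod a" x] by simp
  qed
  have linS: "clinear S" by (rule clinearI) (rule S_add S_scale)+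
  have normS: "jnorm J (S x) \<le> jnorm J x" for x
  proof (rule LIMSEQ_le_const2[OF tendsto_jnorm[OF S]], intro exI allI impI)
    show "jnorm J (A n x) \<le> jnorm J x" for n
      using normA[of n x] mult_right_mono[of "c n" 1 "jnorm J x"] c[of n] by simp
  qed
  have symS: "jinner J (S x) y = jinner J x (S y)" for x y
  proof (rule LIMSEQ_unique)
    show "(\<lambda>n. jinner J (A n x) y) \<longlonglongrightarrow> jinner J (S x) y" by (rule tendsto_jinner_left[OF S])
    have "(\<lambda>n. cnj (jinner J (A n y) x)) \<longlonglongrightarrow> cnj (jinner J (S y) x)"
      by (intro tendsto_cnj tendsto_jinner_left[OF S])
    then show "(\<lambda>n. jinner J (A n x) y) \<longlonglongrightarrow> jinner J x (S y)"
      by (simp only: jinner_commute[symmetric] symA)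
  qed
  have SS: "2 *\<^sub>C S x = B x + S (S x)" for x
  proof (rule jnorm_limit_unique)
    have "jnorm J (2 *\<^sub>C A (Suc n) x - 2 *\<^sub>C S x) = 2 * jnorm J (A (Suc n) x - S x)" for n
      by (simp add: cvec.scale_right_diff_distrib[symmetric])
    then show "(\<lambda>n. jnorm J (2 *\<^sub>C A (Suc n) x - 2 *\<^sub>C S x)) \<longlonglongrightarrow> 0"
      using tendsto_mult_right_zero[OF LIMSEQ_Suc[OF S], of 2 x] by simp
    show "(\<lambda>n. jnorm J (2 *\<^sub>C A (Suc n) x - (B x + S (S x)))) \<longlonglongrightarrow> 0"
    proof (rule tendsto_zero_le)
      show "(\<lambda>n. jnorm J (A n x - S x) + jnorm J (A n (S x) - S (S x))) \<longlonglongrightarrow> 0"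
        using tendsto_add[OF S S] by simp
      fix n
      have "2 *\<^sub>C A (Suc n) x - (B x + S (S x)) = A n (A n x - S x) + (A n (S x) - S (S x))"
        by (simp add: A_Suc scaleC_scaleC clinear_simps[OF lin])
      then have "jnorm J (2 *\<^sub>C A (Suc n) x - (B x + S (S x)))
          \<le> jnorm J (A n (A n x - S x)) + jnorm J (A n (S x) - S (S x))"
        by (simp only: jnorm_triangle)
      also have "jnorm J (A n (A n x - S x)) \<le> 1 * jnorm J (A n x - S x)"
        using normA[of n "A n x - S x"] mult_right_mono[of "c n" 1 "jnorm J (A n x - S x)"] c[of n]
        by simp
      finally show "jnorm J (2 *\<^sub>C A (Suc n) x - (B x + S (S x)))
          \<le> jnorm J (A n x - S x) + jnorm J (A n (S x) - S (S x))" by simp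
    qed simp
  qed
  show ?thesis
  proof (rule that[of "\<lambda>x. x - S x"])
    have bS: "bounded_op S" by (rule bounded_opI[OF linS, of 1]) (simp add: normS)
    show "positive_op J (\<lambda>x. x - S x)"
    proof (rule positive_opI)
      show "bounded_op (\<lambda>x. x - S x)" by (intro bounded_op_diff bounded_op_id bS)
      show "jinner J (x - S x) y = jinner J x (y - S y)" for x y
        by (simp add: jinner_simps symS)
      fix x
      have "Re (jinner J (S x) x) \<le> jnorm J (S x) * jnorm J x"
        using jinner_Cauchy_Schwarz[of "S x" x] complex_Re_le_cmod order_trans by blast
      also have "\<dots> \<le> jnorm J x * jnorm J x" by (intro mult_right_mono normS) simp
      finally show "0 \<le> Re (jinner J (x - S x) x)"
        by (simp add: jinner_simps jinner_self power2_eq_square)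
    qed
    show "x - S x - S (x - S x) = x - B x" for x
      using SS[of x] scaleC_add_left[of 1 1 "S x"]
      by (simp add: clinear_simps[OF linS] scaleC_one algebra_simps)
    fix C x
    assume C: "clinear C" "\<And>x. C (B x) = B (C x)" "bounded_op C"
    have "C (S x) = S (C x)"
    proof (rule jnorm_limit_unique)
      show "(\<lambda>n. jnorm J (C (A n x) - C (S x))) \<longlonglongrightarrow> 0" by (rule tendsto_bounded_op[OF C(3) S])
      show "(\<lambda>n. jnorm J (C (A n x) - S (C x))) \<longlonglongrightarrow> 0"
        using S[of "C x"] by (simp add: comm[OF C(1,2)])
    qed
    then show "C (x - S x) = C x - S (C x)" by (simp add: clinear_diff[OF C(1)])
  qed
qed

text \<open>With \<open>M\<close> a norm bound for \<open>A\<close>, the operator B = 1 - A / M lies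
  between 0 and 1 and is therefore a contraction; the root of 1 - B is rescaled by the square root
  of \<open>M\<close>.\<close>

lemma ex_sqrt_op:
  assumes A: "positive_op J A"
  obtains R where "positive_op J R" and "\<And>x. R (R x) = A x"
    and "\<And>C x. bounded_op C \<Longrightarrow> (\<And>x. C (A x) = A (C x)) \<Longrightarrow> C (R x) = R (C x)"
proof -
  note lin = positive_op_clinear[OF A]
  obtain M where M: "0 < M" "\<And>x. jnorm J (A x) \<le> M * jnorm J x"
    using bounded_opE[OF positive_op_bounded[OF A]] by blast
  define B where "B x = x - of_real (1 / M) *\<^sub>C A x" for x
  have linB: "clinear B"
    by (simp add: clinear_iff B_def clinear_simps[OF lin] cvec.scale_right_distrib
        cvec.scale_right_diff_distrib mult.commute)
  have symB: "jinner J (B x) y = jinner J x (B y)" for x y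
    by (simp add: B_def jinner_simps positive_op_sym[OF A])
  have Bx: "Re (jinner J (B x) x) = (jnorm J x)\<^sup>2 - Re (jinner J (A x) x) / M" for x
    by (simp add: B_def jinner_simps jinner_self)
  have le: "Re (jinner J (B x) x) \<le> 1 * (jnorm J x)\<^sup>2" for x
    unfolding Bx using M(1) positive_op_nonneg[OF A, of x] by simp
  have pos: "0 \<le> Re (jinner J (B x) x)" for x
  proof -
    have "Re (jinner J (A x) x) \<le> jnorm J (A x) * jnorm J x"
      using jinner_Cauchy_Schwarz[of "A x" x] complex_Re_le_cmod order_trans by blast
    also have "\<dots> \<le> M * jnorm J x * jnorm J x" by (intro mult_right_mono M) simp
    finally show ?thesis
      unfolding Bx using M(1) by (simp add: field_simps power2_eq_square)
  qed
  have "jnorm J (B x) \<le> jnorm J x" for x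
    using jnorm_sq_le_positive[OF linB symB pos le, of x] le[of x]
    by (simp add: power2_le_imp_le)
  then obtain R where R: "positive_op J R" "\<And>x. R (R x) = x - B x"
    "\<And>C x. clinear C \<Longrightarrow> (\<And>x. C (B x) = B (C x)) \<Longrightarrow> bounded_op C \<Longrightarrow> C (R x) = R (C x)"
    using ex_sqrt_contraction[OF linB symB] by metis
  note linR = positive_op_clinear[OF R(1)]
  show ?thesis
  proof (rule that[of "\<lambda>x. of_real (sqrt M) *\<^sub>C R x"])
    show "positive_op J (\<lambda>x. of_real (sqrt M) *\<^sub>C R x)"
      using R(1) M(1) positive_op_nonneg[OF R(1)]
      by (intro positive_opI) (simp_all add: bounded_op_scale positive_op_bounded jinner_simps positive_op_sym)
    show "of_real (sqrt M) *\<^sub>C R (of_real (sqrt M) *\<^sub>C R x) = A x" for x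
      using M(1) by (simp add: clinear_simps[OF linR] R(2) B_def flip: of_real_mult)
    fix C x
    assume C: "bounded_op C" "\<And>x. C (A x) = A (C x)"
    have linC: "clinear C" by (rule bounded_op_clinear[OF C(1)])
    have "C (R x) = R (C x)"
      by (rule R(3)[OF linC _ C(1)]) (simp add: B_def clinear_simps[OF linC] C(2))
    then show "C (of_real (sqrt M) *\<^sub>C R x) = of_real (sqrt M) *\<^sub>C R (C x)"
      by (simp add: clinear_simps[OF linC])
  qed
qed

lemma positive_op_eq_0:
  assumes A: "positive_op J A" and "Re (jinner J (A x) x) = 0"
  shows "A x = 0"
proof -
  obtain R where R: "positive_op J R" "\<And>x. R (R x) = A x" using ex_sqrt_op[OF A] by metis
  have "(jnorm J (R x))\<^sup>2 = 0"
    using assms(2) by (simp only: jnorm_sq positive_op_sym[OF R(1), of x] R(2)[symmetric])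
      (simp add: positive_op_sym[OF R(1)])
  then have "R x = 0" by simp
  then show ?thesis using R(2)[of x] by (simp add: clinear_zero[OF positive_op_clinear[OF R(1)]])
qed

text \<open>Every root Q of \<open>A\<close> commutes with \<open>A\<close>, hence with the
  constructed root R. Then Q + R annihilates y = (Q - R) x, positivity forces Q y = R y = 0, and <y,
  y> = <x, (Q - R) y> = 0.\<close>

lemma sqrt_op_unique:
  assumes A: "positive_op J A" and "positive_op J R1" "\<And>x. R1 (R1 x) = A x"
    and "positive_op J R2" "\<And>x. R2 (R2 x) = A x"
  shows "R1 = R2"
proof -
  obtain R where R: "positive_op J R" "\<And>x. R (R x) = A x"
    and comm: "\<And>C x. bounded_op C \<Longrightarrow> (\<And>x. C (A x) = A (C x)) \<Longrightarrow> C (R x) = R (C x)"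
    using ex_sqrt_op[OF A] by blast
  have "Q = R" if Q: "positive_op J Q" "\<And>x. Q (Q x) = A x" for Q
  proof
    fix x
    have lin: "clinear Q" "clinear R" using Q R by (simp_all add: positive_op_clinear)
    have QR: "Q (R x) = R (Q x)" for x
      by (rule comm) (simp_all add: positive_op_bounded Q(1) flip: Q(2))
    define y where "y = Q x - R x"
    have "Q y + R y = 0"
      by (simp add: y_def clinear_simps[OF lin(1)] clinear_simps[OF lin(2)] Q(2) R(2) QR)
    then have "Re (jinner J (Q y) y) + Re (jinner J (R y) y) = 0"
      by (metis jinner_add_left jinner_zero_left plus_complex.sel(1) zero_complex.sel(1))
    then have "Re (jinner J (Q y) y) = 0" "Re (jinner J (R y) y) = 0"
      using positive_op_nonneg[OF Q(1), of y] positive_op_nonneg[OF R(1), of y] by linarith+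
    then have "Q y = 0" "R y = 0" using positive_op_eq_0 Q(1) R(1) by blast+
    then have "jinner J y y = 0"
      by (subst (1) y_def) (simp add: jinner_simps positive_op_sym[OF Q(1)] positive_op_sym[OF R(1)])
    then show "Q x = R x" by (simp add: y_def)
  qed
  then show ?thesis using assms by blast
qed

lemma sqrt_op_eqI:
  assumes "positive_op J R" and "\<And>x. R (R x) = A x"
  shows "sqrt_op J A = R"
proof -
  have "positive_op J A"
  proof (rule positive_opI)
    have "A = (\<lambda>x. R (R x))" using assms by auto
    then show "bounded_op A" by (simp add: bounded_op_comp positive_op_bounded assms(1))
    show "jinner J (A x) y = jinner J x (A y)" for x y
      by (simp add: assms(2)[symmetric] positive_op_sym[OF assms(1)])
    show "0 \<le> Re (jinner J (A x) x)" for x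
      using zero_le_power2[of "jnorm J (R x)"]
      by (simp add: assms(2)[symmetric] positive_op_sym[OF assms(1), of "R x"] jnorm_sq)
  qed
  note unique = sqrt_op_unique[OF this _ _ assms]
  show ?thesis
    unfolding sqrt_op_def
  proof (rule the_equality)
    show "positive_op J R \<and> R \<circ> R = A" using assms by auto
    show "Q = R" if "positive_op J Q \<and> Q \<circ> Q = A" for Q
      using that by (intro unique) auto
  qed
qed

lemma sqrt_op:
  assumes "positive_op J A"
  shows positive_op_sqrt_op: "positive_op J (sqrt_op J A)"
    and sqrt_op_sqrt_op: "sqrt_op J A (sqrt_op J A x) = A x"
proof -
  obtain R where R: "positive_op J R" "\<And>x. R (R x) = A x" using ex_sqrt_op[OF assms] by metis
  then show "positive_op J (sqrt_op J A)" "sqrt_op J A (sqrt_op J A x) = A x"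
    using sqrt_op_eqI[OF R] by simp_all
qed

section \<open>Absolute values and the polar decomposition\<close>

lemma positive_op_jadj_comp:
  assumes "bounded_op A"
  shows "positive_op J (jadj J A \<circ> A)"
proof (rule positive_opI)
  show "bounded_op (jadj J A \<circ> A)"
    unfolding comp_def by (rule bounded_op_comp[OF bounded_op_jadj[OF assms] assms])
  show "0 \<le> Re (jinner J ((jadj J A \<circ> A) x) x)" for x
    by (simp add: jinner_jadj'[OF assms] jinner_self)
qed (simp add: jinner_jadj'[OF assms] jinner_jadj[OF assms, symmetric])

lemma positive_op_abs_op: "bounded_op A \<Longrightarrow> positive_op J (abs_op J A)"
  unfolding abs_op_def by (intro positive_op_sqrt_op positive_op_jadj_comp)

lemma jnorm_abs_op:
  assumes "bounded_op A"
  shows "jnorm J (abs_op J A x) = jnorm J (A x)"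
proof -
  have "jinner J (abs_op J A x) (abs_op J A x) = jinner J (abs_op J A (abs_op J A x)) x"
    using positive_op_sym[OF positive_op_abs_op[OF assms]] by simp
  also have "\<dots> = jinner J (A x) (A x)"
    unfolding abs_op_def sqrt_op_sqrt_op[OF positive_op_jadj_comp[OF assms]]
    by (simp add: jinner_jadj'[OF assms])
  finally show ?thesis by (simp add: jnorm_def)
qed

lemma abs_op_positive:
  assumes "positive_op J A"
  shows "abs_op J A = A"
proof -
  have "jadj J A = A" by (rule jadj_eqI) (rule positive_op_sym[OF assms])
  then show ?thesis unfolding abs_op_def by (intro sqrt_op_eqI assms) simp
qed

text \<open>Any candidate has U A = A. Taking adjoints shows that the adjoint of U moves every
  vector only by an element of ker A, so U fixes the orthogonal complement of ker A; since it
  vanishes on ker A, only the projection is left.\<close>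

lemma polar_op_positive:
  assumes A: "positive_op J A"
  shows "polar_op J A = (\<lambda>x. x - jproj J (ker A) x)"
  unfolding polar_op_def abs_op_positive[OF A]
proof (rule the_equality)
  note bA = positive_op_bounded[OF A]
  note linA = bounded_op_clinear[OF bA]
  note cl = closed_subspace_ker[OF bA]
  note sub = subspace_ker[OF linA]
  have ran: "A x \<in> jorth J (ker A)" for x
    by (auto simp: jorth_def positive_op_sym[OF A])
  have ker: "ker (\<lambda>x. x - jproj J (ker A) x) = ker A"
    using jproj_ident[OF sub] jproj_mem[OF cl] by auto metis
  show "partial_isometry J (\<lambda>x. x - jproj J (ker A) x) \<and> ker (\<lambda>x. x - jproj J (ker A) x) = ker A
      \<and> A = (\<lambda>x. x - jproj J (ker A) x) \<circ> A"
    unfolding partial_isometry_def ker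
    using jproj_eq_0[OF sub] ran
    by (auto simp: fun_eq_iff bounded_op_diff bounded_op_id bounded_op_jproj[OF cl])
  fix U assume U: "partial_isometry J U \<and> ker U = ker A \<and> A = U \<circ> A"
  then have bU: "bounded_op U" and kerU: "ker U = ker A" and UA: "\<And>x. U (A x) = A x"
    by (auto simp: partial_isometry_def fun_eq_iff)
  note linU = bounded_op_clinear[OF bU]
  have ident: "U x = x" if x: "x \<in> jorth J (ker A)" for x
  proof -
    have adj: "jadj J U y - y \<in> ker A" for y
    proof -
      have "jinner J z (A (jadj J U y - y)) = jinner J z 0" for z
        by (simp add: positive_op_sym[OF A, symmetric] jinner_diff_right
            jinner_jadj[OF bU, symmetric] UA)
      then have "A (jadj J U y - y) = 0" by (rule jinner_eqI)
      then show ?thesis by simp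
    qed
    have "jinner J (U x - x) (U x - x) = jinner J x (jadj J U (U x - x) - (U x - x))"
      by (simp add: jinner_diff_left jinner_diff_right[of x] jinner_jadj[OF bU, symmetric])
    also have "\<dots> = 0" using jorthD[OF x adj] .
    finally show ?thesis by simp
  qed
  show "U = (\<lambda>x. x - jproj J (ker A) x)"
  proof
    fix x
    have "U x = U (x - jproj J (ker A) x) + U (jproj J (ker A) x)"
      by (simp add: clinear_diff[OF linU])
    moreover have "U (jproj J (ker A) x) = 0" using jproj_mem[OF cl, of x] kerU by blast
    moreover have "U (x - jproj J (ker A) x) = x - jproj J (ker A) x"
      by (intro ident jproj_orth cl)
    ultimately show "U x = x - jproj J (ker A) x" by simp
  qed
qed

end

section \<open>Orthonormal bases and the trace\<close>

context signature
begin

definition orthonormal :: "'a set \<Rightarrow> bool" where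
  "orthonormal E \<longleftrightarrow> (\<forall>e\<in>E. \<forall>f\<in>E. jinner J e f = (if e = f then 1 else 0))"

lemma orthonormal_basis_iff:
  "orthonormal_basis J E \<longleftrightarrow>
    orthonormal E \<and> (\<forall>x. \<forall>r>0. \<exists>y\<in>cvec.span E. jnorm J (x - y) < r)"
  unfolding orthonormal_basis_def orthonormal_def jtopology_closure_of by blast

text \<open>Zorn: if the span of a maximal orthonormal set were not dense, the normalized residual
  of a projection could be added. Starting from \<open>{}\<close> gives some basis; starting from
  \<open>{e}\<close> puts a prescribed unit vector into one.\<close>

lemma ex_orthonormal_basis:
  assumes "orthonormal E0"
  obtains E where "orthonormal_basis J E" and "E0 \<subseteq> E"
proof -
  let ?\<A> = "{E. E0 \<subseteq> E \<and> orthonormal E}"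
  have "\<exists>M\<in>?\<A>. \<forall>X\<in>?\<A>. M \<subseteq> X \<longrightarrow> X = M"
  proof (rule subset_Zorn_nonempty)
    show "?\<A> \<noteq> {}" using assms by blast
    fix \<C> assume ne: "\<C> \<noteq> {}" and ch: "subset.chain ?\<A> \<C>"
    have "orthonormal (\<Union>\<C>)"
      unfolding orthonormal_def
    proof (intro ballI)
      fix e f assume "e \<in> \<Union>\<C>" "f \<in> \<Union>\<C>"
      then obtain E where E: "E \<in> \<C>" "e \<in> E" "f \<in> E"
        using ch unfolding subset_chain_def by blast
      then have "orthonormal E" using ch unfolding subset_chain_def by blast
      with E show "jinner J e f = (if e = f then 1 else 0)" by (simp add: orthonormal_def)
    qed
    moreover have "E0 \<subseteq> \<Union>\<C>" using ne ch unfolding subset_chain_def by blast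
    ultimately show "\<Union>\<C> \<in> ?\<A>" by blast
  qed
  then obtain E where mem: "E \<in> ?\<A>" and max': "\<forall>X\<in>?\<A>. E \<subseteq> X \<longrightarrow> X = E"
    by (rule bexE)
  then have E: "E0 \<subseteq> E" "orthonormal E" by simp_all
  have max: "X = E" if "E \<subseteq> X" "orthonormal X" for X
    using max' E(1) that by simp
  have "\<exists>y\<in>cvec.span E. jnorm J (x - y) < r" if r: "r > 0" for x r
  proof -
    obtain s p where s: "\<And>n. s n \<in> cvec.span E" and p: "(\<lambda>n. jnorm J (s n - p)) \<longlonglongrightarrow> 0"
      and orth: "x - p \<in> jorth J (cvec.span E)"
      using ex_projection[OF cvec.subspace_span, of E x] by metis
    have "x = p"
    proof (rule ccontr)
      assume "x \<noteq> p"
      then have pos: "0 < jnorm J (x - p)" by (intro jnorm_pos) simp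
      define u where "u = of_real (1 / jnorm J (x - p)) *\<^sub>C (x - p)"
      have "jnorm J u = 1" using pos \<open>x \<noteq> p\<close> by (simp add: u_def norm_divide)
      then have uu: "jinner J u u = 1" by (simp add: jinner_self)
      have ue: "jinner J u e = 0" "jinner J e u = 0" if "e \<in> E" for e
        using jorthD[OF orth cvec.span_base[OF that]] jorthD'[OF orth cvec.span_base[OF that]]
        by (simp_all add: u_def jinner_scale_left jinner_scale_right)
      have "u \<notin> E" using ue uu by force
      moreover have "orthonormal (insert u E)"
        using E(2) uu ue \<open>u \<notin> E\<close> unfolding orthonormal_def by auto
      ultimately show False using max[of "insert u E"] by blast
    qed
    with p have "(\<lambda>n. jnorm J (x - s n)) \<longlonglongrightarrow> 0" by (simp add: jnorm_commute)
    then have "\<forall>\<^sub>F n in sequentially. jnorm J (x - s n) < r"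
      using r by (rule order_tendstoD)
    then obtain n where "jnorm J (x - s n) < r"
      using eventually_happens'[OF sequentially_bot] by blast
    then show ?thesis using s by blast
  qed
  with E that show ?thesis unfolding orthonormal_basis_iff by blast
qed

lemma jinner_sum_left: "jinner J (\<Sum>i\<in>I. f i) y = (\<Sum>i\<in>I. jinner J (f i) y)"
  by (induction I rule: infinite_finite_induct) (simp_all add: jinner_add_left)

lemma orthonormal_expansion:
  assumes "orthonormal F" and "finite F"
  defines "p \<equiv> \<lambda>x. \<Sum>e\<in>F. jinner J x e *\<^sub>C e"
  shows orthonormal_Pythagoras: "(jnorm J x)\<^sup>2 = (jnorm J (x - p x))\<^sup>2 + (\<Sum>e\<in>F. (cmod (jinner J x e))\<^sup>2)"
    and orthonormal_best_approximation: "y \<in> cvec.span F \<Longrightarrow> jnorm J (x - p x) \<le> jnorm J (x - y)"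
proof -
  have "jinner J (p x) e = jinner J x e" if "e \<in> F" for e
  proof -
    have "jinner J (p x) e = (\<Sum>f\<in>F. jinner J x f * (if f = e then 1 else 0))"
      unfolding p_def jinner_sum_left using assms(1) that
      by (intro sum.cong) (auto simp: orthonormal_def jinner_scale_left)
    also have "\<dots> = (\<Sum>f\<in>F. if f = e then jinner J x f else 0)" by (intro sum.cong) auto
    also have "\<dots> = jinner J x e" using assms(2) that by simp
    finally show ?thesis .
  qed
  then have "F \<subseteq> {z. jinner J (x - p x) z = 0}" by (auto simp: jinner_diff_left)
  moreover have "cvec.subspace {z. jinner J (x - p x) z = 0}"
    by (simp add: cvec.subspace_def jinner_simps)
  ultimately have orth: "jinner J (x - p x) z = 0" if "z \<in> cvec.span F" for z
    using cvec.span_minimal that by blast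
  have pF: "p x \<in> cvec.span F"
    unfolding p_def by (intro cvec.span_sum cvec.span_scale cvec.span_base)
  have "(jnorm J (p x))\<^sup>2 = Re (jinner J (p x) x)"
    using orth[OF pF] by (simp add: jnorm_sq jinner_diff_left jinner_commute[of "p x" x])
  also have "\<dots> = (\<Sum>e\<in>F. (cmod (jinner J x e))\<^sup>2)"
    unfolding p_def jinner_sum_left
    by (simp add: jinner_scale_left jinner_scale_right jinner_commute[of _ x] cmod_power2)
      (simp add: power2_eq_square)
  finally have "(jnorm J (p x))\<^sup>2 = (\<Sum>e\<in>F. (cmod (jinner J x e))\<^sup>2)" .
  then show "(jnorm J x)\<^sup>2 = (jnorm J (x - p x))\<^sup>2 + (\<Sum>e\<in>F. (cmod (jinner J x e))\<^sup>2)"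
    using jnorm_add_sq[of "x - p x" "p x"] orth[OF pF] by simp
  assume "y \<in> cvec.span F"
  then have "p x - y \<in> cvec.span F" using pF cvec.span_diff by blast
  then have "(jnorm J (x - y))\<^sup>2 = (jnorm J (x - p x))\<^sup>2 + (jnorm J (p x - y))\<^sup>2"
    using jnorm_add_sq[of "x - p x" "p x - y"] orth by simp
  then show "jnorm J (x - p x) \<le> jnorm J (x - y)"
    by (simp add: power2_le_imp_le)
qed

text \<open>Bessel's inequality bounds the finite sums. Density gives the reverse estimate, because
  the expansion over a finite subset is the best approximation from its span.\<close>

lemma Parseval:
  assumes "orthonormal_basis J E"
  shows "((\<lambda>e. (cmod (jinner J x e))\<^sup>2) has_sum (jnorm J x)\<^sup>2) E"
proof -
  let ?f = "\<lambda>e. (cmod (jinner J x e))\<^sup>2"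
  have E: "orthonormal E" and dense: "\<And>r. r > 0 \<Longrightarrow> \<exists>y\<in>cvec.span E. jnorm J (x - y) < r"
    using assms by (auto simp: orthonormal_basis_iff)
  have sub: "orthonormal F" if "F \<subseteq> E" for F
    using E that unfolding orthonormal_def by (meson subsetD)
  have le: "sum ?f F \<le> (jnorm J x)\<^sup>2" if "finite F" "F \<subseteq> E" for F
    using orthonormal_Pythagoras[OF sub[OF that(2)] that(1), of x] by simp
  have summable: "?f summable_on E"
    by (rule nonneg_bdd_above_summable_on) (use le in \<open>auto intro!: bdd_aboveI[of _ "(jnorm J x)\<^sup>2"]\<close>)
  have "infsum ?f E \<le> (jnorm J x)\<^sup>2" by (rule infsum_le_finite_sums[OF summable le])
  moreover have "(jnorm J x)\<^sup>2 \<le> infsum ?f E"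
  proof (rule field_le_epsilon)
    fix e :: real assume e: "0 < e"
    then obtain y where y: "y \<in> cvec.span E" "jnorm J (x - y) < sqrt e"
      using dense[of "sqrt e"] by auto
    then obtain F r where F: "finite F" "F \<subseteq> E" "y = (\<Sum>a\<in>F. r a *\<^sub>C a)"
      unfolding cvec.span_explicit by blast
    have "y \<in> cvec.span F"
      unfolding F(3) by (rule cvec.span_sum) (rule cvec.span_scale, erule cvec.span_base)
    note orthonormal_best_approximation[OF sub[OF F(2)] F(1) this, of x]
    with y(2) have "jnorm J (x - (\<Sum>e\<in>F. jinner J x e *\<^sub>C e)) < sqrt e" by linarith
    then have "(jnorm J (x - (\<Sum>e\<in>F. jinner J x e *\<^sub>C e)))\<^sup>2 < (sqrt e)\<^sup>2"
      by (intro power_strict_mono) simp_all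
    then have "(jnorm J x)\<^sup>2 \<le> sum ?f F + e"
      using orthonormal_Pythagoras[OF sub[OF F(2)] F(1), of x] e by simp
    moreover have "sum ?f F \<le> infsum ?f E"
      by (rule finite_sum_le_infsum[OF summable F(1,2)]) simp
    ultimately show "(jnorm J x)\<^sup>2 \<le> infsum ?f E + e" by simp
  qed
  ultimately show ?thesis using has_sum_infsum[OF summable] by simp
qed

end

section \<open>Hilbert-Schmidt sums and existence of the trace\<close>

lemma has_sum_swap_nonneg:
  fixes f :: "'b \<Rightarrow> 'c \<Rightarrow> real"
  assumes nonneg: "\<And>a b. 0 \<le> f a b"
    and g: "\<And>a. a \<in> A \<Longrightarrow> (f a has_sum g a) B"
    and h: "\<And>b. b \<in> B \<Longrightarrow> ((\<lambda>a. f a b) has_sum h b) A"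
    and s: "(g has_sum s) A"
  shows "(h has_sum s) B"
proof -
  \<comment> \<open>Tonelli for unordered sums: nonnegative terms with summable iterated sums are
    summable on the product, where the order of summation can be exchanged.\<close>
  have "(\<lambda>(a, b). f a b) summable_on A \<times> B"
    using s by (intro summable_on_SigmaI[where g = g]) (auto simp: g nonneg summable_on_def)
  then have "((\<lambda>(a, b). f a b) has_sum s) (A \<times> B)"
    by (intro has_sum_SigmaI[where g = g]) (auto simp: g s)
  then have "((\<lambda>(b, a). f a b) has_sum s) (B \<times> A)"
    by (subst (asm) has_sum_swap) simp
  then show ?thesis
    by (rule has_sum_SigmaD) (simp add: h)
qed

lemma kadj_eqI:
  fixes A :: "'a::krein_space \<Rightarrow> 'a"
  assumes "bounded_op A" and "\<And>x y. kinner (A x) y = kinner x (B y)"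
  shows "kadj A = B"
proof -
  obtain J :: "'a \<Rightarrow> 'a" where "signature_op J" using ex_signature_op by blast
  then interpret signature J by unfold_locales
  show ?thesis
  proof
    fix y
    have "kinner x (kadj A y) = kinner x (B y)" for x
      using assms by (simp add: kinner_kadj[OF assms(1), symmetric])
    then have "jinner J x (kadj A y) = jinner J x (B y)" for x
      by (simp add: jinner_def)
    then show "kadj A y = B y" by (rule jinner_eqI)
  qed
qed

text \<open>Both sums are sums of the matrix coefficients \<open>\<bar>[A e, J' f]\<bar>\<^sup>2\<close>.\<close>
lemma Hilbert_Schmidt_kadj:
  assumes "signature_op J" and "signature_op J'"
    and E: "orthonormal_basis J E" and F: "orthonormal_basis J' F" and A: "bounded_op A"
    and sum: "((\<lambda>e. (jnorm J' (A e))\<^sup>2) has_sum s) E"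
  shows "((\<lambda>f. (jnorm J (kadj A (J' f)))\<^sup>2) has_sum s) F"
proof -
  interpret signature J by standard fact
  interpret J': signature J' by standard fact
  have coeff: "cmod (jinner J' (A e) f) = cmod (jinner J (J (kadj A (J' f))) e)" for e f
  proof -
    have "jinner J' (A e) f = jinner J e (J (kadj A (J' f)))"
      by (simp add: J'.kinner_eq_jinner(2)[symmetric] kinner_kadj[OF A] jinner_def J_sym J'.J_sym)
    then show ?thesis by (metis complex_mod_cnj jinner_commute)
  qed
  show ?thesis
  proof (rule has_sum_swap_nonneg[OF _ _ _ sum])
    show "((\<lambda>f. (cmod (jinner J' (A e) f))\<^sup>2) has_sum (jnorm J' (A e))\<^sup>2) F" for e
      by (rule J'.Parseval[OF F])
    show "((\<lambda>e. (cmod (jinner J' (A e) f))\<^sup>2) has_sum (jnorm J (kadj A (J' f)))\<^sup>2) E" for f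
      using Parseval[OF E, of "J (kadj A (J' f))"] by (simp add: coeff)
  qed simp
qed

context signature
begin

text \<open>J A^# J is the Hilbert space adjoint of \<open>A\<close>. Knowing its Krein adjoint
  allows a second application of \<open>Hilbert_Schmidt_kadj\<close>, which returns from the adjoint
  to \<open>A\<close>.\<close>

lemma bounded_op_J_kadj_J:
  assumes A: "bounded_op A"
  shows "bounded_op (\<lambda>x. J (kadj A (J x)))" and "kadj (\<lambda>x. J (kadj A (J x))) = (\<lambda>x. J (A (J x)))"
proof -
  show *: "bounded_op (\<lambda>x. J (kadj A (J x)))"
    by (rule bounded_op_comp[OF bounded_op_J bounded_op_comp[OF bounded_op_kadj[OF A] bounded_op_J]])
  show "kadj (\<lambda>x. J (kadj A (J x))) = (\<lambda>x. J (A (J x)))"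
    by (rule kadj_eqI[OF *]) (simp add: J_sym kinner_kadj'[OF A])
qed

lemma Hilbert_Schmidt_from_kadj:
  assumes A: "bounded_op A" and E: "orthonormal_basis J E" and F: "orthonormal_basis J F"
    and sum: "((\<lambda>e. (jnorm J (kadj A (J e)))\<^sup>2) has_sum s) E"
  shows "((\<lambda>f. (jnorm J (A f))\<^sup>2) has_sum s) F"
proof -
  have "((\<lambda>e. (jnorm J (J (kadj A (J e))))\<^sup>2) has_sum s) E" using sum by simp
  from Hilbert_Schmidt_kadj[OF signature_op signature_op E F bounded_op_J_kadj_J(1)[OF A] this]
  show ?thesis by (simp add: bounded_op_J_kadj_J(2)[OF A])
qed

text \<open>Two passages through the adjoint, the first within \<open>E\<close> and the second from
  \<open>E\<close> to \<open>F\<close>; each preserves the sum.\<close>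

lemma Hilbert_Schmidt_basis_independent:
  assumes A: "bounded_op A" and E: "orthonormal_basis J E" and F: "orthonormal_basis J F"
    and sum: "((\<lambda>e. (jnorm J (A e))\<^sup>2) has_sum s) E"
  shows "((\<lambda>f. (jnorm J (A f))\<^sup>2) has_sum s) F"
  by (rule Hilbert_Schmidt_from_kadj[OF A E F])
    (rule Hilbert_Schmidt_kadj[OF signature_op signature_op E E A sum])

lemma jnorm_sq_summable_mono:
  assumes "(\<lambda>e. (g e)\<^sup>2) summable_on E"
    and "\<And>e. jnorm J (f e) \<le> c * g e"
  shows "(\<lambda>e. (jnorm J (f e))\<^sup>2) summable_on E"
proof (rule summable_on_comparison_test)
  show "(\<lambda>e. c\<^sup>2 * (g e)\<^sup>2) summable_on E"
    using assms(1) by (rule summable_on_cmult_right)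
  show "(jnorm J (f e))\<^sup>2 \<le> c\<^sup>2 * (g e)\<^sup>2" for e
    using power_mono[OF assms(2), of e 2] by (simp add: power_mult_distrib)
qed simp

text \<open>T x and \<bar>T\<bar> x have the same norm, and \<bar>T\<bar>^2 \<le> M \<bar>T\<bar> as
  forms, which gives summability for the \<open>J0\<close> and \<open>E0\<close> of the definition.
  Since \<open>E0\<close> need not be \<open>J\<close>-orthonormal, it is exchanged for
  \<open>E\<close> by passing to the adjoint, where \<open>Hilbert_Schmidt_kadj\<close> admits two
  signature operators.\<close>

lemma trace_class_summable_jnorm:
  assumes T: "trace_class T" and E: "orthonormal_basis J E"
  shows "(\<lambda>e. (jnorm J (T e))\<^sup>2) summable_on E"
proof -
  from T obtain J0 E0 where bT: "bounded_op T" and J0: "signature_op J0"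
    and E0: "orthonormal_basis J0 E0" and sum: "(\<lambda>e. jinner J0 (abs_op J0 T e) e) summable_on E0"
    unfolding trace_class_def by blast
  interpret J0: signature J0 by standard fact
  note pos = J0.positive_op_abs_op[OF bT]
  obtain M where M: "0 < M" "\<And>x. jnorm J0 (abs_op J0 T x) \<le> M * jnorm J0 x"
    using J0.bounded_opE[OF J0.positive_op_bounded[OF pos]] by blast
  have le: "(jnorm J0 (T x))\<^sup>2 \<le> M * Re (jinner J0 (abs_op J0 T x) x)" for x
  proof -
    have "Re (jinner J0 (abs_op J0 T x) x) \<le> M * (jnorm J0 x)\<^sup>2" for x
    proof -
      have "Re (jinner J0 (abs_op J0 T x) x) \<le> jnorm J0 (abs_op J0 T x) * jnorm J0 x"
        using J0.jinner_Cauchy_Schwarz complex_Re_le_cmod order_trans by blast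
      also have "\<dots> \<le> M * jnorm J0 x * jnorm J0 x" by (intro mult_right_mono M) simp
      finally show ?thesis by (simp add: power2_eq_square mult.assoc)
    qed
    from J0.jnorm_sq_le_positive[OF J0.positive_op_clinear[OF pos] J0.positive_op_sym[OF pos]
        J0.positive_op_nonneg[OF pos] this, of x]
    show ?thesis by (simp add: J0.jnorm_abs_op[OF bT])
  qed
  have "(\<lambda>e. Re (jinner J0 (abs_op J0 T e) e)) summable_on E0"
    using sum has_sum_Re unfolding summable_on_def by blast
  then have "(\<lambda>e. M * Re (jinner J0 (abs_op J0 T e) e)) summable_on E0"
    by (rule summable_on_cmult_right)
  then have s0: "(\<lambda>e. (jnorm J0 (T e))\<^sup>2) summable_on E0"
    using le by (rule summable_on_comparison_test) simp
  obtain C where C: "\<And>x. jnorm J x \<le> C * jnorm J0 x" using jnorm_equivalent[OF J0] by metis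
  have "(\<lambda>e. (jnorm J (T e))\<^sup>2) summable_on E0"
    by (rule jnorm_sq_summable_mono[OF s0 C])
  then have "(\<lambda>f. (jnorm J0 (kadj T (J f)))\<^sup>2) summable_on E"
    using Hilbert_Schmidt_kadj[OF J0 signature_op E0 E bT] unfolding summable_on_def by blast
  then have "(\<lambda>f. (jnorm J (kadj T (J f)))\<^sup>2) summable_on E"
    by (rule jnorm_sq_summable_mono[OF _ C])
  then show ?thesis
    using Hilbert_Schmidt_from_kadj[OF bT E E] unfolding summable_on_def by blast
qed

text \<open>A bounded factor on the left only costs a constant in a sum of squared norms; the
  adjoint moves \<open>X\<close> from the right to the left.\<close>

lemma trace_class_comp_summable_jnorm:
  assumes T: "trace_class T" and X: "bounded_op X" and E: "orthonormal_basis J E"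
  shows "(\<lambda>e. (jnorm J (T (X e)))\<^sup>2) summable_on E"
proof -
  have bT: "bounded_op T" using T by (simp add: trace_class_def)
  have TX: "bounded_op (\<lambda>x. T (X x))" by (rule bounded_op_comp[OF bT X])
  have adj: "kadj (\<lambda>x. T (X x)) = (\<lambda>y. kadj X (kadj T y))"
    by (rule kadj_eqI[OF TX]) (simp add: kinner_kadj[OF bT] kinner_kadj[OF X])
  obtain C where C: "\<And>x. jnorm J (kadj X x) \<le> C * jnorm J x"
    using bounded_opE[OF bounded_op_kadj[OF X]] by metis
  have "(\<lambda>e. (jnorm J (kadj T (J e)))\<^sup>2) summable_on E"
    using trace_class_summable_jnorm[OF T E] Hilbert_Schmidt_kadj[OF signature_op signature_op E E bT]
    unfolding summable_on_def by blast
  then have "(\<lambda>e. (jnorm J (kadj X (kadj T (J e))))\<^sup>2) summable_on E"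
    by (rule jnorm_sq_summable_mono[OF _ C])
  then show ?thesis
    using Hilbert_Schmidt_from_kadj[OF TX E E] unfolding adj summable_on_def by blast
qed

text \<open>With y = A e one has [y, y] = 1/2 \<parallel>y + J y\<parallel>^2 -
  \<parallel>y\<parallel>^2, where y + J y is twice the component of y in the positive summand. Both
  squared norms have finite sums that do not depend on the basis.\<close>

lemma has_sum_kinner:
  assumes A: "bounded_op A"
    and sum: "\<And>E. orthonormal_basis J E \<Longrightarrow> (\<lambda>e. (jnorm J (A e))\<^sup>2) summable_on E"
  obtains t :: real where "\<And>E. orthonormal_basis J E \<Longrightarrow> ((\<lambda>e. kinner (A e) (A e)) has_sum of_real t) E"
proof -
  obtain E0 where E0: "orthonormal_basis J E0"
    using ex_orthonormal_basis[of "{}"] by (auto simp: orthonormal_def)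
  let ?D = "\<lambda>x. A x + J (A x)"
  have D: "bounded_op ?D" by (rule bounded_op_add[OF A bounded_op_comp[OF bounded_op_J A]])
  have sumD: "(\<lambda>e. (jnorm J (?D e))\<^sup>2) summable_on E0"
  proof (rule jnorm_sq_summable_mono[OF sum[OF E0]])
    show "jnorm J (?D e) \<le> 2 * jnorm J (A e)" for e
      using jnorm_triangle[of "A e" "J (A e)"] by simp
  qed
  obtain a where a: "((\<lambda>e. (jnorm J (A e))\<^sup>2) has_sum a) E0"
    using sum[OF E0] by (auto simp: summable_on_def)
  obtain d where d: "((\<lambda>e. (jnorm J (?D e))\<^sup>2) has_sum d) E0"
    using sumD by (auto simp: summable_on_def)
  have "((\<lambda>e. kinner (A e) (A e)) has_sum of_real (1/2 * d + (- 1) * a)) E"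
    if E: "orthonormal_basis J E" for E
  proof -
    have "((\<lambda>e. (jnorm J (?D e))\<^sup>2) has_sum d) E"
      by (rule Hilbert_Schmidt_basis_independent[OF D E0 E d])
    moreover have "((\<lambda>e. (jnorm J (A e))\<^sup>2) has_sum a) E"
      by (rule Hilbert_Schmidt_basis_independent[OF A E0 E a])
    ultimately have "((\<lambda>e. 1/2 * (jnorm J (?D e))\<^sup>2 + (- 1) * (jnorm J (A e))\<^sup>2) has_sum (1/2 * d + (- 1) * a)) E"
      by (intro has_sum_add has_sum_cmult_right)
    moreover have "1/2 * (jnorm J (?D e))\<^sup>2 + (- 1) * (jnorm J (A e))\<^sup>2 = Re (kinner (A e) (A e))" for e
      by (simp add: jnorm_add_sq kinner_eq_jinner(2) add_divide_distrib)
    ultimately have "((\<lambda>e. Re (kinner (A e) (A e))) has_sum (1/2 * d + (- 1) * a)) E" by simp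
    then show ?thesis
      by (subst kinner_self_eq) (rule has_sum_of_real)
  qed
  then show ?thesis using that by blast
qed

text \<open>The description in \<open>tr\<close> needs a value common to all orthonormal bases, and
  the existence of one basis to make that value unique. Reality of the value makes traces comparable
  in the order of the complex numbers.\<close>

lemma tr_kadj_comp:
  assumes T: "trace_class T" and X: "bounded_op X"
  obtains t :: real where "tr J (kadj X \<circ> kadj T \<circ> T \<circ> X) = of_real t"
    and "\<And>E. orthonormal_basis J E \<Longrightarrow> ((\<lambda>e. Re (kinner (T (X e)) (T (X e)))) has_sum t) E"
proof -
  have bT: "bounded_op T" using T by (simp add: trace_class_def)
  have eq: "kinner ((kadj X \<circ> kadj T \<circ> T \<circ> X) e) e = kinner (T (X e)) (T (X e))" for e
    by (simp add: kinner_kadj'[OF X] kinner_kadj'[OF bT])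
  obtain t :: real where t: "\<And>E. orthonormal_basis J E \<Longrightarrow>
      ((\<lambda>e. kinner (T (X e)) (T (X e))) has_sum of_real t) E"
    using has_sum_kinner[OF bounded_op_comp[OF bT X] trace_class_comp_summable_jnorm[OF T X]] by blast
  obtain E0 where E0: "orthonormal_basis J E0"
    using ex_orthonormal_basis[of "{}"] by (auto simp: orthonormal_def)
  have "tr J (kadj X \<circ> kadj T \<circ> T \<circ> X) = of_real t"
    unfolding tr_def eq
    by (rule the_equality) (use t E0 has_sum_unique in blast)+
  moreover have "((\<lambda>e. Re (kinner (T (X e)) (T (X e)))) has_sum t) E" if "orthonormal_basis J E" for E
    using has_sum_Re[OF t[OF that]] by simp
  ultimately show ?thesis using that by blast
qed

end

section \<open>Abstract splines\<close>

lemma kinner_eq_0I: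
  fixes x :: "'a::krein_space"
  assumes "\<And>z. kinner x z = 0"
  shows "x = 0"
proof -
  obtain J :: "'a \<Rightarrow> 'a" where "signature_op J" using ex_signature_op by blast
  then interpret signature J by unfold_locales
  have "jinner J x x = 0" using assms[of "J x"] by (simp add: jinner_def J_sym)
  then show ?thesis by simp
qed

text \<open>First and second variation: \<open>c\<close> stands for [T h, T z] and \<open>b\<close>
  for [T z, T z] when \<open>h\<close> is displaced by multiples of \<open>z\<close>. The choices 1
  and -1 cancel the linear term; real multiples of \<open>- c\<close> isolate it.\<close>

lemma complex_quadratic_nonneg:
  fixes c :: complex and b :: real
  assumes nonneg: "\<And>l. 0 \<le> 2 * Re (cnj l * c) + (cmod l)\<^sup>2 * b"
  shows "c = 0" and "0 \<le> b"
proof -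
  show b: "0 \<le> b" using nonneg[of 1] nonneg[of "-1"] by simp
  have "(cmod c)\<^sup>2 \<le> 0 * b"
  proof (rule real_quadratic_discriminant[OF _ b])
    fix t :: real
    have "(cmod c)\<^sup>2 = Re c * Re c + Im c * Im c" using cmod_power2[of c] by (simp only: power2_eq_square)
    then have "Re (cnj (- of_real t * c) * c) = - t * (cmod c)\<^sup>2"
      by (simp add: algebra_simps)
    moreover have "(cmod (- of_real t * c))\<^sup>2 = t\<^sup>2 * (cmod c)\<^sup>2"
      by (simp add: norm_mult power_mult_distrib)
    ultimately show "0 \<le> 0 - 2 * t * (cmod c)\<^sup>2 + t\<^sup>2 * ((cmod c)\<^sup>2 * b)"
      using nonneg[of "- of_real t * c"] by (simp only: mult.assoc)
  qed simp
  then show "c = 0" by simp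
qed

lemma Re_kinner_perturbation:
  assumes "clinear T"
  shows "Re (kinner (T (h + c *\<^sub>C z)) (T (h + c *\<^sub>C z)))
    = Re (kinner (T h) (T h)) + (2 * Re (cnj c * kinner (T h) (T z)) + (cmod c)\<^sup>2 * Re (kinner (T z) (T z)))"
proof -
  have "kinner (T (h + c *\<^sub>C z)) (T (h + c *\<^sub>C z)) = kinner (T h) (T h)
      + (cnj c * kinner (T h) (T z) + cnj (cnj c * kinner (T h) (T z)))
      + of_real ((cmod c)\<^sup>2) * kinner (T z) (T z)"
    by (simp add: clinear_simps[OF assms] kinner_simps kinner_commute[of "T z" "T h"]
        complex_norm_square algebra_simps del: of_real_power)
  then show ?thesis by simp
qed

context
  fixes T V :: "'a::krein_space \<Rightarrow> 'a"
  assumes T: "bounded_op T" and V: "bounded_op V"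
begin

private lemma linT: "clinear T" and linV: "clinear V"
  using T V by (simp_all add: bounded_op_clinear)

lemma nonneg_subspace_image_ker:
  "nonneg_subspace (T ` ker V) \<longleftrightarrow> (\<forall>z\<in>ker V. 0 \<le> Re (kinner (T z) (T z)))"
  by (simp add: nonneg_subspace_def kinner_nonneg_iff subspace_image subspace_ker linT linV)

lemma kinner_normal: "kinner ((kadj T \<circ> T) x) y = kinner (T x) (T y)"
  and kinner_normal': "kinner x ((kadj T \<circ> T) y) = kinner (T x) (T y)"
  by (simp_all add: kinner_kadj[OF T, symmetric] kinner_kadj'[OF T])

lemma korth_normal_image:
  "t \<in> korth ((kadj T \<circ> T) ` ker V) \<longleftrightarrow> (\<forall>z\<in>ker V. kinner (T t) (T z) = 0)"
  unfolding korth_def ball_simps mem_Collect_eq kinner_normal' by simp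

text \<open>Adding a complex multiple of a kernel vector to \<open>h\<close> changes the form by the
  expression in \<open>complex_quadratic_nonneg\<close>. Conversely, orthogonality removes the
  linear term and nonnegativity controls the rest.\<close>

lemma mem_spl_iff:
  "h \<in> spl T V h0 \<longleftrightarrow> V h = V h0 \<and> (\<forall>z\<in>ker V. kinner (T h) (T z) = 0 \<and> 0 \<le> Re (kinner (T z) (T z)))"
proof
  assume h: "h \<in> spl T V h0"
  then obtain k where k: "V k = 0" "h = h0 + k"
    and min: "\<And>z. V z = 0 \<Longrightarrow> kinner (T h) (T h) \<le> kinner (T (h0 + z)) (T (h0 + z))"
    unfolding spl_def is_minimum_def by blast
  have "kinner (T h) (T z) = 0 \<and> 0 \<le> Re (kinner (T z) (T z))" if z: "V z = 0" for z
  proof -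
    have "0 \<le> 2 * Re (cnj c * kinner (T h) (T z)) + (cmod c)\<^sup>2 * Re (kinner (T z) (T z))" for c
    proof -
      have "V (k + c *\<^sub>C z) = 0" using k z by (simp add: clinear_simps[OF linV])
      from min[OF this] have "Re (kinner (T h) (T h)) \<le> Re (kinner (T (h + c *\<^sub>C z)) (T (h + c *\<^sub>C z)))"
        by (simp add: less_eq_complex_def k add.assoc)
      then show ?thesis unfolding Re_kinner_perturbation[OF linT] by simp
    qed
    from complex_quadratic_nonneg[OF this] show ?thesis by simp
  qed
  then show "V h = V h0 \<and> (\<forall>z\<in>ker V. kinner (T h) (T z) = 0 \<and> 0 \<le> Re (kinner (T z) (T z)))"
    using k by (simp add: clinear_simps[OF linV])
next
  assume h: "V h = V h0 \<and> (\<forall>z\<in>ker V. kinner (T h) (T z) = 0 \<and> 0 \<le> Re (kinner (T z) (T z)))"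
  have le: "kinner (T h) (T h) \<le> kinner (T (h0 + z)) (T (h0 + z))" if "V z = 0" for z
  proof -
    have w: "h0 + z - h \<in> ker V" using h that by (simp add: clinear_simps[OF linV])
    have "Re (kinner (T h) (T h)) \<le> Re (kinner (T (h + 1 *\<^sub>C (h0 + z - h))) (T (h + 1 *\<^sub>C (h0 + z - h))))"
      unfolding Re_kinner_perturbation[OF linT] using h w by simp
    then show ?thesis by (simp add: less_eq_complex_def)
  qed
  have k: "h - h0 \<in> ker V" "h = h0 + (h - h0)" using h by (simp_all add: clinear_simps[OF linV])
  then show "h \<in> spl T V h0"
    unfolding spl_def is_minimum_def using le by (auto intro!: exI[of _ "h - h0"] bexI[of _ "h - h0"])
qed

lemma spl_nonempty_imp_complementable:
  assumes "\<And>h. spl T V h \<noteq> {}"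
  shows "complementable (kadj T \<circ> T) (ker V)" and "nonneg_subspace (T ` ker V)"
proof -
  show "complementable (kadj T \<circ> T) (ker V)"
    unfolding complementable_def
  proof
    fix h
    obtain g where g: "g \<in> spl T V h" using assms[of h] by blast
    then have "g \<in> korth ((kadj T \<circ> T) ` ker V)"
      unfolding korth_normal_image mem_spl_iff by blast
    moreover have "h - g \<in> ker V" using g by (simp add: mem_spl_iff clinear_simps[OF linV])
    ultimately show "\<exists>s\<in>ker V. \<exists>t\<in>korth ((kadj T \<circ> T) ` ker V). h = s + t"
      by (intro bexI[of _ "h - g"] bexI[of _ g]) auto
  qed
  show "nonneg_subspace (T ` ker V)"
    using assms[of 0] by (auto simp: mem_spl_iff nonneg_subspace_image_ker)
qed

text \<open>The linear half of the spline condition. Nonnegativity of T(ker V) is kept apart,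
  because complementability speaks about this half only.\<close>

definition spline_op :: "('a \<Rightarrow> 'a) \<Rightarrow> bool" where
  "spline_op G \<longleftrightarrow> bounded_op G \<and> (\<forall>h. V (G h) = V h) \<and> (\<forall>h. \<forall>z\<in>ker V. kinner (T (G h)) (T z) = 0)"

lemma complementable_imp_spline_op:
  assumes "complementable (kadj T \<circ> T) (ker V)"
  obtains G where "spline_op G"
proof -
  obtain J :: "'a \<Rightarrow> 'a" where "signature_op J" using ex_signature_op by blast
  then interpret signature J by unfold_locales
  note cl = closed_subspace_ker[OF V]
  let ?P = "jproj J (ker V)"
  let ?D = "\<lambda>x. ?P (J (kadj T (T x)))"
  have bP: "bounded_op ?P" by (rule bounded_op_jproj[OF cl])
  have linP: "clinear ?P" by (rule bounded_op_clinear[OF bP])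
  have bD: "bounded_op ?D"
    by (rule bounded_op_comp[OF bP bounded_op_comp[OF bounded_op_J bounded_op_comp[OF bounded_op_kadj[OF T] T]]])
  have linD: "clinear ?D" by (rule bounded_op_clinear[OF bD])
  \<comment> \<open>The kernel of \<open>?D\<close> is the companion of ker V, so complementability
    says that \<open>?D\<close> attains all its values on ker V.\<close>
  have D_iff: "?D x = 0 \<longleftrightarrow> (\<forall>z\<in>ker V. kinner (T x) (T z) = 0)" for x
  proof -
    have eq: "jinner J (?D x) z = kinner (T x) (T (?P z))" for z
      by (simp only: jproj_sym[OF cl]) (simp add: jinner_def kinner_kadj'[OF T])
    show ?thesis
    proof
      assume "?D x = 0"
      then show "\<forall>z\<in>ker V. kinner (T x) (T z) = 0"
        using eq jproj_ident[OF subspace_ker[OF linV]] by (metis jinner_zero_left)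
    next
      assume "\<forall>z\<in>ker V. kinner (T x) (T z) = 0"
      then have "jinner J (?D x) (?D x) = 0" unfolding eq using jproj_mem[OF cl] by blast
      then show "?D x = 0" by simp
    qed
  qed
  have ran: "range ?D \<subseteq> range (\<lambda>x. ?D (?P x))"
  proof
    fix y assume "y \<in> range ?D"
    then obtain h where h: "y = ?D h" by blast
    obtain s t where st: "s \<in> ker V" "t \<in> korth ((kadj T \<circ> T) ` ker V)" "h = s + t"
      using assms unfolding complementable_def by blast
    have "?D t = 0" using st(2) unfolding korth_normal_image D_iff .
    then have "?D h = ?D s" unfolding st(3) clinear_add[OF linD] by simp
    then have "y = ?D (?P s)" using h st(1) by (simp add: jproj_ident[OF subspace_ker[OF linV]])
    then show "y \<in> range (\<lambda>x. ?D (?P x))" by blast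
  qed
  obtain F where bF: "bounded_op F" and F: "\<And>x. ?D (?P (F x)) = ?D x"
    using Douglas_factorization[OF bounded_op_comp[OF bD bP] bD ran] by metis
  \<comment> \<open>G = 1 - P F: as P F takes values in ker V, composing with V changes nothing, and
    \<open>?D (?P (F x)) = ?D x\<close> puts G x into the companion.\<close>
  have "spline_op (\<lambda>x. x - ?P (F x))"
    unfolding spline_op_def
  proof (intro conjI allI)
    show "bounded_op (\<lambda>x. x - ?P (F x))"
      by (rule bounded_op_diff[OF bounded_op_id bounded_op_comp[OF bP bF]])
    show "V (x - ?P (F x)) = V x" for x
      using jproj_mem[OF cl, of "F x"] by (simp add: clinear_diff[OF linV])
    fix x
    have "?D (x - ?P (F x)) = 0"
      by (simp only: clinear_diff[OF linD] F) simp
    then show "\<forall>z\<in>ker V. kinner (T (x - ?P (F x))) (T z) = 0" unfolding D_iff .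
  qed
  then show ?thesis using that by blast
qed

lemma spline_op_mem_spl:
  assumes "spline_op G" and "nonneg_subspace (T ` ker V)"
  shows "G h \<in> spl T V h"
  using assms by (simp add: mem_spl_iff spline_op_def nonneg_subspace_image_ker)

text \<open>The difference \<open>x - y\<close> lies both in ker V and in the companion. Splitting k
  as (k - G k) + G k, the form [T (x - y), T k] vanishes on the first part because x - y is a
  companion vector, and on the second because G k is one.\<close>

lemma normal_spline_op_unique:
  assumes G: "spline_op G" and "V x = V y"
    and "\<And>z. z \<in> ker V \<Longrightarrow> kinner (T x) (T z) = 0" and "\<And>z. z \<in> ker V \<Longrightarrow> kinner (T y) (T z) = 0"
  shows "kadj T (T x) = kadj T (T y)"
proof -
  have d: "x - y \<in> ker V" using assms by (simp add: clinear_diff[OF linV])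
  have "kinner (T (x - y)) (T k) = 0" for k
  proof -
    have "k - G k \<in> ker V" using G by (simp add: spline_op_def clinear_diff[OF linV])
    with assms(3,4) have "kinner (T x) (T (k - G k)) = 0" "kinner (T y) (T (k - G k)) = 0" by blast+
    then have "kinner (T (x - y)) (T (k - G k)) = 0"
      by (simp add: clinear_diff[OF linT, of x] kinner_diff_left)
    moreover have "kinner (T (G k)) (T (x - y)) = 0" using G d unfolding spline_op_def by blast
    then have "kinner (T (x - y)) (T (G k)) = 0" using kinner_commute[of "T (x - y)" "T (G k)"] by simp
    moreover have "kinner (T (x - y)) (T k) = kinner (T (x - y)) (T (k - G k)) + kinner (T (x - y)) (T (G k))"
      by (simp add: clinear_diff[OF linT, of k] kinner_diff_right)
    ultimately show ?thesis by simp
  qed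
  then have "kadj T (T x) - kadj T (T y) = 0"
    by (intro kinner_eq_0I)
      (simp add: clinear_diff[OF linT] kinner_simps kinner_kadj'[OF T])
  then show ?thesis by simp
qed

text \<open>In the factorization \<open>b = \<bar>a\<bar>\<^sup>1\<^sup>/\<^sup>2 f\<close> one has \<open>f = - a\<^sup>1\<^sup>/\<^sup>2 G\<close>.\<close>
lemma schur_wrt_normal:
  assumes J: "signature_op J" and G: "spline_op G" and nonneg: "nonneg_subspace (T ` ker V)"
  shows "schur_wrt J (kadj T \<circ> T) (ker V) = kadj T \<circ> T \<circ> G"
proof -
  interpret signature J by standard fact
  note cl = closed_subspace_ker[OF V]
  let ?W = "kadj T \<circ> T"
  define P where "P = jproj J (ker V)"
  define Q where "Q = (\<lambda>x. x - P x)"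
  define a where "a = P \<circ> J \<circ> ?W \<circ> P"
  define b where "b = P \<circ> J \<circ> ?W \<circ> Q"
  define c where "c = Q \<circ> J \<circ> ?W \<circ> Q"
  define r where "r = sqrt_op J (abs_op J a)"
  have bP: "bounded_op P" unfolding P_def by (rule bounded_op_jproj[OF cl])
  have bG: "bounded_op G" using G by (simp add: spline_op_def)
  have bW: "bounded_op ?W" unfolding comp_def by (rule bounded_op_comp[OF bounded_op_kadj[OF T] T])
  note linP = bounded_op_clinear[OF bP] and linG = bounded_op_clinear[OF bG]
    and linW = bounded_op_clinear[OF bW]
  have P_mem: "P x \<in> ker V" for x unfolding P_def by (rule jproj_mem[OF cl])
  have P_ident: "P x = x" if "x \<in> ker V" for x
    unfolding P_def by (rule jproj_ident[OF subspace_ker[OF linV] that])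
  have P_sym: "jinner J (P x) y = jinner J x (P y)" for x y
    unfolding P_def by (rule jproj_sym[OF cl])
  have jW: "jinner J (J (?W x)) y = kinner (T x) (T y)" for x y
    by (simp only: jinner_def J_invol kinner_normal)
  have ba: "bounded_op a"
    unfolding a_def comp_assoc using bounded_op_comp[OF bP bounded_op_comp[OF bounded_op_J bounded_op_comp[OF bW bP]]]
    by (simp add: comp_def)
  have a: "jinner J (a x) y = kinner (T (P x)) (T (P y))" for x y
    unfolding a_def comp_apply[of _ P] comp_apply[of "P \<circ> J"] comp_apply[of P] P_sym jW ..
  have pos_a: "positive_op J a"
  proof (rule positive_opI[OF ba])
    show "jinner J (a x) y = jinner J x (a y)" for x y
      unfolding a using a[of y x] kinner_commute[of "T (P x)" "T (P y)"] jinner_commute[of x "a y"] by simp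
    show "0 \<le> Re (jinner J (a x) x)" for x
      unfolding a using nonneg P_mem by (simp add: nonneg_subspace_image_ker)
  qed
  have r_def': "r = sqrt_op J a" by (simp add: r_def abs_op_positive[OF pos_a])
  have pos_r: "positive_op J r" unfolding r_def' by (rule positive_op_sqrt_op[OF pos_a])
  have rr: "r (r x) = a x" for x unfolding r_def' by (rule sqrt_op_sqrt_op[OF pos_a])
  note br = positive_op_bounded[OF pos_r] and linr = positive_op_clinear[OF pos_r]
    and sym_r = positive_op_sym[OF pos_r]
  have r_eq_0: "r x = 0" if "a x = 0" for x
  proof -
    have "jinner J (r x) (r x) = jinner J (a x) x" by (simp add: sym_r flip: rr)
    then show ?thesis using that by simp
  qed
  have PJWG: "P (J (?W (G x))) = 0" for x
  proof -
    have "jinner J (P (J (?W (G x)))) y = 0" for y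
      unfolding P_sym jW using G P_mem unfolding spline_op_def by blast
    from this[of "P (J (?W (G x)))"] show ?thesis by simp
  qed
  have QG: "Q x + P (G x) = G x" for x
  proof -
    have "P (x - G x) = x - G x" using G by (intro P_ident) (simp add: spline_op_def clinear_diff[OF linV])
    then show ?thesis by (simp add: Q_def clinear_diff[OF linP] algebra_simps)
  qed
  \<comment> \<open>Since G x - x lies in ker V, G x has the components P G x and Q x; P J W
    annihilates their sum.\<close>
  have b: "b x = - a (G x)" for x
  proof -
    have "b x + a (G x) = P (J (?W (Q x + P (G x))))"
      by (simp only: a_def b_def comp_apply[of _ P] comp_apply[of _ Q] comp_apply[of "P \<circ> J"]
          comp_apply[of P] clinear_add[OF linP] clinear_add[OF clinear_J] clinear_add[OF linW])
    then show ?thesis using PJWG[of x] by (simp add: QG eq_neg_iff_add_eq_0)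
  qed
  define f where "f = (\<lambda>x. - r (G x))"
  have bf: "bounded_op f"
    unfolding f_def using bounded_op_scale[OF bounded_op_comp[OF br bG], of "-1"] by simp
  have f_eq: "f x = r (- G x)" for x by (simp add: f_def clinear_minus[OF linr])
  have ran_orth: "r x \<in> jorth J (ker r)" for x by (simp add: jorth_def sym_r)
  have ker_r: "ker r = ker a"
    using r_eq_0 rr clinear_zero[OF linr] by (auto, metis)
  have the_f: "(THE f. bounded_op f \<and> b = r \<circ> f \<and> range f \<subseteq> jtopology J closure_of range r) = f"
  proof (rule the_equality, intro conjI)
    show "b = r \<circ> f" by (simp add: fun_eq_iff b f_def clinear_minus[OF linr] rr)
    have "f x \<in> jtopology J closure_of range r" for x
      unfolding jtopology_closure_of f_eq by (intro CollectI allI impI bexI[of _ "r (- G x)"]) simp_all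
    then show "range f \<subseteq> jtopology J closure_of range r" by blast
    fix f' assume f': "bounded_op f' \<and> b = r \<circ> f' \<and> range f' \<subseteq> jtopology J closure_of range r"
    show "f' = f"
    proof
      fix x
      \<comment> \<open>Two solutions differ by an element of ker r, so it remains to see that the
        closure of the range of \<open>r\<close> is orthogonal to ker r. The summand 1 in the
        denominator covers \<open>k = 0\<close>.\<close>
      have "f' x \<in> jorth J (ker r)"
        unfolding jorth_def
      proof (intro CollectI ballI)
        fix k assume k: "k \<in> ker r"
        have "cmod (jinner J (f' x) k) \<le> 0 + e" if e: "e > 0" for e
        proof -
          have pos: "0 < jnorm J k + 1" by (simp add: add_nonneg_pos)
          then have "0 < e / (jnorm J k + 1)" using e by simp
          then obtain y where y: "jnorm J (f' x - r y) < e / (jnorm J k + 1)"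
            using f' unfolding jtopology_closure_of by blast
          have "jinner J (f' x) k = jinner J (f' x - r y) k"
            using k by (simp add: jinner_diff_left sym_r)
          also have "cmod \<dots> \<le> jnorm J (f' x - r y) * jnorm J k" by (rule jinner_Cauchy_Schwarz)
          also have "\<dots> \<le> e / (jnorm J k + 1) * jnorm J k" using y by (intro mult_right_mono) auto
          also have "\<dots> \<le> e" using e pos by (simp add: pos_divide_le_eq distrib_left)
          finally show ?thesis by simp
        qed
        then have "cmod (jinner J (f' x) k) \<le> 0" by (rule field_le_epsilon)
        then show "jinner J (f' x) k = 0" by simp
      qed
      then have "f' x - f x \<in> jorth J (ker r)"
        unfolding f_eq by (rule cvec.subspace_diff[OF subspace_jorth _ ran_orth])
      moreover have "r (f' x) = b x" using f' by auto
      then have "f' x - f x \<in> ker r"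
        by (simp add: clinear_simps[OF linr] f_eq b rr)
      ultimately show "f' x = f x" using jorth_Int[of "f' x - f x" "ker r"] by simp
    qed
  qed (use bf in simp)
  \<comment> \<open>Values of \<open>f\<close> lie in the range of \<open>r\<close>, hence in the
    orthogonal complement of ker r = ker a, where the polar factor of \<open>a\<close> is the
    identity.\<close>
  have uf: "polar_op J a (f x) = f x" for x
    unfolding polar_op_positive[OF pos_a] f_eq ker_r[symmetric]
    using jproj_eq_0[OF subspace_ker[OF linr] ran_orth] by simp
  have jadj_f: "jadj J f (f x) = - Q (J (?W (P (G x))))" for x
  proof (rule jinner_eqI)
    fix z
    have "jinner J z (jadj J f (f x)) = jinner J (a (G z)) (G x)"
      unfolding jinner_jadj[OF bf, symmetric]
      by (simp add: f_def sym_r[of "r (G z)" "G x"] flip: rr)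
    also have "\<dots> = - jinner J (b z) (G x)" by (simp add: b)
    also have "\<dots> = - kinner (T (Q z)) (T (P (G x)))"
      unfolding b_def comp_apply[of _ Q] comp_apply[of "P \<circ> J"] comp_apply[of P] P_sym jW ..
    also have "kinner (T (Q z)) (T (P (G x))) = jinner J (Q z) (J (?W (P (G x))))"
      by (simp only: kinner_eq_jinner(2)[symmetric] kinner_normal')
    also have "\<dots> = jinner J z (Q (J (?W (P (G x)))))"
      by (simp only: Q_def jinner_diff_left jinner_diff_right P_sym)
    finally show "jinner J z (jadj J f (f x)) = jinner J z (- Q (J (?W (P (G x)))))" by simp
  qed
  have linQ: "clinear Q" unfolding Q_def
    by (rule bounded_op_clinear) (rule bounded_op_diff[OF bounded_op_id bP])
  \<comment> \<open>Q J W P G x added to c x = Q J W Q x gives Q J W G x, which equals J W G x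
    because P J W G = 0.\<close>
  have "J (c x - jadj J f (polar_op J a (f x))) = (?W \<circ> G) x" for x
  proof -
    have "c x - jadj J f (polar_op J a (f x)) = Q (J (?W (Q x + P (G x))))"
      by (simp only: uf jadj_f c_def comp_apply[of _ Q] comp_apply[of "Q \<circ> J"]
          comp_apply[of Q] clinear_add[OF linQ] clinear_add[OF clinear_J] clinear_add[OF linW])
        simp
    also have "\<dots> = J (?W (G x))" unfolding QG by (simp add: Q_def PJWG del: comp_apply)
    finally show ?thesis by simp
  qed
  moreover have "schur_wrt J ?W (ker V) = J \<circ> (\<lambda>x. c x - jadj J f (polar_op J a (f x)))"
    unfolding schur_wrt_def Let_def P_def[symmetric] Q_def[symmetric] a_def[symmetric]
      b_def[symmetric] c_def[symmetric] r_def[symmetric] the_f ..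
  ultimately show ?thesis by (simp add: fun_eq_iff)
qed

text \<open>The value found for each \<open>J\<close> does not involve \<open>J\<close>, which is
  the independence that the description in \<open>schur\<close> asks for.\<close>

lemma schur_normal:
  assumes "spline_op G" and "nonneg_subspace (T ` ker V)"
  shows "schur (kadj T \<circ> T) (ker V) = kadj T \<circ> T \<circ> G"
  unfolding schur_def
proof (rule the_equality)
  show "\<forall>J. signature_op J \<longrightarrow> kadj T \<circ> T \<circ> G = schur_wrt J (kadj T \<circ> T) (ker V)"
    using schur_wrt_normal assms by simp
  fix C assume "\<forall>J. signature_op J \<longrightarrow> C = schur_wrt J (kadj T \<circ> T) (ker V)"
  then show "C = kadj T \<circ> T \<circ> G"
    using ex_signature_op schur_wrt_normal[OF _ assms] by metis
qed

end

section \<open>Minimizing the trace\<close>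

lemma (in signature) tr_mono:
  assumes T: "trace_class T" and X: "bounded_op X" and Y: "bounded_op Y"
    and le: "\<And>e. Re (kinner (T (X e)) (T (X e))) \<le> Re (kinner (T (Y e)) (T (Y e)))"
  shows "tr J (kadj X \<circ> kadj T \<circ> T \<circ> X) \<le> tr J (kadj Y \<circ> kadj T \<circ> T \<circ> Y)"
proof -
  obtain E where E: "orthonormal_basis J E"
    using ex_orthonormal_basis[of "{}"] by (auto simp: orthonormal_def)
  obtain t where t: "tr J (kadj X \<circ> kadj T \<circ> T \<circ> X) = of_real t"
    "((\<lambda>e. Re (kinner (T (X e)) (T (X e)))) has_sum t) E"
    using tr_kadj_comp[OF T X] E by metis
  obtain u where u: "tr J (kadj Y \<circ> kadj T \<circ> T \<circ> Y) = of_real u"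
    "((\<lambda>e. Re (kinner (T (Y e)) (T (Y e)))) has_sum u) E"
    using tr_kadj_comp[OF T Y] E by metis
  have "t \<le> u" by (rule has_sum_mono[OF t(2) u(2) le])
  then show ?thesis by (simp add: t u less_eq_complex_def)
qed

lemma (in signature) bounded_op_rank_one: "bounded_op (\<lambda>x. jinner J x e *\<^sub>C z)"
proof (rule bounded_opI)
  show "clinear (\<lambda>x. jinner J x e *\<^sub>C z)"
    by (simp add: clinear_iff jinner_simps scaleC_add_left)
  show "jnorm J (jinner J x e *\<^sub>C z) \<le> (jnorm J e * jnorm J z) * jnorm J x" for x
    using mult_right_mono[OF jinner_Cauchy_Schwarz[of x e], of "jnorm J z"]
    by (simp add: mult.commute mult.left_commute)
qed

text \<open>
  Perturbing the minimizer \<open>X\<close> of the problem \<open>V X = V\<close> by rank one operators \<open>c \<langle>\<cdot>, e\<rangle> z\<close> with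
  \<open>z \<in> ker V\<close>, for a basis element \<open>e\<close>, shows that \<open>X e\<close> solves the spline problem for \<open>e\<close>.
\<close>
lemma trace_minimum_imp_complementable:
  fixes T V :: "'a::krein_space \<Rightarrow> 'a"
  assumes T: "trace_class T" and V: "bounded_op V" and J: "signature_op J"
    and min: "is_minimum m (trace_values J T V V)"
  shows "complementable (kadj T \<circ> T) (ker V)"
proof -
  interpret signature J by standard fact
  have bT: "bounded_op T" using T by (simp add: trace_class_def)
  note linT = bounded_op_clinear[OF bT] and linV = bounded_op_clinear[OF V]
  obtain X where X: "bounded_op X" "V \<circ> X = V" and m: "m = tr J (kadj X \<circ> kadj T \<circ> T \<circ> X)"
    using min unfolding is_minimum_def trace_values_def by blast
  have le: "m \<le> tr J (kadj Y \<circ> kadj T \<circ> T \<circ> Y)" if "bounded_op Y" "V \<circ> Y = V" for Y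
    using min that unfolding is_minimum_def trace_values_def by blast
  have VX: "V (X x) = V x" for x using X(2) by (metis comp_apply)
  have linX: "clinear X" by (rule bounded_op_clinear[OF X(1)])
  have orth: "kinner (T (X e)) (T z) = 0" if e: "jnorm J e = 1" and z: "z \<in> ker V" for e z
  proof -
    have "orthonormal {e}" using e by (simp add: orthonormal_def jinner_self)
    \<comment> \<open>Extending \<open>{e}\<close> to a basis confines the effect of the rank one
      perturbation to the single summand at \<open>e\<close>.\<close>
    then obtain E where E: "orthonormal_basis J E" "e \<in> E"
      using ex_orthonormal_basis by blast
    obtain t where t: "m = of_real t" "((\<lambda>e. Re (kinner (T (X e)) (T (X e)))) has_sum t) E"
      using tr_kadj_comp[OF T X(1)] E(1) m by metis
    have "0 \<le> 2 * Re (cnj c * kinner (T (X e)) (T z)) + (cmod c)\<^sup>2 * Re (kinner (T z) (T z))" for c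
    proof -
      let ?v = "2 * Re (cnj c * kinner (T (X e)) (T z)) + (cmod c)\<^sup>2 * Re (kinner (T z) (T z))"
      define Y where "Y = (\<lambda>x. X x + c *\<^sub>C jinner J x e *\<^sub>C z)"
      have bY: "bounded_op Y"
        unfolding Y_def by (rule bounded_op_add[OF X(1) bounded_op_scale[OF bounded_op_rank_one]])
      have "V \<circ> Y = V" using z by (simp add: fun_eq_iff Y_def clinear_simps[OF linV] VX)
      note le = le[OF bY this]
      obtain u where u: "tr J (kadj Y \<circ> kadj T \<circ> T \<circ> Y) = of_real u"
        "((\<lambda>e. Re (kinner (T (Y e)) (T (Y e)))) has_sum u) E"
        using tr_kadj_comp[OF T bY] E(1) by metis
      \<comment> \<open>The change of the sum, written as a family supported at \<open>e\<close>:
        the trace grows by exactly \<open>?v\<close>, which minimality then forces to be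
        nonnegative.\<close>
      have "((\<lambda>f. if f = e then ?v else 0) has_sum ?v) E"
      proof (rule iffD2[OF has_sum_cong_neutral])
        show "((\<lambda>f. if f = e then ?v else 0) has_sum ?v) {e}" by (rule has_sum_finiteI) simp_all
      qed (use E(2) in auto)
      from has_sum_add[OF t(2) this]
      have "((\<lambda>f. Re (kinner (T (Y f)) (T (Y f)))) has_sum (t + ?v)) E"
      proof (rule has_sum_cong[THEN iffD1, rotated])
        fix f assume f: "f \<in> E"
        then have "jinner J f e = (if f = e then 1 else 0)"
          using E unfolding orthonormal_basis_def by blast
        then show "Re (kinner (T (X f)) (T (X f))) + (if f = e then ?v else 0)
            = Re (kinner (T (Y f)) (T (Y f)))"
          using Re_kinner_perturbation[OF linT, of "X e" c z] by (auto simp: Y_def)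
      qed
      with u(2) have "u = t + ?v" by (rule has_sum_unique)
      moreover have "t \<le> u" using le by (simp add: t(1) u(1) less_eq_complex_def)
      ultimately show "0 \<le> ?v" by simp
    qed
    then show ?thesis by (rule complex_quadratic_nonneg(1))
  qed
  show ?thesis
    unfolding complementable_def
  proof
    fix h
    \<comment> \<open>Linearity extends the orthogonality from unit vectors to all \<open>h\<close>;
      then h = (h - X h) + X h is the required splitting.\<close>
    have "kinner (T (X h)) (T z) = 0" if z: "z \<in> ker V" for z
    proof (cases "h = 0")
      case False
      then have pos: "0 < jnorm J h" by (rule jnorm_pos)
      have "jnorm J (of_real (1 / jnorm J h) *\<^sub>C h) = 1"
        using pos False by (simp add: norm_divide)
      from orth[OF this z] pos False show ?thesis
        by (simp add: clinear_simps[OF linX] clinear_simps[OF linT] kinner_simps)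
    qed (simp add: clinear_zero[OF linX] clinear_zero[OF linT])
    then have "X h \<in> korth ((kadj T \<circ> T) ` ker V)"
      unfolding korth_normal_image[OF bT V] by blast
    moreover have "h - X h \<in> ker V" by (simp add: clinear_diff[OF linV] VX)
    ultimately show "\<exists>s\<in>ker V. \<exists>t\<in>korth ((kadj T \<circ> T) ` ker V). h = s + t"
      by (intro bexI[of _ "h - X h"] bexI[of _ "X h"]) simp_all
  qed
qed

text \<open>The equation sees X only through P X, while V X = B fixes the component orthogonal to
  ker V as Y. Together P X + Y = X, and the equation says that X takes values in the companion; so G
  Y is a solution.\<close>

lemma trace_minimum:
  fixes T V :: "'a::krein_space \<Rightarrow> 'a"
  assumes T: "trace_class T" and V: "bounded_op V" and J: "signature_op J"
    and B: "bounded_op B" "range B \<subseteq> range V"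
    and G: "spline_op T V G" and nonneg: "nonneg_subspace (T ` ker V)"
  defines "P \<equiv> jproj J (ker V)" and "Y \<equiv> mp_inv J V \<circ> B"
  defines "solution \<equiv> \<lambda>X. bounded_op X \<and> V \<circ> X = B \<and>
    (\<forall>h. (kadj P \<circ> kadj T \<circ> T) (P (X h) + Y h) = 0)"
  shows "\<exists>X. solution X"
    and "solution X \<Longrightarrow> tr J (kadj X \<circ> kadj T \<circ> T \<circ> X) = tr J (kadj Y \<circ> schur (kadj T \<circ> T) (ker V) \<circ> Y)"
    and "is_minimum (tr J (kadj Y \<circ> schur (kadj T \<circ> T) (ker V) \<circ> Y)) (trace_values J T V B)"
proof -
  interpret signature J by standard fact
  have bT: "bounded_op T" using T by (simp add: trace_class_def)
  note linT = bounded_op_clinear[OF bT] and linV = bounded_op_clinear[OF V]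
  note cl = closed_subspace_ker[OF V]
  have bG: "bounded_op G" and VG: "\<And>h. V (G h) = V h"
    and TG: "\<And>h z. z \<in> ker V \<Longrightarrow> kinner (T (G h)) (T z) = 0"
    using G by (simp_all add: spline_op_def[OF bT V])
  obtain F where F: "bounded_op F" "\<And>x. V (F x) = B x" "\<And>x. F x \<in> jorth J (ker V)"
    using Douglas_factorization[OF V B] by metis
  \<comment> \<open>The Douglas factor is orthogonal to ker V and hence is the Moore-Penrose
    solution; this is where boundedness of \<open>Y\<close> comes from.\<close>
  have "Y = F" unfolding Y_def by (simp add: fun_eq_iff mp_inv_eqI[OF linV F(2,3)])
  with F have bY: "bounded_op Y" and VY: "\<And>x. V (Y x) = B x" and Y: "\<And>x. Y x \<in> jorth J (ker V)"
    by simp_all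
  have bP: "bounded_op P" unfolding P_def by (rule bounded_op_jproj[OF cl])
  have solution_iff: "solution X \<longleftrightarrow>
      bounded_op X \<and> (\<forall>h. V (X h) = B h) \<and> (\<forall>h. \<forall>z\<in>ker V. kinner (T (X h)) (T z) = 0)" for X
  proof -
    have split: "P (X h) + Y h = X h" if VX: "\<And>h. V (X h) = B h" for h
    proof -
      have "P (X h) = X h - Y h"
        unfolding P_def
        by (rule jproj_eqI[OF subspace_ker[OF linV]]) (simp_all add: clinear_diff[OF linV] VX VY Y)
      then show ?thesis by simp
    qed
    have "(kadj P \<circ> kadj T \<circ> T) x = 0 \<longleftrightarrow> (\<forall>z\<in>ker V. kinner (T x) (T z) = 0)" for x
    proof -
      have eq: "kinner ((kadj P \<circ> kadj T \<circ> T) x) z = kinner (T x) (T (P z))" for z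
        by (simp add: kinner_kadj'[OF bP] kinner_kadj'[OF bT])
      have P_mem: "P z \<in> ker V" for z unfolding P_def by (rule jproj_mem[OF cl])
      have P_ident: "P z = z" if "z \<in> ker V" for z
        unfolding P_def by (rule jproj_ident[OF subspace_ker[OF linV] that])
      show ?thesis
      proof
        assume "(kadj P \<circ> kadj T \<circ> T) x = 0"
        then show "\<forall>z\<in>ker V. kinner (T x) (T z) = 0" using eq P_ident by (metis kinner_zero_left)
      next
        assume "\<forall>z\<in>ker V. kinner (T x) (T z) = 0"
        then show "(kadj P \<circ> kadj T \<circ> T) x = 0"
          using P_mem by (intro kinner_eq_0I) (simp only: eq)
      qed
    qed
    then show ?thesis
      unfolding solution_def using split by (auto simp: fun_eq_iff simp del: comp_apply) (auto simp: fun_eq_iff)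
  qed
  have sol: "solution (\<lambda>x. G (Y x))"
    unfolding solution_iff using bounded_op_comp[OF bG bY] VG VY TG by simp
  then show "\<exists>X. solution X" by blast
  show eq: "tr J (kadj X \<circ> kadj T \<circ> T \<circ> X) = tr J (kadj Y \<circ> schur (kadj T \<circ> T) (ker V) \<circ> Y)"
    if "solution X" for X
  proof -
    have bX: "bounded_op X" and VX: "\<And>h. V (X h) = B h"
      and TX: "\<And>h z. z \<in> ker V \<Longrightarrow> kinner (T (X h)) (T z) = 0"
      using that unfolding solution_iff by blast+
    \<comment> \<open>X h and G (Y h) are companion vectors with the same image under V, so T^# T
      does not distinguish them.\<close>
    have "kadj T (T (G (Y h))) = kadj T (T (X h))" for h
      by (rule normal_spline_op_unique[OF bT V G]) (simp_all add: VG VX VY TG TX)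
    then have "(kadj Y \<circ> schur (kadj T \<circ> T) (ker V) \<circ> Y) h = kadj Y (kadj T (T (X h)))" for h
      by (simp add: schur_normal[OF bT V G nonneg])
    \<comment> \<open>Y^# may be replaced by X^#, because X h is a companion vector and Y k - X k
      lies in ker V. Thus the operators under the two traces coincide, not only the traces.\<close>
    also have "kadj Y (kadj T (T (X h))) = kadj X (kadj T (T (X h)))" for h
    proof -
      have "kinner (kadj Y (kadj T (T (X h))) - kadj X (kadj T (T (X h)))) k = kinner (T (X h)) (T (Y k - X k))" for k
        by (simp add: kinner_diff_left kinner_kadj'[OF bY] kinner_kadj'[OF bX] kinner_kadj'[OF bT]
            clinear_diff[OF linT] kinner_diff_right)
      also have "\<dots> k = 0" for k
        by (rule TX) (simp add: clinear_diff[OF linV] VX VY)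
      finally show ?thesis using kinner_eq_0I by (metis eq_iff_diff_eq_0)
    qed
    finally have "kadj Y \<circ> schur (kadj T \<circ> T) (ker V) \<circ> Y = kadj X \<circ> kadj T \<circ> T \<circ> X"
      by (simp add: fun_eq_iff)
    then show ?thesis by simp
  qed
  show "is_minimum (tr J (kadj Y \<circ> schur (kadj T \<circ> T) (ker V) \<circ> Y)) (trace_values J T V B)"
    unfolding is_minimum_def eq[OF sol, symmetric]
  proof (intro conjI ballI)
    let ?X = "\<lambda>x. G (Y x)"
    have bX: "bounded_op ?X" by (rule bounded_op_comp[OF bG bY])
    have "V \<circ> ?X = B" by (simp add: fun_eq_iff VG VY)
    with bX show "tr J (kadj ?X \<circ> kadj T \<circ> T \<circ> ?X) \<in> trace_values J T V B"
      unfolding trace_values_def by blast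
    fix a assume "a \<in> trace_values J T V B"
    then obtain Z where Z: "bounded_op Z" "V \<circ> Z = B" and a: "a = tr J (kadj Z \<circ> kadj T \<circ> T \<circ> Z)"
      unfolding trace_values_def by blast
    have VZ: "V (Z x) = B x" for x using Z(2) by (metis comp_apply)
    show "tr J (kadj ?X \<circ> kadj T \<circ> T \<circ> ?X) \<le> a"
      unfolding a
    proof (rule tr_mono[OF T bX Z(1)])
      fix e
      \<comment> \<open>A competitor differs from the minimizer by a vector of ker V at each
        \<open>e\<close>; the mixed term vanishes and the square is nonnegative, so the comparison
        holds summand by summand.\<close>
      have w: "Z e - ?X e \<in> ker V" by (simp add: clinear_diff[OF linV] VG VY VZ)
      have "Re (kinner (T (?X e)) (T (?X e)))
          \<le> Re (kinner (T (?X e + 1 *\<^sub>C (Z e - ?X e))) (T (?X e + 1 *\<^sub>C (Z e - ?X e))))"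
        unfolding Re_kinner_perturbation[OF linT]
        using TG[OF w] w nonneg by (simp add: nonneg_subspace_image_ker[OF bT V])
      then show "Re (kinner (T (?X e)) (T (?X e))) \<le> Re (kinner (T (Z e)) (T (Z e)))" by simp
    qed
  qed
qed

theorem theorem4p4:
  fixes T V :: "'a::krein_space \<Rightarrow> 'a"
  assumes "krein_separable TYPE('a)" and "trace_class T" and "bounded_op V"
  shows
    "((\<forall>J B\<^sub>0. signature_op J \<longrightarrow> bounded_op B\<^sub>0 \<longrightarrow> range B\<^sub>0 \<subseteq> range V \<longrightarrow>
          (\<exists>m. is_minimum m (trace_values J T V B\<^sub>0)))
        \<and> nonneg_subspace (T ` ker V)
      \<longleftrightarrow> (\<exists>G. bounded_op G \<and> (\<forall>h. G h \<in> spl T V h)))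
     \<and> ((\<exists>G. bounded_op G \<and> (\<forall>h. G h \<in> spl T V h))
      \<longleftrightarrow> complementable (T\<^sup># \<circ> T) (ker V) \<and> nonneg_subspace (T ` ker V))
     \<and> (complementable (T\<^sup># \<circ> T) (ker V) \<and> nonneg_subspace (T ` ker V)
      \<longleftrightarrow> (\<forall>h\<^sub>0. spl T V h\<^sub>0 \<noteq> {}))
     \<and> ((\<forall>h\<^sub>0. spl T V h\<^sub>0 \<noteq> {}) \<longrightarrow>
        (\<forall>J B\<^sub>0. signature_op J \<longrightarrow> bounded_op B\<^sub>0 \<longrightarrow> range B\<^sub>0 \<subseteq> range V \<longrightarrow>
          (let P = jproj J (ker V);
               Y = mp_inv J V \<circ> B\<^sub>0;
               solution = (\<lambda>X\<^sub>0. bounded_op X\<^sub>0 \<and> V \<circ> X\<^sub>0 = B\<^sub>0 \<and>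
                 (\<forall>h. (P\<^sup># \<circ> T\<^sup># \<circ> T) (P (X\<^sub>0 h) + Y h) = 0))
           in is_minimum (tr J (Y\<^sup># \<circ> schur (T\<^sup># \<circ> T) (ker V) \<circ> Y)) (trace_values J T V B\<^sub>0)
            \<and> (\<exists>X\<^sub>0. solution X\<^sub>0)
            \<and> (\<forall>X\<^sub>0. solution X\<^sub>0 \<longrightarrow>
                tr J (X\<^sub>0\<^sup># \<circ> T\<^sup># \<circ> T \<circ> X\<^sub>0)
                  = tr J (Y\<^sup># \<circ> schur (T\<^sup># \<circ> T) (ker V) \<circ> Y)))))"
    (is "(?min \<and> ?nonneg \<longleftrightarrow> ?op) \<and> (_ \<longleftrightarrow> ?comp \<and> _) \<and> (_ \<longleftrightarrow> ?spl) \<and> (_ \<longrightarrow> ?formula)")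
proof -
  have T: "bounded_op T" using assms(2) by (simp add: trace_class_def)
  note V = assms(3)
  have op_imp_spl: "?op \<Longrightarrow> ?spl" by blast
  have spl_imp_comp: "?spl \<Longrightarrow> ?comp \<and> ?nonneg"
    using spl_nonempty_imp_complementable[OF T V] by blast
  have comp_imp_op: "?comp \<and> ?nonneg \<Longrightarrow> ?op"
    using complementable_imp_spline_op[OF T V] spline_op_mem_spl[OF T V] spline_op_def[OF T V] by metis
  have min_imp_comp: "?comp" if ?min
  proof -
    \<comment> \<open>The instance \<open>B\<^sub>0 = V\<close>, whose range condition is trivial,
      provides the minimizer that is perturbed.\<close>
    obtain J :: "'a \<Rightarrow> 'a" where "signature_op J" using ex_signature_op by blast
    then show ?thesis
      using that V trace_minimum_imp_complementable[OF assms(2) V] by blast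
  qed
  have formula: "?formula" if comp: "?comp \<and> ?nonneg"
    unfolding Let_def
  proof (intro allI impI)
    fix J B\<^sub>0 :: "'a \<Rightarrow> 'a"
    assume JB: "signature_op J" "bounded_op B\<^sub>0" "range B\<^sub>0 \<subseteq> range V"
    obtain G where "spline_op T V G" using complementable_imp_spline_op[OF T V] comp by blast
    note min = trace_minimum[OF assms(2) V JB this conjunct2[OF comp]]
    show "is_minimum (tr J ((mp_inv J V \<circ> B\<^sub>0)\<^sup># \<circ> schur (T\<^sup># \<circ> T) (ker V) \<circ> (mp_inv J V \<circ> B\<^sub>0)))
          (trace_values J T V B\<^sub>0)
        \<and> (\<exists>X\<^sub>0. bounded_op X\<^sub>0 \<and> V \<circ> X\<^sub>0 = B\<^sub>0 \<and>
            (\<forall>h. ((jproj J (ker V))\<^sup># \<circ> T\<^sup># \<circ> T) (jproj J (ker V) (X\<^sub>0 h) + (mp_inv J V \<circ> B\<^sub>0) h) = 0))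
        \<and> (\<forall>X\<^sub>0. bounded_op X\<^sub>0 \<and> V \<circ> X\<^sub>0 = B\<^sub>0 \<and>
            (\<forall>h. ((jproj J (ker V))\<^sup># \<circ> T\<^sup># \<circ> T) (jproj J (ker V) (X\<^sub>0 h) + (mp_inv J V \<circ> B\<^sub>0) h) = 0)
          \<longrightarrow> tr J (X\<^sub>0\<^sup># \<circ> T\<^sup># \<circ> T \<circ> X\<^sub>0)
            = tr J ((mp_inv J V \<circ> B\<^sub>0)\<^sup># \<circ> schur (T\<^sup># \<circ> T) (ker V) \<circ> (mp_inv J V \<circ> B\<^sub>0)))"
      using min by blast
  qed
  have comp_imp_min: "?min" if "?comp \<and> ?nonneg"
    using formula[OF that] unfolding Let_def by blast
  show ?thesis
    using op_imp_spl spl_imp_comp comp_imp_op min_imp_comp formula comp_imp_min by argo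
qed

end
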